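(* Let $f$ be a (linearly nondegenerate) holomorphic curve of $S^2$ into $\mathbb{CP}^n$. Suppose $f$ has exactly two ramificated points $P_1$ and $P_2$, and let $\gamma_j(P_i)$ be the ramification index of $f_j$ at $P_i$, where $f_j$ is the $j$-th associated curve of $f$, $1\le j\le n$. Then $\gamma_j(P_1)=\gamma_{n+1-j}(P_2)$ for all $1\le j\le n$. Furthermore, if $f$ and $g$ are two such curves with the same ramificated points and the same ramification indices, then $g$ can be obtained from $f$ by a linear map of $\mathbb{CP}^n$ (i.e. by a projective linear transformation).
   Context: $S^2=\mathbb C\cup\{\infty\}$. For a holomorphic curve $f:S^2\to\mathbb{CP}^n$ with local holomorphic lift $\nu$ to $\mathbb C^{n+1}\setminus\{0\}$, the $k$-th associated curve ($1\le k\le n$) is $f_k=[\nu\wedge\nu'\wedge\cdots\wedge\nu^{(k-1)}]:S^2\to G(k,n+1)\subset\mathbb{CP}^{N_k-1}$, $N_k=\binom{n+1}{k}$ (Plücker embedding), so $f_1=f$; it is extended holomorphically across points where the wedge vanishes. Let $\omega_k$ be the Fubini–Study metric on $G(k,n+1)\subset\mathbb{CP}^{N_k-1}$. In a local coordinate $z$ near $p$, $f_k^*(\omega_k)=|z-p|^{2\gamma_k(p)}h(z)\,dz\wedge d\bar z$ up to a constant factor, with $h>0$ at $p$; the nonnegative integer $\gamma_k(p)$ is the ramification index of $f_k$ at $p$. The point $p$ is a ramificated point of $f$ if $\gamma_k(p)>0$ for some $1\le k\le n$. Linearly nondegenerate means the image is not contained in a proper projective linear subspace. *)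

theory Defs
  imports
    "HOL-Complex_Analysis.Complex_Analysis"
    "Jordan_Normal_Form.VS_Connect"
begin

hide_const (open) Finite_Cartesian_Product.vec Determinants.det
no_notation Finite_Cartesian_Product.vec_nth (infixl \<open>$\<close> 90)
no_notation inner (infix \<open>\<bullet>\<close> 70)

section \<open>The Riemann sphere and complex projective space\<close>

datatype riemann_sphere = Plane complex | Infty

text \<open>Inverse of the standard local coordinate centred at a point: this coordinate is \<open>z - p\<close>
  at a finite point \<open>p\<close> and \<open>1 / z\<close> at \<open>\<infinity>\<close>.\<close>

fun param :: "riemann_sphere \<Rightarrow> complex \<Rightarrow> riemann_sphere" where
  "param (Plane p) t = Plane (p + t)"
| "param Infty t = (if t = 0 then Infty else Plane (1 / t))"

text \<open>Points of the projective space of \<open>\<complex>\<^sup>N\<close> (of dimension \<open>N - 1\<close>) are classes of nonzero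
  vectors modulo nonzero scalars. All notions below are indexed by the dimension \<open>N\<close> of the
  vector space, so that \<open>\<complex>\<P>\<^sup>n\<close> is \<open>proj_space (Suc n)\<close>.\<close>

definition proj_class :: "complex vec \<Rightarrow> complex vec set" where
  "proj_class v = {c \<cdot>\<^sub>v v | c. c \<noteq> 0}"

definition proj_space :: "nat \<Rightarrow> complex vec set set" where
  "proj_space N = proj_class ` (carrier_vec N - {0\<^sub>v N})"


section \<open>Holomorphic curves\<close>

definition local_lift ::
  "nat \<Rightarrow> (riemann_sphere \<Rightarrow> complex vec set) \<Rightarrow> riemann_sphere \<Rightarrow> real \<Rightarrow> (complex \<Rightarrow> complex vec) \<Rightarrow> bool"
  where
  "local_lift N F p r \<nu> \<longleftrightarrow>
     r > 0 \<and>
     (\<forall>t \<in> ball 0 r. \<nu> t \<in> carrier_vec N \<and> \<nu> t \<noteq> 0\<^sub>v N \<and> F (param p t) = proj_class (\<nu> t)) \<and>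
     (\<forall>i < N. (\<lambda>t. \<nu> t $ i) holomorphic_on ball 0 r)"

definition holomorphic_curve :: "nat \<Rightarrow> (riemann_sphere \<Rightarrow> complex vec set) \<Rightarrow> bool" where
  "holomorphic_curve N F \<longleftrightarrow> range F \<subseteq> proj_space N \<and> (\<forall>p. \<exists>r \<nu>. local_lift N F p r \<nu>)"

definition linearly_nondegenerate :: "nat \<Rightarrow> (riemann_sphere \<Rightarrow> complex vec set) \<Rightarrow> bool" where
  "linearly_nondegenerate N F \<longleftrightarrow>
     \<not> (\<exists>W. VectorSpace.subspace class_ring W (module_vec TYPE(complex) N) \<and>
            W \<noteq> carrier_vec N \<and> (\<forall>p. F p \<subseteq> W))"


section \<open>Associated curves\<close>

text \<open>The \<open>k\<close>-element subsets of \<open>{0..<N}\<close>, each listed in increasing order.\<close>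

definition combinations :: "nat \<Rightarrow> nat \<Rightarrow> nat list list" where
  "combinations N k = filter (\<lambda>I. length I = k) (subseqs [0..<N])"

lemma length_combinations: "length (combinations N k) = N choose k"
proof -
  have d: "distinct (map set (subseqs [0..<N]))"
    by (simp add: distinct_set_subseqs)
  then have d': "distinct (map set (combinations N k))"
    unfolding combinations_def by (rule distinct_map_filter)
  have l: "card (set I) = length I" if "I \<in> set (subseqs [0..<N])" for I
    using that by (meson distinct_card distinct_upt subseqs_distinctD)
  have "set ` set (combinations N k) = {A. A \<subseteq> {0..<N} \<and> card A = k}"
  proof (intro equalityI subsetI)
    fix A assume "A \<in> set ` set (combinations N k)"
    then show "A \<in> {A. A \<subseteq> {0..<N} \<and> card A = k}"
      using l subseqs_powset[of "[0..<N]"] by (auto simp: combinations_def)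
  next
    fix A assume A: "A \<in> {A. A \<subseteq> {0..<N} \<and> card A = k}"
    then have "A \<in> set ` set (subseqs [0..<N])"
      using subseqs_powset[of "[0..<N]"] by auto
    then show "A \<in> set ` set (combinations N k)"
      using A l by (auto simp: combinations_def)
  qed
  then have "card (set ` set (combinations N k)) = N choose k"
    using n_subsets[of "{0..<N}" k] by simp
  moreover have "card (set ` set (combinations N k)) = length (combinations N k)"
    using distinct_card[OF d'] by simp
  ultimately show ?thesis by simp
qed

text \<open>Pluecker coordinates of \<open>v\<^sub>0 \<and> \<dots> \<and> v\<^sub>k\<^sub>-\<^sub>1 \<in> \<Lambda>\<^sup>k \<complex>\<^sup>N\<close>: its coefficients in the
  basis of the \<open>e\<^sub>I\<close>, \<open>I\<close> a \<open>k\<close>-subset.\<close>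

definition wedge :: "nat \<Rightarrow> nat \<Rightarrow> (nat \<Rightarrow> complex vec) \<Rightarrow> complex vec" where
  "wedge N k v =
     vec (N choose k) (\<lambda>m. det (mat k k (\<lambda>(a, b). v b $ (combinations N k ! m ! a))))"

definition higher_deriv_vec :: "nat \<Rightarrow> nat \<Rightarrow> (complex \<Rightarrow> complex vec) \<Rightarrow> complex \<Rightarrow> complex vec" where
  "higher_deriv_vec N j \<nu> t = vec N (\<lambda>i. (deriv ^^ j) (\<lambda>s. \<nu> s $ i) t)"

definition osculating :: "nat \<Rightarrow> nat \<Rightarrow> (complex \<Rightarrow> complex vec) \<Rightarrow> complex \<Rightarrow> complex vec" where
  "osculating N k \<nu> t = wedge N k (\<lambda>j. higher_deriv_vec N j \<nu> t)"

text \<open>The holomorphic curve that agrees with \<open>[\<nu> \<and> \<nu>' \<and> \<dots> \<and> \<nu>\<^sup>(\<^sup>k\<^sup>-\<^sup>1\<^sup>)]\<close> wherever the wedge of a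
  local lift \<open>\<nu>\<close> does not vanish. For linearly nondegenerate \<open>F\<close> and \<open>1 \<le> k \<le> N\<close> the
  zeros of the wedge are isolated, so it exists and is unique, and it is meant for this case only.\<close>

definition is_associated_curve ::
  "nat \<Rightarrow> nat \<Rightarrow> (riemann_sphere \<Rightarrow> complex vec set) \<Rightarrow> (riemann_sphere \<Rightarrow> complex vec set) \<Rightarrow> bool"
  where
  "is_associated_curve N k F G \<longleftrightarrow>
     holomorphic_curve (N choose k) G \<and>
     (\<forall>p r \<nu>. local_lift N F p r \<nu> \<longrightarrow>
        (\<forall>t \<in> ball 0 r. osculating N k \<nu> t \<noteq> 0\<^sub>v (N choose k) \<longrightarrow>
           G (param p t) = proj_class (osculating N k \<nu> t)))"

definition associated_curve ::
  "nat \<Rightarrow> nat \<Rightarrow> (riemann_sphere \<Rightarrow> complex vec set) \<Rightarrow> riemann_sphere \<Rightarrow> complex vec set" where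
  "associated_curve N k F = (THE G. is_associated_curve N k F G)"


section \<open>Ramification\<close>

text \<open>The Fubini--Study metric in homogeneous coordinates: the squared length, at the point
  \<open>[Z]\<close>, of the image of the tangent vector \<open>W\<close> under the differential of the projection from
  the nonzero vectors to projective space, that is
  \<open>(|Z|\<^sup>2 |W|\<^sup>2 - |\<langle>W, Z\<rangle>|\<^sup>2) / |Z|\<^sup>4\<close>.\<close>

definition fubini_study :: "complex vec \<Rightarrow> complex vec \<Rightarrow> real" where
  "fubini_study Z W =
     (Re (Z \<bullet>c Z) * Re (W \<bullet>c W) - (cmod (W \<bullet>c Z))\<^sup>2) / (Re (Z \<bullet>c Z))\<^sup>2"

text \<open>Up to a constant factor, \<open>fubini_study (\<nu> t) (\<nu>' t)\<close> is the coefficient of \<open>dt \<and> d(cnj t)\<close>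
  in the pullback of the Fubini--Study form by the curve lifted by \<open>\<nu>\<close>, in the coordinate \<open>t\<close>
  centred at \<open>p\<close>.\<close>

definition has_ramification_index ::
  "nat \<Rightarrow> (riemann_sphere \<Rightarrow> complex vec set) \<Rightarrow> riemann_sphere \<Rightarrow> nat \<Rightarrow> bool" where
  "has_ramification_index N F p \<gamma> \<longleftrightarrow>
     (\<exists>r \<nu> h. local_lift N F p r \<nu> \<and> continuous_on (ball 0 r) h \<and> h 0 > (0 :: real) \<and>
        (\<forall>t \<in> ball 0 r.
           fubini_study (\<nu> t) (higher_deriv_vec N 1 \<nu> t) = cmod t ^ (2 * \<gamma>) * h t))"

text \<open>The index \<open>\<gamma>\<^sub>k(p)\<close> of \<open>F\<close>, i.e. the ramification index at \<open>p\<close> of the \<open>k\<close>-th associated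
  curve.\<close>

definition ramification_index ::
  "nat \<Rightarrow> (riemann_sphere \<Rightarrow> complex vec set) \<Rightarrow> nat \<Rightarrow> riemann_sphere \<Rightarrow> nat" where
  "ramification_index N F k p =
     (THE \<gamma>. has_ramification_index (N choose k) (associated_curve N k F) p \<gamma>)"

text \<open>For a curve in \<open>\<complex>\<P>\<^sup>n\<close>, where \<open>N = n + 1\<close>, the relevant \<open>k\<close> are those with \<open>1 \<le> k \<le> n\<close>.\<close>

definition ramified_points :: "nat \<Rightarrow> (riemann_sphere \<Rightarrow> complex vec set) \<Rightarrow> riemann_sphere set" where
  "ramified_points N F = {p. \<exists>k \<in> {1..<N}. ramification_index N F k p > 0}"

end

theory Submission
  imports
    Defs
    "Jordan_Normal_Form.Determinant"
    "Jordan_Normal_Form.Gauss_Jordan_Elimination"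
    "HOL-Computational_Algebra.Fundamental_Theorem_Algebra"
begin

text \<open>A holomorphic curve in \<open>\<complex>\<P>\<^sup>n\<close> is given by polynomials \<open>P\<^sub>0, \<dots>, P\<^sub>n\<close> of degree at most \<open>d\<close> that have no
common zero as sections of \<open>O(d)\<close> (\<open>holomorphic_curve_imp_poly_curve\<close>). If it is nondegenerate, they
span an \<open>(n+1)\<close>-dimensional space \<open>V\<close> of sections, and this space determines the curve up to a
projective linear transformation. The theorem becomes a statement about the orders of vanishing of
elements of \<open>V\<close>.

At each point \<open>p\<close> exactly \<open>n + 1\<close> orders \<open>0 = a\<^sub>0 < \<dots> < a\<^sub>n\<close> occur. In a basis of \<open>V\<close> adapted to them the
\<open>k\<close>-th osculating vector is, up to a scalar factor, the Pluecker vector of the first \<open>k\<close> basis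
elements plus \<open>t\<^sup>g\<close> times a nonzero multiple of the next one, with \<open>g = a\<^sub>k - a\<^sub>k\<^sub>-\<^sub>1\<close>, plus terms of
higher order. Hence \<open>\<gamma>\<^sub>k(p) = a\<^sub>k - a\<^sub>k\<^sub>-\<^sub>1 - 1\<close> (\<open>ramification_index_eq\<close>); in particular the indices at \<open>p\<close>
determine the orders at \<open>p\<close>.

Let \<open>a\<^sub>i\<close> and \<open>b\<^sub>i\<close> be the orders at the two ramified points. The Wronskian of the \<open>P\<^sub>i\<close> vanishes at a finite
point to the order by which the sum of the orders exceeds \<open>0 + 1 + \<dots> + n\<close>, and its degree is given by the
orders at infinity. As all other points are unramified, counting its roots gives
\<open>\<Sum> a\<^sub>i + \<Sum> b\<^sub>i = (n+1) d\<close> (\<open>order_sum_two_ramified_points\<close>). On the other hand, the elements of \<open>V\<close> of order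
at least \<open>a\<^sub>i\<close> at the first point and those of order at least \<open>b\<^sub>n\<^sub>-\<^sub>i\<close> at the second point form subspaces of
dimensions \<open>n + 1 - i\<close> and \<open>i + 1\<close>, which have a common nonzero element. It has only \<open>d\<close> zeros, so
\<open>a\<^sub>i + b\<^sub>n\<^sub>-\<^sub>i \<le> d\<close>. Summing over \<open>i\<close> shows that all these inequalities are equalities, so that this common
element has no other zeros. It is therefore \<open>s\<^sub>1\<^sup>a s\<^sub>2\<^sup>d\<^sup>-\<^sup>a\<close> with \<open>a = a\<^sub>i\<close> up to a constant, where \<open>s\<^sub>1\<close> and \<open>s\<^sub>2\<close> are
the sections of \<open>O(1)\<close> that vanish at the two points (\<open>two_ramified_points_normal_form\<close>).

Both claims follow. From \<open>b\<^sub>n\<^sub>-\<^sub>i = d - a\<^sub>i\<close> the gaps at the second point are those at the first in reverse.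
And \<open>V\<close> is spanned by sections that depend only on the two points, the \<open>a\<^sub>i\<close> and \<open>d = a\<^sub>n\<close>.\<close>

hide_const (open) module.smult Coset.order
no_notation fps_nth (infixl \<open>$\<close> 75)

section \<open>Points of projective space and local lifts\<close>

lemma proj_class_smult:
  assumes "c \<noteq> 0"
  shows "proj_class (c \<cdot>\<^sub>v v) = proj_class v"
proof -
  have "d \<cdot>\<^sub>v v = (d / c) \<cdot>\<^sub>v (c \<cdot>\<^sub>v v)" "d \<cdot>\<^sub>v (c \<cdot>\<^sub>v v) = (d * c) \<cdot>\<^sub>v v" for d
    using assms by (simp_all add: smult_smult_assoc)
  then show ?thesis
    unfolding proj_class_def using assms by (auto; metis divide_eq_0_iff mult_eq_0_iff)
qed

lemma mem_proj_class: "v \<in> proj_class v"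
  unfolding proj_class_def by (auto intro!: exI[of _ 1])

lemma proj_class_eqD:
  assumes "proj_class v = proj_class w"
  obtains c where "c \<noteq> 0" "v = c \<cdot>\<^sub>v w"
  using mem_proj_class[of v] assms unfolding proj_class_def by auto

lemma nonzero_vecE:
  assumes "v \<in> carrier_vec N" "v \<noteq> 0\<^sub>v N"
  obtains i where "i < N" "v $ i \<noteq> 0"
  using assms by (metis carrier_vecD eq_vecI index_zero_vec)

lemma proj_class_eq_iff:
  assumes "v \<in> carrier_vec N" "v \<noteq> 0\<^sub>v N" "w \<in> carrier_vec N" "w \<noteq> 0\<^sub>v N"
  shows "proj_class v = proj_class w \<longleftrightarrow> (\<forall>i<N. \<forall>j<N. v $ i * w $ j = v $ j * w $ i)"
proof
  assume "proj_class v = proj_class w"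
  then obtain c where "v = c \<cdot>\<^sub>v w" by (rule proj_class_eqD)
  then show "\<forall>i<N. \<forall>j<N. v $ i * w $ j = v $ j * w $ i"
    using assms by auto
next
  assume eq: "\<forall>i<N. \<forall>j<N. v $ i * w $ j = v $ j * w $ i"
  obtain i where i: "i < N" "w $ i \<noteq> 0"
    using nonzero_vecE assms(3,4) by blast
  have "v = (v $ i / w $ i) \<cdot>\<^sub>v w"
    using eq i assms by (intro eq_vecI) (auto simp: field_simps)
  moreover from this have "v $ i / w $ i \<noteq> 0"
    using assms by (metis carrier_vecD index_smult_vec(1) index_zero_vec mult_zero_left eq_vecI index_smult_vec(2))
  ultimately show "proj_class v = proj_class w"
    using proj_class_smult by metis
qed

lemma param_0 [simp]: "param p 0 = p"
  by (cases p) auto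

lemma local_liftD:
  assumes "local_lift N F p r \<nu>" "norm t < r"
  shows "\<nu> t \<in> carrier_vec N" "\<nu> t \<noteq> 0\<^sub>v N" "F (param p t) = proj_class (\<nu> t)"
  using assms unfolding local_lift_def by auto

lemma local_lift_continuous:
  assumes "local_lift N F p r \<nu>" "i < N" "t \<in> ball 0 r"
  shows "isCont (\<lambda>t. \<nu> t $ i) t"
proof -
  have "(\<lambda>t. \<nu> t $ i) holomorphic_on ball 0 r"
    using assms unfolding local_lift_def by blast
  then show ?thesis
    using assms(3) by (meson continuous_on_eq_continuous_at holomorphic_on_imp_continuous_on open_ball)
qed

text \<open>Two nonzero vectors are proportional iff their cross products \<open>v\<^sub>i w\<^sub>j - v\<^sub>j w\<^sub>i\<close> vanish. For two lifts
this is a closed condition on the parameter, so it passes to the limit. This is how curves are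
identified below: it suffices to compare them where both are given by formulas.\<close>

lemma isolated_agreement_extends:
  assumes F: "local_lift N F p r \<nu>" and G: "local_lift N G p s \<mu>"
    and ev: "eventually (\<lambda>t. F (param p t) = G (param p t)) (at 0)"
  shows "F p = G p"
proof -
  have rs: "r > 0" "s > 0" using F G unfolding local_lift_def by auto
  have "\<nu> 0 $ i * \<mu> 0 $ j = \<nu> 0 $ j * \<mu> 0 $ i" if ij: "i < N" "j < N" for i j
  proof -
    have "((\<lambda>t. \<nu> t $ i * \<mu> t $ j - \<nu> t $ j * \<mu> t $ i) \<longlongrightarrow>
          (\<nu> 0 $ i * \<mu> 0 $ j - \<nu> 0 $ j * \<mu> 0 $ i)) (at 0)"
      using local_lift_continuous[OF F, of _ 0] local_lift_continuous[OF G, of _ 0] ij rs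
      by (intro tendsto_intros) (auto simp: isCont_def)
    moreover have "eventually (\<lambda>t. \<nu> t $ i * \<mu> t $ j - \<nu> t $ j * \<mu> t $ i = 0) (at 0)"
      using ev eventually_at_ball[OF rs(1), of 0 UNIV] eventually_at_ball[OF rs(2), of 0 UNIV]
    proof eventually_elim
      case (elim t)
      then have "proj_class (\<nu> t) = proj_class (\<mu> t)"
        using F G rs unfolding local_lift_def by auto
      then show ?case
        using F G elim ij rs proj_class_eq_iff[of "\<nu> t" N "\<mu> t"] unfolding local_lift_def by auto
    qed
    ultimately have "((\<lambda>t. 0) \<longlongrightarrow> (\<nu> 0 $ i * \<mu> 0 $ j - \<nu> 0 $ j * \<mu> 0 $ i)) (at (0::complex))"
      by (rule Lim_transform_eventually)
    then show ?thesis
      by (simp add: LIM_const_eq tendsto_const_iff)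
  qed
  then have "proj_class (\<nu> 0) = proj_class (\<mu> 0)"
    using F G rs proj_class_eq_iff[of "\<nu> 0" N "\<mu> 0"] unfolding local_lift_def by auto
  moreover have "F (param p 0) = proj_class (\<nu> 0)" "G (param p 0) = proj_class (\<mu> 0)"
    using F G rs unfolding local_lift_def by (metis centre_in_ball)+
  ultimately show ?thesis by simp
qed

lemma eventually_param_notin:
  assumes "finite S"
  shows "eventually (\<lambda>t. \<exists>z. param p t = Plane z \<and> z \<notin> S) (at 0)"
proof (cases p)
  case (Plane a)
  have "finite ((\<lambda>z. z - a) ` S)" using assms by simp
  from islimpt_finite[OF this, of 0] have "eventually (\<lambda>t. t \<notin> (\<lambda>z. z - a) ` S) (at 0)"
    by (simp add: islimpt_iff_eventually)
  then show ?thesis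
    by eventually_elim (auto simp: Plane image_iff)
next
  case Infty
  have "finite ((\<lambda>z. 1 / z) ` S)" using assms by simp
  from islimpt_finite[OF this, of 0] have "eventually (\<lambda>t. t \<notin> (\<lambda>z. 1 / z) ` S) (at 0)"
    by (simp add: islimpt_iff_eventually)
  moreover have "eventually (\<lambda>t::complex. t \<noteq> 0) (at 0)"
    by (simp add: eventually_at_filter)
  ultimately show ?thesis
    by eventually_elim (force simp: Infty image_iff)
qed

lemma holomorphic_curve_eqI:
  assumes F: "holomorphic_curve N F" and G: "holomorphic_curve N G"
    and S: "finite S" and eq: "\<And>z. z \<notin> S \<Longrightarrow> F (Plane z) = G (Plane z)"
  shows "F = G"
proof
  fix p
  obtain r \<nu> s \<mu> where l: "local_lift N F p r \<nu>" "local_lift N G p s \<mu>"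
    using F G unfolding holomorphic_curve_def by meson
  have "eventually (\<lambda>t. F (param p t) = G (param p t)) (at 0)"
    using eventually_param_notin[OF S, of p] by eventually_elim (use eq in auto)
  with l show "F p = G p" by (rule isolated_agreement_extends)
qed

section \<open>Curves given by polynomials\<close>

text \<open>The polynomial \<open>t\<^sup>d q(1/t)\<close>, for \<open>q\<close> of degree at most \<open>d\<close>.\<close>

definition flip :: "nat \<Rightarrow> complex poly \<Rightarrow> complex poly" where
  "flip d q = (\<Sum>j\<le>d. monom (coeff q (d - j)) j)"

lemma coeff_flip: "coeff (flip d q) j = (if j \<le> d then coeff q (d - j) else 0)"
proof -
  have "coeff (flip d q) j = (\<Sum>i\<le>d. if i = j then coeff q (d - i) else 0)"
    unfolding flip_def by (simp add: coeff_sum coeff_monom)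
  also have "\<dots> = (if j \<le> d then coeff q (d - j) else 0)"
    by (simp add: sum.delta)
  finally show ?thesis .
qed

lemma poly_flip:
  assumes "degree q \<le> d" "t \<noteq> 0"
  shows "poly (flip d q) t = t ^ d * poly q (1 / t)"
proof -
  have "poly (flip d q) t = (\<Sum>j\<le>d. coeff q (d - j) * t ^ j)"
    unfolding flip_def by (simp add: poly_sum poly_monom)
  also have "\<dots> = (\<Sum>j\<le>d. coeff q j * t ^ (d - j))"
    by (rule sum.reindex_bij_witness[of _ "\<lambda>j. d - j" "\<lambda>j. d - j"]) auto
  also have "\<dots> = (\<Sum>j\<le>d. t ^ d * (coeff q j * (1 / t) ^ j))"
    using assms(2) by (intro sum.cong refl) (simp add: power_diff field_simps)
  also have "\<dots> = t ^ d * poly q (1 / t)"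
    using poly_as_sum_of_monoms'[OF assms(1), THEN arg_cong, of "\<lambda>q. poly q (1 / t)"]
    by (simp add: poly_sum poly_monom flip: sum_distrib_left)
  finally show ?thesis .
qed

text \<open>A polynomial of degree at most \<open>d\<close> is a section of the line bundle \<open>O(d)\<close> on the sphere; this is
its expression in the coordinate centred at a given point. At infinity its order of vanishing
is \<open>d\<close> minus the degree.\<close>

fun local_poly :: "nat \<Rightarrow> riemann_sphere \<Rightarrow> complex poly \<Rightarrow> complex poly" where
  "local_poly d (Plane a) q = pcompose q [:a, 1:]"
| "local_poly d Infty q = flip d q"

definition poly_lift ::
  "nat \<Rightarrow> nat \<Rightarrow> (nat \<Rightarrow> complex poly) \<Rightarrow> riemann_sphere \<Rightarrow> complex \<Rightarrow> complex vec" where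
  "poly_lift N d P p t = vec N (\<lambda>i. poly (local_poly d p (P i)) t)"

text \<open>The condition that the lift does not vanish says that the \<open>P i\<close> have no common zero on
the sphere as sections of \<open>O(d)\<close>: no common root, and at infinity that one of them has degree
exactly \<open>d\<close>.\<close>

definition poly_curve ::
  "nat \<Rightarrow> nat \<Rightarrow> (nat \<Rightarrow> complex poly) \<Rightarrow> (riemann_sphere \<Rightarrow> complex vec set) \<Rightarrow> bool" where
  "poly_curve N d P F \<longleftrightarrow> (\<forall>i<N. degree (P i) \<le> d) \<and>
     (\<forall>p. poly_lift N d P p 0 \<noteq> 0\<^sub>v N \<and> F p = proj_class (poly_lift N d P p 0))"

lemma poly_lift_carrier [simp]: "poly_lift N d P p t \<in> carrier_vec N"
  by (simp add: poly_lift_def)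

lemma poly_lift_index [simp]: "i < N \<Longrightarrow> poly_lift N d P p t $ i = poly (local_poly d p (P i)) t"
  by (simp add: poly_lift_def)

lemma poly_lift_dim [simp]: "dim_vec (poly_lift N d P p t) = N"
  by (simp add: poly_lift_def)

lemma poly_lift_Plane: "poly_lift N d P (Plane a) t = vec N (\<lambda>i. poly (P i) (a + t))"
  by (auto simp: poly_lift_def poly_pcompose)

lemma poly_lift_Infty:
  assumes "\<forall>i<N. degree (P i) \<le> d" "t \<noteq> 0"
  shows "poly_lift N d P Infty t = t ^ d \<cdot>\<^sub>v vec N (\<lambda>i. poly (P i) (1 / t))"
  using assms by (auto simp: poly_lift_def poly_flip)

lemma poly_lift_param:
  assumes "\<forall>i<N. degree (P i) \<le> d"
  obtains c where "c \<noteq> 0" "poly_lift N d P p t = c \<cdot>\<^sub>v poly_lift N d P (param p t) 0"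
proof (cases p)
  case (Plane a)
  then show ?thesis using that[of 1] by (simp add: poly_lift_Plane)
next
  case Infty
  show ?thesis
  proof (cases "t = 0")
    case True then show ?thesis using that[of 1] Infty by simp
  next
    case False then show ?thesis
      using that[of "t ^ d"] Infty assms by (simp add: poly_lift_Infty poly_lift_Plane)
  qed
qed

lemma poly_curve_param:
  assumes "poly_curve N d P F"
  shows "poly_lift N d P p t \<noteq> 0\<^sub>v N" "F (param p t) = proj_class (poly_lift N d P p t)"
proof -
  obtain c where c: "c \<noteq> 0" "poly_lift N d P p t = c \<cdot>\<^sub>v poly_lift N d P (param p t) 0"
    using poly_lift_param assms unfolding poly_curve_def by metis
  have nz: "poly_lift N d P (param p t) 0 \<noteq> 0\<^sub>v N" "F (param p t) = proj_class (poly_lift N d P (param p t) 0)"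
    using assms unfolding poly_curve_def by auto
  show "F (param p t) = proj_class (poly_lift N d P p t)"
    using nz(2) c proj_class_smult by simp
  obtain i where "i < N" "poly_lift N d P (param p t) 0 $ i \<noteq> 0"
    using nonzero_vecE[OF _ nz(1)] by auto
  then have "i < N" "poly_lift N d P p t $ i \<noteq> 0"
    unfolding c(2) using c(1) by auto
  then show "poly_lift N d P p t \<noteq> 0\<^sub>v N" by (metis index_zero_vec(1))
qed

lemma poly_curve_local_lift:
  assumes "poly_curve N d P F" "r > 0"
  shows "local_lift N F p r (poly_lift N d P p)"
  unfolding local_lift_def using assms poly_curve_param[OF assms(1)]
  by (auto intro!: holomorphic_intros)

lemma poly_curve_imp_holomorphic_curve:
  assumes "poly_curve N d P F"
  shows "holomorphic_curve N F"
  unfolding holomorphic_curve_def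
proof (intro conjI allI)
  show "range F \<subseteq> proj_space N"
    using assms unfolding proj_space_def poly_curve_def by auto
  show "\<exists>r \<nu>. local_lift N F p r \<nu>" for p
    using poly_curve_local_lift[OF assms, of 1] by auto
qed

lemma poly_curve_Plane:
  "poly_curve N d P F \<Longrightarrow> F (Plane z) = proj_class (vec N (\<lambda>i. poly (P i) z))"
  unfolding poly_curve_def by (simp add: poly_lift_Plane)

text \<open>The common factor \<open>h\<close> is a common divisor of largest degree; a common root of the quotients would
give a larger one.\<close>

lemma poly_curve_of_polys:
  assumes "m < N" "Q m \<noteq> (0 :: complex poly)"
  shows "\<exists>h Q' e F. h \<noteq> 0 \<and> (\<forall>i<N. Q i = h * Q' i) \<and> poly_curve N e Q' F"
proof -
  define D where "D = {h. h \<noteq> 0 \<and> (\<forall>i<N. h dvd Q i)}"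
  have "1 \<in> D" by (auto simp: D_def)
  moreover have bd: "\<forall>h. h \<in> D \<longrightarrow> degree h \<le> degree (Q m)"
    using assms by (auto simp: D_def intro: dvd_imp_degree_le)
  ultimately obtain h where h: "h \<in> D" "\<And>h'. h' \<in> D \<Longrightarrow> degree h' \<le> degree h"
    using ex_has_greatest_nat[of "\<lambda>h. h \<in> D" 1 degree "Suc (degree (Q m))"]
    by (metis less_Suc_eq_le)
  define Q' where "Q' i = Q i div h" for i
  have Q: "Q i = h * Q' i" if "i < N" for i
    using h(1) that unfolding D_def Q'_def by auto
  have h0: "h \<noteq> 0" using h(1) by (auto simp: D_def)
  have "Q' m \<noteq> 0" using Q assms by auto
  then have "{i. i < N \<and> Q' i \<noteq> 0} \<noteq> {}" "finite {i. i < N \<and> Q' i \<noteq> 0}" using assms by auto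
  then have "Max ((\<lambda>i. degree (Q' i)) ` {i. i < N \<and> Q' i \<noteq> 0}) \<in> (\<lambda>i. degree (Q' i)) ` {i. i < N \<and> Q' i \<noteq> 0}"
    by (intro Max_in) auto
  then obtain l where l: "l < N" "Q' l \<noteq> 0"
    "Max ((\<lambda>i. degree (Q' i)) ` {i. i < N \<and> Q' i \<noteq> 0}) = degree (Q' l)" by auto
  have lmax: "degree (Q' i) \<le> degree (Q' l)" if "i < N" "Q' i \<noteq> 0" for i
    unfolding l(3)[symmetric] using that by (intro Max_ge) auto
  define e where "e = degree (Q' l)"
  have deg: "degree (Q' i) \<le> e" if "i < N" for i
    unfolding e_def using lmax that by (cases "Q' i = 0") auto
  define F where "F p = proj_class (poly_lift N e Q' p 0)" for p
  have "poly_lift N e Q' p 0 \<noteq> 0\<^sub>v N" for p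
  proof (cases p)
    case (Plane a)
    show ?thesis
    proof
      assume "poly_lift N e Q' p 0 = 0\<^sub>v N"
      then have "poly (Q' i) a = 0" if "i < N" for i
        using that Plane poly_lift_index[of i N e Q' p 0] by (simp add: poly_pcompose)
      then have "[:-a, 1:] dvd Q' i" if "i < N" for i
        using that by (simp add: poly_eq_0_iff_dvd)
      then have dvd: "h * [:-a, 1:] dvd Q i" if "i < N" for i
        unfolding Q[OF that] using that by (intro mult_dvd_mono dvd_refl)
      have "h * [:-a, 1:] \<noteq> 0" unfolding mult_eq_0_iff using h0 by simp
      with dvd have "h * [:-a, 1:] \<in> D" unfolding D_def by blast
      from h(2)[OF this] show False
        using h0 degree_mult_eq[of h "[:-a, 1:]"] by simp
    qed
  next
    case Infty
    have "poly_lift N e Q' p 0 $ l \<noteq> 0"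
      using l Infty by (simp add: poly_0_coeff_0 coeff_flip e_def)
    then show ?thesis using l(1) by (metis index_zero_vec(1))
  qed
  then have "poly_curve N e Q' F"
    unfolding poly_curve_def F_def using deg by auto
  with h0 Q show ?thesis
    by (intro exI[of _ h] exI[of _ Q'] exI[of _ e] exI[of _ F] conjI allI impI)
qed

section \<open>Holomorphic curves are rational\<close>

lemma meromorphic_clear_pole:
  assumes "m meromorphic_on {s}"
  obtains k c where "(\<lambda>z. m z * (z - s) ^ k) \<midarrow>s\<rightarrow> c"
proof (cases "is_pole m s")
  case True
  have iso: "isolated_singularity_at m s"
    using assms by (simp add: meromorphic_at_iff)
  then obtain r where r: "r > 0" "m analytic_on ball s r - {s}"
    unfolding isolated_singularity_at_def by blast
  have "m holomorphic_on ball s r - {s}" using r(2) by (rule analytic_imp_holomorphic)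
  from zorder_exist_pole[OF this open_ball _ True] r(1)
  obtain r' where r': "r' > 0" "zor_poly m s holomorphic_on cball s r'" by auto
  have "continuous_on (ball s r') (zor_poly m s)"
    using r'(2) by (meson ball_subset_cball continuous_on_subset holomorphic_on_imp_continuous_on)
  then have "zor_poly m s \<midarrow>s\<rightarrow> zor_poly m s s"
    using r'(1) by (simp add: continuous_on_eq_continuous_at isCont_def)
  then have "(\<lambda>z. m z * (z - s) ^ nat (- zorder m s)) \<midarrow>s\<rightarrow> zor_poly m s s"
    using zor_poly_pole_eq[OF iso True] by (rule Lim_transform_eventually)
  then show ?thesis by (rule that)
next
  case False
  then obtain c where "m \<midarrow>s\<rightarrow> c"
    using assms unfolding meromorphic_at_iff not_essential_def by auto
  then show ?thesis using that[of 0 c] by simp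
qed

text \<open>The singularities are isolated and lie in a disc, so there are finitely many. Multiplying by a polynomial that
clears them gives an entire function of polynomial growth, which is a polynomial by Liouville.\<close>

lemma rational_of_meromorphic:
  assumes mero: "m meromorphic_on UNIV"
    and ana: "\<And>z. norm z > R \<Longrightarrow> m analytic_on {z}"
    and bound: "\<And>z. norm z > R \<Longrightarrow> norm (m z) \<le> B"
  shows "\<exists>p q S. finite S \<and> q \<noteq> 0 \<and> (\<forall>z. z \<notin> S \<longrightarrow> poly q z \<noteq> 0 \<and> m z = poly p z / poly q z)"
proof -
  define S where "S = {z. \<not> m analytic_on {z}}"
  have S_sub: "S \<subseteq> cball 0 R"
    using ana unfolding S_def by (force simp: not_less[symmetric])
  have "S sparse_in UNIV"
    using meromorphic_on_imp_sparse_singularities[OF mero] by (simp add: S_def)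
  then have "finite (cball 0 R \<inter> S)"
    by (metis compact_cball sparse_in_compact_finite sparse_in_subset subset_UNIV)
  then have finS: "finite S"
    using S_sub by (simp add: Int_absorb1)
  have "\<exists>k c. (\<lambda>z. m z * (z - s) ^ k) \<midarrow>s\<rightarrow> c" for s
    using meromorphic_clear_pole[of m s] meromorphic_on_subset[OF mero] by blast
  then obtain k where k: "\<And>s. \<exists>c. (\<lambda>z. m z * (z - s) ^ k s) \<midarrow>s\<rightarrow> c"
    by metis
  define q where "q = (\<Prod>s\<in>S. [:-s, 1:] ^ k s)"
  have q: "poly q z = (\<Prod>s\<in>S. (z - s) ^ k s)" for z
    by (simp add: q_def poly_prod)
  have q0: "poly q z \<noteq> 0" if "z \<notin> S" for z
    using that finS by (auto simp: q)
  define g where "g z = m z * poly q z" for z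
  have g_ana: "g analytic_on {z}" if "z \<notin> S" for z
    unfolding g_def q using that by (auto simp: S_def intro!: analytic_intros)
  have g_mero: "g meromorphic_on UNIV"
    unfolding g_def q by (intro meromorphic_intros mero analytic_on_imp_meromorphic_on analytic_intros)
  have "remove_sings g analytic_on {z}" for z
  proof (cases "z \<in> S")
    case True
    obtain c where c: "(\<lambda>w. m w * (w - z) ^ k z) \<midarrow>z\<rightarrow> c" using k by blast
    have "g = (\<lambda>w. (m w * (w - z) ^ k z) * (\<Prod>s\<in>S - {z}. (w - s) ^ k s))"
      unfolding g_def q by (intro ext) (simp add: mult.assoc prod.remove[OF finS True])
    moreover have "((\<lambda>w. (m w * (w - z) ^ k z) * (\<Prod>s\<in>S - {z}. (w - s) ^ k s)) \<longlongrightarrow>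
       c * (\<Prod>s\<in>S - {z}. (z - s) ^ k s)) (at z)"
      by (intro tendsto_intros c)
    ultimately have "g \<midarrow>z\<rightarrow> c * (\<Prod>s\<in>S - {z}. (z - s) ^ k s)" by simp
    then show ?thesis
      using g_mero by (intro remove_sings_analytic_at) (auto simp: meromorphic_on_altdef)
  next
    case False
    then show ?thesis
      using g_ana remove_sings_analytic_on by blast
  qed
  then have ent: "remove_sings g holomorphic_on UNIV"
    using analytic_on_analytic_at analytic_imp_holomorphic by blast
  define K where "K = (\<Sum>s\<in>S. k s)"
  have "norm (remove_sings g z) \<le> (B * 2 ^ K) * norm z ^ K" if z: "\<bar>R\<bar> + 1 \<le> norm z" for z
  proof -
    have "z \<notin> S" using S_sub z by auto
    then have "remove_sings g z = g z"
      using g_ana by (simp add: remove_sings_at_analytic)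
    moreover have "norm (poly q z) \<le> (\<Prod>s\<in>S. (2 * norm z) ^ k s)"
      unfolding q prod_norm[symmetric]
    proof (intro prod_mono conjI)
      fix s assume "s \<in> S"
      then have "norm s \<le> norm z" using S_sub z by auto
      then have "norm (z - s) \<le> 2 * norm z"
        using norm_triangle_ineq4[of z s] by simp
      then show "norm ((z - s) ^ k s) \<le> (2 * norm z) ^ k s"
        unfolding norm_power by (intro power_mono) auto
    qed auto
    moreover have "(\<Prod>s\<in>S. (2 * norm z) ^ k s) = 2 ^ K * norm z ^ K"
      unfolding K_def by (simp add: power_sum power_mult_distrib prod.distrib)
    moreover have "norm (m z) \<le> B" using bound z by auto
    ultimately show ?thesis
      unfolding g_def norm_mult
      using mult_mono[of "norm (m z)" B "norm (poly q z)" "2 ^ K * norm z ^ K"] order_trans[OF norm_ge_zero, of "m z" B]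
      by (simp add: mult.assoc norm_mult)
  qed
  from Liouville_polynomial[OF ent this]
  have L: "remove_sings g z = (\<Sum>j\<le>K. (deriv ^^ j) (remove_sings g) 0 / fact j * z ^ j)" for z
    by blast
  define p where "p = (\<Sum>j\<le>K. monom ((deriv ^^ j) (remove_sings g) 0 / fact j) j)"
  have "m z = poly p z / poly q z" if "z \<notin> S" for z
  proof -
    have "g z = poly p z"
      using L[of z] remove_sings_at_analytic[OF g_ana[OF that]]
      by (simp add: p_def poly_sum poly_monom)
    then show ?thesis using q0[OF that] by (simp add: g_def field_simps)
  qed
  moreover have "q \<noteq> 0" unfolding q_def using finS by simp
  ultimately show ?thesis
    using finS q0 by (intro exI[of _ p] exI[of _ q] exI[of _ S]) auto
qed

text \<open>A quotient of two coordinates of a point does not depend on the representative; since \<open>x / 0 = 0\<close>,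
this includes the points where the denominator vanishes.\<close>

lemma some_ratio:
  assumes "X = proj_class w" "w \<in> carrier_vec N" "i < N" "j < N"
  shows "(SOME v. v \<in> X) $ i / (SOME v. v \<in> X) $ j = w $ i / w $ j"
proof -
  have "(SOME v. v \<in> X) \<in> X"
    using mem_proj_class assms(1) by (metis someI)
  then obtain c where "c \<noteq> 0" "(SOME v. v \<in> X) = c \<cdot>\<^sub>v w"
    using assms(1) unfolding proj_class_def by auto
  then show ?thesis using assms by simp
qed

text \<open>The quotient of the \<open>i\<close>-th by the \<open>j\<close>-th coordinate is locally a quotient of holomorphic functions,
hence meromorphic in the plane, even around a point near which the \<open>j\<close>-th coordinate
vanishes identically, since it is then constantly \<open>0\<close>. The index \<open>j\<close> is chosen so that the quotient is
bounded near infinity. The case \<open>i = j\<close> is what excludes identical vanishing: there the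
quotient takes the values \<open>0\<close> and \<open>1\<close> only, and it is \<open>1\<close> near infinity.\<close>

lemma coordinate_ratio_rational:
  assumes F: "holomorphic_curve N F" and ij: "i < N" "j < N"
    and lift: "local_lift N F Infty r \<nu>" "\<nu> 0 $ j \<noteq> 0"
  shows "\<exists>p q S. finite S \<and> q \<noteq> 0 \<and>
      (\<forall>z w. z \<notin> S \<longrightarrow> w \<in> carrier_vec N \<longrightarrow> F (Plane z) = proj_class w \<longrightarrow>
         poly q z \<noteq> 0 \<and> w $ i / w $ j = poly p z / poly q z) \<and> (i = j \<longrightarrow> p = q)"
proof -
  \<comment> \<open>The representative is arbitrary: by \<open>some_ratio\<close> the value does not depend on it.\<close>
  define m where "m z = (SOME v. v \<in> F (Plane z)) $ i / (SOME v. v \<in> F (Plane z)) $ j" for z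
  have m: "m z = w $ i / w $ j" if "F (Plane z) = proj_class w" "w \<in> carrier_vec N" for z w
    unfolding m_def using some_ratio[OF that ij] by simp
  have mero: "m meromorphic_on {a}" for a
  proof -
    obtain s \<mu> where l: "local_lift N F (Plane a) s \<mu>"
      using F unfolding holomorphic_curve_def by meson
    then have s: "s > 0" unfolding local_lift_def by simp
    have "eventually (\<lambda>z. m z = \<mu> (z - a) $ i / \<mu> (z - a) $ j) (at a)"
      using eventually_at_ball[OF s, of a UNIV]
    proof eventually_elim
      case (elim z)
      then have "norm (z - a) < s" by (simp add: dist_norm norm_minus_commute)
      note local_liftD[OF l this]
      then show ?case using m by simp
    qed
    moreover have "(\<lambda>z. \<mu> (z - a) $ i / \<mu> (z - a) $ j) meromorphic_on {a}"
    proof -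
      have "(\<lambda>z. \<mu> (z - a) $ l) holomorphic_on ball a s" if "l < N" for l
      proof -
        have "(\<lambda>t. \<mu> t $ l) holomorphic_on ball 0 s" using l that unfolding local_lift_def by auto
        then have "((\<lambda>t. \<mu> t $ l) \<circ> (\<lambda>z. z - a)) holomorphic_on ball a s"
          by (intro holomorphic_on_compose_gen[of _ _ _ "ball 0 s"] holomorphic_intros)
             (auto simp: dist_norm norm_minus_commute)
        then show ?thesis by (simp add: o_def)
      qed
      then have "(\<lambda>z. \<mu> (z - a) $ l) analytic_on {a}" if "l < N" for l
        using that s by (meson analytic_at centre_in_ball open_ball)
      then show ?thesis using ij by (intro meromorphic_intros analytic_on_imp_meromorphic_on)
    qed
    ultimately show ?thesis
      by (subst meromorphic_on_cong[of _ m "\<lambda>z. \<mu> (z - a) $ i / \<mu> (z - a) $ j"]) auto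
  qed
  have r: "r > 0" using lift(1) unfolding local_lift_def by simp
  have cont: "isCont (\<lambda>t. \<nu> t $ l) 0" if "l < N" for l
    using local_lift_continuous[OF lift(1) that] r by simp
  define B where "B = norm (\<nu> 0 $ i / \<nu> 0 $ j) + 1"
  have "((\<lambda>t. norm (\<nu> t $ i / \<nu> t $ j)) \<longlongrightarrow> norm (\<nu> 0 $ i / \<nu> 0 $ j)) (nhds 0)"
    using cont ij lift(2) by (intro tendsto_intros) (auto simp: isCont_def tendsto_nhds_iff)
  then have "eventually (\<lambda>t. norm (\<nu> t $ i / \<nu> t $ j) < B) (nhds 0)"
    by (rule order_tendstoD) (simp add: B_def)
  moreover have "eventually (\<lambda>t. \<nu> t $ j \<noteq> 0) (nhds 0)"
    using cont[OF ij(2)] lift(2) by (intro tendsto_imp_eventually_ne) (auto simp: isCont_def tendsto_nhds_iff)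
  ultimately have "eventually (\<lambda>t. norm (\<nu> t $ i / \<nu> t $ j) < B \<and> \<nu> t $ j \<noteq> 0) (nhds 0)"
    by eventually_elim auto
  then obtain d where d: "d > 0" "\<And>t. norm t < d \<Longrightarrow> norm (\<nu> t $ i / \<nu> t $ j) < B \<and> \<nu> t $ j \<noteq> 0"
    unfolding eventually_nhds_metric by (auto simp: dist_norm)
  define R where "R = 1 / min r d"
  have Rpos: "R > 0" using d r by (simp add: R_def)
  have inv: "norm (1 / z) < r" "norm (1 / z) < d" "z \<noteq> 0" if "norm z > R" for z :: complex
  proof -
    have "norm z > 0" using that Rpos by linarith
    then have "1 / norm z < 1 / R"
      using that Rpos by (intro divide_strict_left_mono) auto
    then have "1 / norm z < min r d" by (simp add: R_def)
    then show "norm (1 / z) < r" "norm (1 / z) < d" by (simp_all add: norm_divide)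
    show "z \<noteq> 0" using that Rpos by auto
  qed
  have minf: "m z = \<nu> (1 / z) $ i / \<nu> (1 / z) $ j" if "norm z > R" for z
  proof -
    note local_liftD[OF lift(1) inv(1)[OF that]]
    then show ?thesis using m inv[OF that] by simp
  qed
  have opn: "open {z::complex. norm z > R}"
    by (intro open_Collect_less continuous_intros)
  have "(\<lambda>z. \<nu> (1 / z) $ l) holomorphic_on {z. norm z > R}" if "l < N" for l
  proof -
    have "(\<lambda>t. \<nu> t $ l) holomorphic_on ball 0 r" using lift(1) that unfolding local_lift_def by auto
    then have "((\<lambda>t. \<nu> t $ l) \<circ> (\<lambda>z. 1 / z)) holomorphic_on {z. norm z > R}"
      using inv by (intro holomorphic_on_compose_gen[of _ _ _ "ball 0 r"] holomorphic_intros) auto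
    then show ?thesis by (simp add: o_def)
  qed
  then have "(\<lambda>z. \<nu> (1 / z) $ i / \<nu> (1 / z) $ j) holomorphic_on {z. norm z > R}"
    using ij d(2) inv by (intro holomorphic_intros) auto
  then have "m holomorphic_on {z. norm z > R}"
    by (subst holomorphic_cong[OF refl, of _ m "\<lambda>z. \<nu> (1 / z) $ i / \<nu> (1 / z) $ j"]) (auto simp: minf)
  then have ana: "m analytic_on {z}" if "norm z > R" for z
    using that opn by (meson analytic_at mem_Collect_eq)
  have bound: "norm (m z) \<le> B" if "norm z > R" for z
    using minf[OF that] d(2)[OF inv(2)[OF that]] by simp
  have "m meromorphic_on UNIV" using mero meromorphic_on_meromorphic_at by blast
  then have "\<exists>p q S. finite S \<and> q \<noteq> 0 \<and> (\<forall>z. z \<notin> S \<longrightarrow> poly q z \<noteq> 0 \<and> m z = poly p z / poly q z)"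
    by (rule rational_of_meromorphic) (fact ana bound)+
  then obtain p q S where pq: "finite S" "q \<noteq> 0" "\<forall>z. z \<notin> S \<longrightarrow> poly q z \<noteq> 0 \<and> m z = poly p z / poly q z"
    by (elim exE conjE)
  have "p = q" if "i = j"
  proof (rule ccontr)
    assume "p \<noteq> q"
    then have "finite {z. poly (p - q) z = 0}" by (intro poly_roots_finite) simp
    then have "finite ({z. poly (p - q) z = 0} \<union> S)" using pq(1) by simp
    then have "bounded ({z. poly (p - q) z = 0} \<union> S)" by (rule finite_imp_bounded)
    then obtain b where b: "\<And>z. z \<in> {z. poly (p - q) z = 0} \<union> S \<Longrightarrow> norm z \<le> b"
      unfolding bounded_iff by blast
    define z where "z = complex_of_real (max R b + 1)"
    have "norm z > R" "norm z > b" using Rpos unfolding z_def norm_of_real by auto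
    then have "m z = 1" "z \<notin> S" "poly (p - q) z \<noteq> 0"
      using minf d(2)[OF inv(2)] that b[of z] by auto
    then show False using pq(3) by auto
  qed
  moreover have "\<forall>z w. z \<notin> S \<longrightarrow> w \<in> carrier_vec N \<longrightarrow> F (Plane z) = proj_class w \<longrightarrow>
         poly q z \<noteq> 0 \<and> w $ i / w $ j = poly p z / poly q z"
    using pq(3) m by metis
  ultimately show ?thesis
    using pq(1,2) by (intro exI[of _ p] exI[of _ q] exI[of _ S] conjI impI)
qed

text \<open>Writing the quotients of coordinates over a common denominator and removing the common factor gives
a polynomial curve that agrees with \<open>F\<close> off a finite set.\<close>

theorem holomorphic_curve_imp_poly_curve:
  assumes F: "holomorphic_curve N F"
  obtains d P where "poly_curve N d P F"
proof -
  obtain r \<nu> where l: "local_lift N F Infty r \<nu>" using F unfolding holomorphic_curve_def by meson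
  then have "\<nu> 0 \<in> carrier_vec N" "\<nu> 0 \<noteq> 0\<^sub>v N" unfolding local_lift_def by auto
  then obtain j where j: "j < N" "\<nu> 0 $ j \<noteq> 0" by (rule nonzero_vecE)
  define good where "good i p q S \<longleftrightarrow> finite S \<and> q \<noteq> 0 \<and>
      (\<forall>z w. z \<notin> S \<longrightarrow> w \<in> carrier_vec N \<longrightarrow> F (Plane z) = proj_class w \<longrightarrow>
         poly q z \<noteq> 0 \<and> w $ i / w $ j = poly p z / poly q z) \<and> (i = j \<longrightarrow> p = q)"
    for i :: nat and p q :: "complex poly" and S :: "complex set"
  have "\<exists>p q S. good i p q S" if i: "i < N" for i
    unfolding good_def by (rule coordinate_ratio_rational[OF F i j(1) l j(2)])
  then obtain p q S where "\<And>i. i < N \<Longrightarrow> good i (p i) (q i) (S i)"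
    by metis
  note pqS = this[unfolded good_def]
  define Q where "Q i = p i * (\<Prod>l\<in>{..<N} - {i}. q l)" for i
  have q0: "q i \<noteq> 0" and finS: "finite (S i)" if "i < N" for i using pqS[OF that] by blast+
  have pj: "p j = q j" using pqS[OF j(1)] by blast
  have "Q j \<noteq> 0" using q0 j(1) by (simp add: Q_def pj)
  obtain h Q' e G where G: "h \<noteq> 0" "\<forall>i<N. Q i = h * Q' i" "poly_curve N e Q' G"
    using poly_curve_of_polys[of j N Q, OF j(1) \<open>Q j \<noteq> 0\<close>] by (elim exE conjE)
  define T where "T = (\<Union>i<N. S i) \<union> {z. poly h z = 0}"
  have "F = G"
  proof (rule holomorphic_curve_eqI[OF F poly_curve_imp_holomorphic_curve[OF G(3)]])
    show "finite T" unfolding T_def using finS poly_roots_finite[OF G(1)] by simp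
    fix z assume z: "z \<notin> T"
    obtain w where w: "w \<in> carrier_vec N" "w \<noteq> 0\<^sub>v N" "F (Plane z) = proj_class w"
      using F unfolding holomorphic_curve_def proj_space_def by blast
    have nz: "poly (q i) z \<noteq> 0" and rat: "w $ i / w $ j = poly (p i) z / poly (q i) z" if "i < N" for i
      using pqS[OF that] z that w(1,3) unfolding T_def by blast+
    have "w $ j \<noteq> 0" using rat[OF j(1)] nz[OF j(1)] pj by auto
    define c where "c = (\<Prod>l\<in>{..<N}. poly (q l) z) / (poly h z * w $ j)"
    have "vec N (\<lambda>i. poly (Q' i) z) = c \<cdot>\<^sub>v w"
    proof (rule eq_vecI)
      fix i assume "i < dim_vec (c \<cdot>\<^sub>v w)"
      then have i: "i < N" using w by simp
      have hz: "poly h z \<noteq> 0" using z unfolding T_def by auto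
      have "poly h z * poly (Q' i) z = poly (Q i) z" using G(2) i by simp
      also have "\<dots> = poly (p i) z * (\<Prod>l\<in>{..<N} - {i}. poly (q l) z)"
        by (simp add: Q_def poly_prod)
      also have "\<dots> = w $ i / w $ j * (\<Prod>l\<in>{..<N}. poly (q l) z)"
        using rat[OF i] nz[OF i] prod.remove[of "{..<N}" i "\<lambda>l. poly (q l) z"] i by simp
      finally show "vec N (\<lambda>i. poly (Q' i) z) $ i = (c \<cdot>\<^sub>v w) $ i"
        using i w hz \<open>w $ j \<noteq> 0\<close> by (simp add: c_def field_simps)
    qed (use w in simp)
    moreover have "c \<noteq> 0" unfolding c_def using nz \<open>w $ j \<noteq> 0\<close> z by (auto simp: T_def)
    ultimately show "F (Plane z) = G (Plane z)"
      using w poly_curve_Plane[OF G(3)] proj_class_smult by simp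
  qed
  then have "poly_curve N e Q' F" using G(3) by simp
  then show ?thesis by (rule that)
qed

section \<open>Osculating vectors under a change of lift and coordinate\<close>

text \<open>The coefficients of the higher chain rule: the \<open>j\<close>-th derivative of \<open>\<phi> \<cdot> (g \<circ> \<tau>)\<close> is the sum over
\<open>i \<le> j\<close> of \<open>chain_coeff \<phi> \<tau> j i\<close> times \<open>g\<^sup>(\<^sup>i\<^sup>) \<circ> \<tau>\<close>. What matters is that they do not depend on \<open>g\<close>, that
they are triangular, and that the diagonal is \<open>\<phi> \<tau>'\<^sup>j\<close>.\<close>

primrec chain_coeff :: "(complex \<Rightarrow> complex) \<Rightarrow> (complex \<Rightarrow> complex) \<Rightarrow> nat \<Rightarrow> nat \<Rightarrow> complex \<Rightarrow> complex" where
  "chain_coeff \<phi> \<tau> 0 i = (if i = 0 then \<phi> else (\<lambda>t. 0))"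
| "chain_coeff \<phi> \<tau> (Suc j) i = (\<lambda>t. deriv (chain_coeff \<phi> \<tau> j i) t +
     (if i = 0 then 0 else chain_coeff \<phi> \<tau> j (i - 1) t * deriv \<tau> t))"

lemma chain_coeff_eq_0: "j < i \<Longrightarrow> chain_coeff \<phi> \<tau> j i = (\<lambda>t. 0)"
  by (induction j arbitrary: i) auto

lemma chain_coeff_diag: "chain_coeff \<phi> \<tau> j j t = \<phi> t * deriv \<tau> t ^ j"
  by (induction j) (auto simp: chain_coeff_eq_0)

lemma holomorphic_chain_coeff:
  assumes "open S" "\<phi> holomorphic_on S" "\<tau> holomorphic_on S"
  shows "chain_coeff \<phi> \<tau> j i holomorphic_on S"
proof (induction j arbitrary: i)
  case (Suc j)
  show ?case
    by (cases i) (auto intro!: holomorphic_intros Suc assms)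
qed (use assms in \<open>auto intro: holomorphic_intros\<close>)

lemma higher_deriv_twisted_compose:
  assumes S: "open S" "\<phi> holomorphic_on S" "\<tau> holomorphic_on S"
    and T: "open T" "\<tau> ` S \<subseteq> T" "g holomorphic_on T" and "t \<in> S"
  shows "(deriv ^^ j) (\<lambda>s. \<phi> s * g (\<tau> s)) t =
    (\<Sum>i\<le>j. chain_coeff \<phi> \<tau> j i t * (deriv ^^ i) g (\<tau> t))"
  using \<open>t \<in> S\<close>
proof (induction j arbitrary: t)
  case (Suc j)
  let ?c = "chain_coeff \<phi> \<tau>" and ?f = "\<lambda>s. \<phi> s * g (\<tau> s)"
  let ?rhs = "\<lambda>t. \<Sum>i\<le>j. ?c j i t * (deriv ^^ i) g (\<tau> t)"
  have "eventually (\<lambda>s. s \<in> S) (nhds t)"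
    using S(1) Suc.prems by (rule eventually_nhds_in_open)
  then have "eventually (\<lambda>s. (deriv ^^ j) ?f s = ?rhs s) (nhds t)"
    by eventually_elim (rule Suc.IH)
  then have "deriv ((deriv ^^ j) ?f) t = deriv ?rhs t"
    by (intro deriv_cong_ev refl)
  also have "(?rhs has_field_derivative (\<Sum>i\<le>j. deriv (?c j i) t * (deriv ^^ i) g (\<tau> t) +
      ?c j i t * ((deriv ^^ Suc i) g (\<tau> t) * deriv \<tau> t))) (at t)"
  proof (rule DERIV_sum)
    fix i
    have 1: "(?c j i has_field_derivative deriv (?c j i) t) (at t)"
      using holomorphic_chain_coeff[OF S] S(1) Suc.prems by (rule holomorphic_derivI)
    have 2: "(\<tau> has_field_derivative deriv \<tau> t) (at t)"
      using S(3,1) Suc.prems by (rule holomorphic_derivI)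
    have "(deriv ^^ i) g holomorphic_on T"
      using T by (simp add: holomorphic_higher_deriv)
    then have 3: "((deriv ^^ i) g has_field_derivative (deriv ^^ Suc i) g (\<tau> t)) (at (\<tau> t))"
      using T Suc.prems holomorphic_derivI by fastforce
    show "((\<lambda>t. ?c j i t * (deriv ^^ i) g (\<tau> t)) has_field_derivative
       deriv (?c j i) t * (deriv ^^ i) g (\<tau> t) + ?c j i t * ((deriv ^^ Suc i) g (\<tau> t) * deriv \<tau> t)) (at t)"
      by (rule DERIV_cong[OF DERIV_mult[OF 1 DERIV_chain2[OF 3 2]]]) (simp add: mult_ac)
  qed
  then have "deriv ?rhs t = (\<Sum>i\<le>j. deriv (?c j i) t * (deriv ^^ i) g (\<tau> t) +
      ?c j i t * ((deriv ^^ Suc i) g (\<tau> t) * deriv \<tau> t))"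
    by (rule DERIV_imp_deriv)
  also have "\<dots> = (\<Sum>i\<le>j. deriv (?c j i) t * (deriv ^^ i) g (\<tau> t)) +
      (\<Sum>i\<le>j. ?c j i t * deriv \<tau> t * (deriv ^^ Suc i) g (\<tau> t))"
    by (simp add: sum.distrib mult_ac)
  also have "(\<Sum>i\<le>j. deriv (?c j i) t * (deriv ^^ i) g (\<tau> t)) =
      (\<Sum>i\<le>Suc j. deriv (?c j i) t * (deriv ^^ i) g (\<tau> t))"
    by (simp add: chain_coeff_eq_0)
  also have "(\<Sum>i\<le>j. ?c j i t * deriv \<tau> t * (deriv ^^ Suc i) g (\<tau> t)) =
      (\<Sum>i\<le>Suc j. (if i = 0 then 0 else ?c j (i - 1) t * deriv \<tau> t) * (deriv ^^ i) g (\<tau> t))"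
    by (subst sum.atMost_Suc_shift) simp
  finally show ?case
    by (simp add: sum.distrib ring_distribs del: sum.atMost_Suc)
qed simp

lemma combinations_nth:
  assumes "m < N choose k"
  shows "length (combinations N k ! m) = k" "distinct (combinations N k ! m)"
    "set (combinations N k ! m) \<subseteq> {..<N}"
proof -
  have "combinations N k ! m \<in> set (combinations N k)"
    using assms by (simp add: length_combinations)
  then have I: "combinations N k ! m \<in> set (subseqs [0..<N])" "length (combinations N k ! m) = k"
    unfolding combinations_def by auto
  show "length (combinations N k ! m) = k" by fact
  show "distinct (combinations N k ! m)"
    using subseqs_distinctD[OF I(1)] by simp
  show "set (combinations N k ! m) \<subseteq> {..<N}"
    using I(1) subseqs_powset[of "[0..<N]"] by (auto simp: atLeast0LessThan)
qed

lemma combinations_nth_less: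
  "m < N choose k \<Longrightarrow> a < k \<Longrightarrow> combinations N k ! m ! a < N"
  using combinations_nth[of m N k] nth_mem by force

lemma wedge_carrier [simp]: "wedge N k v \<in> carrier_vec (N choose k)"
  by (simp add: wedge_def)

lemma wedge_dim [simp]: "dim_vec (wedge N k v) = (N choose k)"
  by (simp add: wedge_def)

lemma wedge_index:
  "m < N choose k \<Longrightarrow> wedge N k v $ m = det (mat k k (\<lambda>(a, b). v b $ (combinations N k ! m ! a)))"
  by (simp add: wedge_def)

lemma wedge_triangular:
  assumes "\<And>i j. i < N \<Longrightarrow> j < k \<Longrightarrow> u j $ i = (\<Sum>l\<le>j. c j l * w l $ i)"
  shows "wedge N k u = (\<Prod>j<k. c j j) \<cdot>\<^sub>v wedge N k w"
proof (rule eq_vecI)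
  fix m assume "m < dim_vec ((\<Prod>j<k. c j j) \<cdot>\<^sub>v wedge N k w)"
  then have m: "m < N choose k" by simp
  define I where "I = combinations N k ! m"
  define W where "W = mat k k (\<lambda>(a, b). w b $ (I ! a))"
  define C where "C = mat k k (\<lambda>(l, j). if l \<le> j then c j l else 0)"
  have "mat k k (\<lambda>(a, b). u b $ (I ! a)) = W * C"
  proof (rule eq_matI)
    fix a b assume "a < dim_row (W * C)" "b < dim_col (W * C)"
    then have ab: "a < k" "b < k" by (simp_all add: W_def C_def)
    have "(W * C) $$ (a, b) = (\<Sum>l\<in>{0..<k}. w l $ (I ! a) * (if l \<le> b then c b l else 0))"
      using ab by (simp add: W_def C_def scalar_prod_def)
    also have "\<dots> = (\<Sum>l\<le>b. c b l * w l $ (I ! a))"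
      using ab by (intro sum.mono_neutral_cong_right) auto
    also have "\<dots> = u b $ (I ! a)"
      using assms[of "I ! a" b] ab combinations_nth_less[OF m, of a] by (simp add: I_def)
    finally show "mat k k (\<lambda>(a, b). u b $ (I ! a)) $$ (a, b) = (W * C) $$ (a, b)"
      using ab by simp
  qed (simp_all add: W_def C_def)
  then have "wedge N k u $ m = det W * det C"
    using m by (simp add: wedge_index I_def[symmetric] W_def C_def det_mult[of _ k])
  also have "det C = (\<Prod>j<k. c j j)"
    by (subst det_upper_triangular[of _ k])
       (auto simp: C_def upper_triangular_def prod_list_diag_prod atLeast0LessThan)
  finally show "wedge N k u $ m = ((\<Prod>j<k. c j j) \<cdot>\<^sub>v wedge N k w) $ m"
    using m by (simp add: wedge_index I_def W_def)
qed simp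

lemma osculating_carrier [simp]: "osculating N k \<nu> t \<in> carrier_vec (N choose k)"
  by (simp add: osculating_def)

text \<open>Passing to another lift and another coordinate multiplies the matrix of derivatives by an upper
triangular matrix (the higher chain rule), so all its minors are multiplied by the
same factor, the product of the diagonal entries.\<close>

lemma osculating_change:
  assumes S: "open S" "\<phi> holomorphic_on S" "\<tau> holomorphic_on S" "t \<in> S"
    and T: "open T" "\<tau> ` S \<subseteq> T" "\<And>i. i < N \<Longrightarrow> (\<lambda>z. \<nu> z $ i) holomorphic_on T"
    and eq: "\<And>s i. s \<in> S \<Longrightarrow> i < N \<Longrightarrow> \<mu> s $ i = \<phi> s * \<nu> (\<tau> s) $ i"
  shows "osculating N k \<mu> t = (\<Prod>j<k. \<phi> t * deriv \<tau> t ^ j) \<cdot>\<^sub>v osculating N k \<nu> (\<tau> t)"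
proof -
  have "higher_deriv_vec N j \<mu> t $ i =
     (\<Sum>l\<le>j. chain_coeff \<phi> \<tau> j l t * higher_deriv_vec N l \<nu> (\<tau> t) $ i)" if "i < N" for i j
  proof -
    have "eventually (\<lambda>s. s \<in> S) (nhds t)"
      using S(1,4) by (rule eventually_nhds_in_open)
    then have "eventually (\<lambda>s. \<mu> s $ i = \<phi> s * \<nu> (\<tau> s) $ i) (nhds t)"
      by eventually_elim (rule eq[OF _ that])
    then have "(deriv ^^ j) (\<lambda>s. \<mu> s $ i) t = (deriv ^^ j) (\<lambda>s. \<phi> s * \<nu> (\<tau> s) $ i) t"
      by (intro higher_deriv_cong_ev refl)
    then show ?thesis
      using higher_deriv_twisted_compose[OF S(1-3) T(1,2) T(3)[OF that] S(4), of j] that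
      by (simp add: higher_deriv_vec_def)
  qed
  then show ?thesis
    unfolding osculating_def by (subst wedge_triangular) (auto simp: chain_coeff_diag)
qed

lemma higher_deriv_poly: "(deriv ^^ j) (poly q) = poly ((pderiv ^^ j) q)" for q :: "complex poly"
proof (induction j)
  case (Suc j)
  have "deriv (poly r) = poly (pderiv r)" for r :: "complex poly"
    by (intro ext DERIV_imp_deriv poly_DERIV)
  with Suc show ?case by simp
qed simp

lemma holomorphic_on_det:
  assumes "\<And>i j. i < k \<Longrightarrow> j < k \<Longrightarrow> (\<lambda>t. A t i j) holomorphic_on S"
  shows "(\<lambda>t. det (mat k k (\<lambda>(i, j). A t i j))) holomorphic_on S"
proof -
  have "(\<lambda>t. \<Sum>p\<in>{p. p permutes {0..<k}}. signof p * (\<Prod>i=0..<k. A t i (p i))) holomorphic_on S"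
    using assms permutes_in_image by (intro holomorphic_intros) fastforce+
  also have "(\<lambda>t. \<Sum>p\<in>{p. p permutes {0..<k}}. signof p * (\<Prod>i=0..<k. A t i (p i))) =
     (\<lambda>t. det (mat k k (\<lambda>(i, j). A t i j)))"
    by (subst det_def'[of _ k]) (auto intro!: ext sum.cong prod.cong dest: permutes_in_image)
  finally show ?thesis .
qed

lemma poly_det: "poly (det (mat k k A)) z = det (mat k k (\<lambda>ij. poly (A ij) z))"
  for A :: "nat \<times> nat \<Rightarrow> complex poly"
proof -
  interpret comm_ring_hom "\<lambda>p. poly p z" by unfold_locales auto
  have "map_mat (\<lambda>p. poly p z) (mat k k A) = mat k k (\<lambda>ij. poly (A ij) z)"
    by (intro eq_matI) auto
  then show ?thesis using hom_det by metis
qed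

section \<open>Associated curves of polynomial curves\<close>

text \<open>The coordinates of \<open>P \<and> P' \<and> \<dots> \<and> P\<^sup>(\<^sup>k\<^sup>-\<^sup>1\<^sup>)\<close>, as polynomials.\<close>

definition plucker_poly :: "nat \<Rightarrow> nat \<Rightarrow> (nat \<Rightarrow> complex poly) \<Rightarrow> nat \<Rightarrow> complex poly" where
  "plucker_poly N k P m = det (mat k k (\<lambda>(a, b). (pderiv ^^ b) (P (combinations N k ! m ! a))))"

lemma osculating_poly:
  assumes "\<And>s i. i < N \<Longrightarrow> \<nu> s $ i = poly (P i) s"
  shows "osculating N k \<nu> t = vec (N choose k) (\<lambda>m. poly (plucker_poly N k P m) t)"
proof -
  have "higher_deriv_vec N b \<nu> t $ i = poly ((pderiv ^^ b) (P i)) t" if "i < N" for i b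
    using that assms higher_deriv_poly[of b "P i"] by (simp add: higher_deriv_vec_def)
  then show ?thesis
    unfolding osculating_def
    by (intro eq_vecI)
       (auto simp: wedge_index plucker_poly_def poly_det combinations_nth_less
             intro!: arg_cong[of _ _ det] eq_matI)
qed

lemma finite_chart:
  assumes "param p t = Plane z"
  obtains S \<tau> where "open S" "t \<in> S" "\<tau> holomorphic_on S" "\<tau> t = z" "deriv \<tau> t \<noteq> 0"
    "\<And>s. s \<in> S \<Longrightarrow> param p s = Plane (\<tau> s)"
proof (cases p)
  case (Plane a)
  have "((\<lambda>s. a + s) has_field_derivative 1) (at t)"
    by (auto intro!: derivative_eq_intros)
  then have "deriv (\<lambda>s. a + s) t = 1" by (rule DERIV_imp_deriv)
  with Plane assms show ?thesis
    by (intro that[of UNIV "\<lambda>s. a + s"]) (auto intro!: holomorphic_intros)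
next
  case Infty
  with assms have t: "t \<noteq> 0" "z = 1 / t" by (auto split: if_splits)
  then have "((\<lambda>s. 1 / s) has_field_derivative - (1 / t\<^sup>2)) (at t)"
    by (auto intro!: derivative_eq_intros simp: power2_eq_square)
  then have "deriv (\<lambda>s. 1 / s) t = - (1 / t\<^sup>2)" by (rule DERIV_imp_deriv)
  with t Infty show ?thesis
    by (intro that[of "- {0}" "\<lambda>s. 1 / s"]) (auto intro!: holomorphic_intros)
qed

text \<open>Away from infinity every local lift is a nonvanishing holomorphic multiple of the
polynomial lift composed with the coordinate change.\<close>

lemma osculating_local_lift:
  assumes F: "poly_curve N d P F" and l: "local_lift N F p r \<nu>" and t: "norm t < r" "param p t = Plane z"
  obtains c where "c \<noteq> 0"
    "osculating N k \<nu> t = c \<cdot>\<^sub>v vec (N choose k) (\<lambda>m. poly (plucker_poly N k P m) z)"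
proof -
  obtain S0 \<tau> where S0: "open S0" "t \<in> S0" "\<tau> holomorphic_on S0" "\<tau> t = z" "deriv \<tau> t \<noteq> 0"
    "\<And>s. s \<in> S0 \<Longrightarrow> param p s = Plane (\<tau> s)"
    using finite_chart[OF t(2)] by metis
  let ?Pz = "\<lambda>z. vec N (\<lambda>i. poly (P i) z)"
  have "?Pz z \<noteq> 0\<^sub>v N" using poly_curve_param(1)[OF F, of "Plane z" 0] by (simp add: poly_lift_Plane)
  then obtain i where i: "i < N" "poly (P i) z \<noteq> 0"
    using nonzero_vecE[of "?Pz z" N] by auto
  define S where "S = ball 0 r \<inter> (S0 \<inter> (\<lambda>s. poly (P i) (\<tau> s)) -` (- {0}))"
  have "continuous_on S0 (\<lambda>s. poly (P i) (\<tau> s))"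
    using S0(3) by (intro continuous_intros holomorphic_on_imp_continuous_on)
  then have "open (S0 \<inter> (\<lambda>s. poly (P i) (\<tau> s)) -` (- {0}))"
    using S0(1) by (intro continuous_open_preimage) auto
  then have S: "open S" "t \<in> S" "S \<subseteq> S0" "S \<subseteq> ball 0 r"
    using t S0(2,4) i unfolding S_def by auto
  define \<phi> where "\<phi> s = \<nu> s $ i / poly (P i) (\<tau> s)" for s
  have rel: "\<nu> s $ j = \<phi> s * poly (P j) (\<tau> s)" and phi: "\<phi> s \<noteq> 0" if s: "s \<in> S" and j: "j < N" for s j
  proof -
    have "norm s < r" "s \<in> S0" "poly (P i) (\<tau> s) \<noteq> 0" using s S by (auto simp: S_def)
    then have "proj_class (\<nu> s) = proj_class (?Pz (\<tau> s))"
      using local_liftD(3)[OF l] S0(6) poly_curve_Plane[OF F] by metis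
    then obtain c where c: "c \<noteq> 0" "\<nu> s = c \<cdot>\<^sub>v ?Pz (\<tau> s)" by (rule proj_class_eqD)
    then have "\<phi> s = c" using i \<open>poly (P i) (\<tau> s) \<noteq> 0\<close> by (simp add: \<phi>_def)
    then show "\<nu> s $ j = \<phi> s * poly (P j) (\<tau> s)" "\<phi> s \<noteq> 0" using c j by simp_all
  qed
  have "(\<lambda>s. \<nu> s $ i) holomorphic_on S" "\<tau> holomorphic_on S"
    using l i(1) S S0(3) unfolding local_lift_def by (meson holomorphic_on_subset)+
  moreover from this have "\<phi> holomorphic_on S"
    unfolding \<phi>_def by (intro holomorphic_intros) (auto simp: S_def)
  ultimately have "osculating N k \<nu> t = (\<Prod>j<k. \<phi> t * deriv \<tau> t ^ j) \<cdot>\<^sub>v osculating N k ?Pz (\<tau> t)"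
    using S rel by (intro osculating_change[where S = S and T = UNIV]) (auto intro!: holomorphic_intros)
  moreover have "(\<Prod>j<k. \<phi> t * deriv \<tau> t ^ j) \<noteq> 0"
    using phi[OF S(2) i(1)] S0(5) by simp
  moreover have "osculating N k ?Pz (\<tau> t) = vec (N choose k) (\<lambda>m. poly (plucker_poly N k P m) z)"
    using osculating_poly[of N ?Pz P k] S0(4) by simp
  ultimately show ?thesis using that by metis
qed

lemma holomorphic_osculating:
  assumes l: "local_lift N F p r \<nu>" and m: "m < N choose k"
  shows "(\<lambda>t. osculating N k \<nu> t $ m) holomorphic_on ball 0 r"
proof -
  have "(deriv ^^ b) (\<lambda>s. \<nu> s $ (combinations N k ! m ! a)) holomorphic_on ball 0 r" if "a < k" for a b
    using l combinations_nth_less[OF m that] unfolding local_lift_def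
    by (intro holomorphic_higher_deriv) auto
  then have "(\<lambda>t. det (mat k k (\<lambda>(a, b). higher_deriv_vec N b \<nu> t $ (combinations N k ! m ! a))))
      holomorphic_on ball 0 r"
    by (intro holomorphic_on_det) (auto simp: higher_deriv_vec_def combinations_nth_less[OF m])
  then show ?thesis using m by (simp add: osculating_def wedge_index)
qed

lemma smult_vec_nonzero_iff:
  fixes v :: "complex vec"
  assumes "v \<in> carrier_vec N" "c \<noteq> 0"
  shows "c \<cdot>\<^sub>v v = 0\<^sub>v N \<longleftrightarrow> v = 0\<^sub>v N"
  using assms by (auto simp: vec_eq_iff)

text \<open>If \<open>Q\<close> is what remains of the Pluecker polynomials of \<open>P\<close> after removal of a common factor \<open>h\<close>,
then the polynomial curve \<open>G\<close> with lift \<open>Q\<close> is the \<open>k\<close>-th associated curve: \<open>Q\<close> extends the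
osculating vectors across the zeros of \<open>h\<close>.\<close>

context
  fixes N k d e :: nat and P Q :: "nat \<Rightarrow> complex poly" and h :: "complex poly"
    and F G :: "riemann_sphere \<Rightarrow> complex vec set"
  assumes F: "poly_curve N d P F" and G: "poly_curve (N choose k) e Q G"
    and h: "h \<noteq> 0" and PQ: "\<forall>m<N choose k. plucker_poly N k P m = h * Q m"
begin

lemma plucker_vec: "vec (N choose k) (\<lambda>m. poly (plucker_poly N k P m) z) =
    poly h z \<cdot>\<^sub>v vec (N choose k) (\<lambda>m. poly (Q m) z)"
  using PQ by (intro eq_vecI) auto

lemma Q_vec_nonzero: "vec (N choose k) (\<lambda>m. poly (Q m) z) \<noteq> 0\<^sub>v (N choose k)"
  using poly_curve_param(1)[OF G, of "Plane z" 0] by (simp add: poly_lift_Plane)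

lemma associated_at_finite:
  assumes l: "local_lift N F p r \<nu>" and t: "norm t < r" "param p t = Plane z"
    and nz: "osculating N k \<nu> t \<noteq> 0\<^sub>v (N choose k)"
  shows "G (param p t) = proj_class (osculating N k \<nu> t)"
proof -
  obtain c where c: "c \<noteq> 0" "osculating N k \<nu> t = c \<cdot>\<^sub>v vec (N choose k) (\<lambda>m. poly (plucker_poly N k P m) z)"
    by (rule osculating_local_lift[OF F l t])
  then have eq: "osculating N k \<nu> t = (c * poly h z) \<cdot>\<^sub>v vec (N choose k) (\<lambda>m. poly (Q m) z)"
    by (simp add: plucker_vec smult_smult_assoc)
  then have "c * poly h z \<noteq> 0" using nz by (auto simp: vec_eq_iff)
  then show ?thesis
    unfolding t(2) poly_curve_Plane[OF G] eq by (simp add: proj_class_smult)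
qed

text \<open>The coordinate at infinity is a finite chart only off its centre. At the centre the claim follows by
continuity, because the osculating vectors themselves form a local lift there.\<close>

lemma associated_at_infinity:
  assumes l: "local_lift N F Infty r \<nu>" and nz: "osculating N k \<nu> 0 \<noteq> 0\<^sub>v (N choose k)"
  shows "G Infty = proj_class (osculating N k \<nu> 0)"
proof -
  have r: "r > 0" using l unfolding local_lift_def by simp
  obtain m where m: "m < N choose k" "osculating N k \<nu> 0 $ m \<noteq> 0"
    using nonzero_vecE[OF _ nz] by auto
  have "isCont (\<lambda>t. osculating N k \<nu> t $ m) 0"
    using holomorphic_osculating[OF l m(1)] r
    by (meson centre_in_ball continuous_on_eq_continuous_at holomorphic_on_imp_continuous_on open_ball)
  then have "eventually (\<lambda>t. osculating N k \<nu> t $ m \<noteq> 0) (nhds 0)"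
    using m(2) by (intro tendsto_imp_eventually_ne) (auto simp: isCont_def tendsto_nhds_iff)
  then obtain \<rho> where \<rho>: "\<rho> > 0" "\<And>t. norm t < \<rho> \<Longrightarrow> osculating N k \<nu> t $ m \<noteq> 0"
    unfolding eventually_nhds_metric by (auto simp: dist_norm)
  define s where "s = min r \<rho>"
  have s: "s > 0" "s \<le> r" "\<And>t. norm t < s \<Longrightarrow> osculating N k \<nu> t \<noteq> 0\<^sub>v (N choose k)"
    using r \<rho> m(1) unfolding s_def by fastforce+
  \<comment> \<open>a curve near infinity for which the osculating vectors are a lift, also at the centre\<close>
  define H where "H q = (case q of Infty \<Rightarrow> proj_class (osculating N k \<nu> 0)
     | Plane z \<Rightarrow> proj_class (osculating N k \<nu> (1 / z)))" for q
  have H: "H (param Infty t) = proj_class (osculating N k \<nu> t)" for t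
    by (simp add: H_def)
  have lH: "local_lift (N choose k) H Infty s (osculating N k \<nu>)"
    unfolding local_lift_def H using s holomorphic_osculating[OF l]
    by (auto intro: holomorphic_on_subset[of _ "ball 0 r"])
  have lG: "local_lift (N choose k) G Infty 1 (poly_lift (N choose k) e Q Infty)"
    using G by (rule poly_curve_local_lift) simp
  have "eventually (\<lambda>t::complex. t \<noteq> 0 \<and> dist t 0 < s) (at 0)"
    using s(1) by (auto simp: eventually_at)
  then have "eventually (\<lambda>t. G (param Infty t) = H (param Infty t)) (at 0)"
  proof eventually_elim
    case (elim t)
    then have "norm t < r" "param Infty t = Plane (1 / t)" using s(2) by auto
    from associated_at_finite[OF l this] show ?case
      unfolding H using s(3) elim by simp
  qed
  from isolated_agreement_extends[OF lG lH this] show ?thesis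
    by (simp add: H_def)
qed

lemma is_associated_curve_poly: "is_associated_curve N k F G"
  unfolding is_associated_curve_def
proof (intro conjI allI impI ballI)
  show "holomorphic_curve (N choose k) G"
    using G by (rule poly_curve_imp_holomorphic_curve)
  fix p r \<nu> t
  assume l: "local_lift N F p r \<nu>" and t: "t \<in> ball 0 r" and nz: "osculating N k \<nu> t \<noteq> 0\<^sub>v (N choose k)"
  show "G (param p t) = proj_class (osculating N k \<nu> t)"
  proof (cases "param p t")
    case (Plane z)
    then show ?thesis using associated_at_finite[OF l _ Plane nz] t by simp
  next
    case Infty
    then have "p = Infty" "t = 0" by (cases p; auto split: if_splits)+
    then show ?thesis using associated_at_infinity l nz by simp
  qed
qed

lemma associated_curve_eq: "associated_curve N k F = G"
  unfolding associated_curve_def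
proof (rule the_equality)
  show "is_associated_curve N k F G" by (rule is_associated_curve_poly)
  fix G' assume G': "is_associated_curve N k F G'"
  show "G' = G"
  proof (rule holomorphic_curve_eqI)
    show "holomorphic_curve (N choose k) G'" "holomorphic_curve (N choose k) G"
      using G' is_associated_curve_poly unfolding is_associated_curve_def by simp_all
    show "finite {z. poly h z = 0}" using h by (rule poly_roots_finite)
    fix z assume z: "z \<notin> {z. poly h z = 0}"
    let ?\<nu> = "poly_lift N d P (Plane 0)"
    have l: "local_lift N F (Plane 0) (norm z + 1) ?\<nu>"
      using F by (rule poly_curve_local_lift) (simp add: add_nonneg_pos)
    have "osculating N k ?\<nu> z = poly h z \<cdot>\<^sub>v vec (N choose k) (\<lambda>m. poly (Q m) z)"
      using osculating_poly[of N ?\<nu> P k z] by (simp add: plucker_vec poly_pcompose)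
    then have "osculating N k ?\<nu> z \<noteq> 0\<^sub>v (N choose k)"
      using z Q_vec_nonzero[of z] smult_vec_nonzero_iff[of _ "N choose k" "poly h z"] by auto
    moreover have "z \<in> ball 0 (norm z + 1)" by simp
    ultimately have "G' (param (Plane 0) z) = G (param (Plane 0) z)"
      using G' is_associated_curve_poly l unfolding is_associated_curve_def by metis
    then show "G' (Plane z) = G (Plane z)" by simp
  qed
qed

end

section \<open>Expansion of minors\<close>

abbreviation maps :: "nat \<Rightarrow> nat \<Rightarrow> (nat \<Rightarrow> nat) set" where
  "maps k N \<equiv> {..<k} \<rightarrow>\<^sub>E {..<N}"

lemma finite_maps: "finite (maps k N)"
  by (intro finite_PiE) auto

text \<open>The unordered form of the Cauchy--Binet expansion, by multilinearity in the columns.\<close>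

lemma det_sum_expand:
  fixes W D :: "nat \<Rightarrow> nat \<Rightarrow> 'a :: comm_ring_1"
  shows "det (mat k k (\<lambda>(a, b). \<Sum>l<N. W a l * D l b)) =
    (\<Sum>f\<in>maps k N. (\<Prod>b<k. D (f b) b) * det (mat k k (\<lambda>(a, b). W a (f b))))"
proof -
  have "det (mat k k (\<lambda>(a, b). \<Sum>l<N. W a l * D l b)) =
     (\<Sum>p | p permutes {0..<k}. signof p * (\<Prod>b<k. \<Sum>l<N. W (p b) l * D l b))"
    by (subst det_col[of _ k]) (auto intro!: sum.cong prod.cong arg_cong2[of _ _ _ _ "(*)"] simp: permutes_in_image)
  also have "\<dots> = (\<Sum>p | p permutes {0..<k}. \<Sum>f\<in>maps k N.
      (\<Prod>b<k. D (f b) b) * (signof p * (\<Prod>b<k. W (p b) (f b))))"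
    by (simp add: prod_sum_PiE sum_distrib_left prod.distrib mult_ac)
  also have "\<dots> = (\<Sum>f\<in>maps k N. (\<Prod>b<k. D (f b) b) *
      (\<Sum>p | p permutes {0..<k}. signof p * (\<Prod>b<k. W (p b) (f b))))"
    by (subst sum.swap) (simp add: sum_distrib_left)
  also have "\<dots> = (\<Sum>f\<in>maps k N. (\<Prod>b<k. D (f b) b) * det (mat k k (\<lambda>(a, b). W a (f b))))"
  proof (intro sum.cong refl arg_cong2[of _ _ _ _ "(*)"])
    fix f
    show "(\<Sum>p | p permutes {0..<k}. signof p * (\<Prod>b<k. W (p b) (f b))) =
        det (mat k k (\<lambda>(a, b). W a (f b)))"
      by (subst det_col[of _ k]) (auto intro!: sum.cong prod.cong arg_cong2[of _ _ _ _ "(*)"] simp: permutes_in_image)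
  qed
  finally show ?thesis .
qed

lemma det_permute_columns:
  assumes "p permutes {0..<k}"
  shows "det (mat k k (\<lambda>(a, b). W a (p b))) = signof p * det (mat k k (\<lambda>(a, b). W a b))"
proof -
  let ?T = "mat k k (\<lambda>(i, j). W j i)"
  have "mat k k (\<lambda>(a, b). W a (p b)) = transpose_mat (mat k k (\<lambda>(i, j). ?T $$ (p i, j)))"
    using permutes_in_image[OF assms] by (intro eq_matI) auto
  moreover have "mat k k (\<lambda>(a, b). W a b) = transpose_mat ?T"
    by (intro eq_matI) auto
  ultimately show ?thesis
    using det_permute_rows[of ?T k p] assms by (simp add: det_transpose[where n = k])
qed

text \<open>Injective maps with the same image differ by a permutation of their arguments, which changes
the minor only by a sign. Hence their contribution to the expansion is a product of two minors.\<close>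

lemma det_sum_group:
  fixes W D :: "nat \<Rightarrow> nat \<Rightarrow> 'a :: comm_ring_1"
  assumes e: "inj_on e {..<k}" "e ` {..<k} \<subseteq> {..<N}"
  shows "(\<Sum>f | f \<in> maps k N \<and> inj_on f {..<k} \<and> f ` {..<k} = e ` {..<k}.
      (\<Prod>b<k. D (f b) b) * det (mat k k (\<lambda>(a, b). W a (f b)))) =
    det (mat k k (\<lambda>(l, b). D (e l) b)) * det (mat k k (\<lambda>(a, b). W a (e b)))"
proof -
  let ?X = "{f. f \<in> maps k N \<and> inj_on f {..<k} \<and> f ` {..<k} = e ` {..<k}}"
  let ?P = "{p. p permutes {0..<k}}"
  define r where "r p = restrict (e \<circ> p) {..<k}" for p
  have pk: "p b < k \<longleftrightarrow> b < k" if "p \<in> ?P" for p b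
    using that permutes_in_image[of p "{0..<k}" b] by simp
  have pim: "p ` {..<k} = {..<k}" if "p \<in> ?P" for p
    using that permutes_image[of p "{0..<k}"] by (simp add: atLeast0LessThan)
  have inj: "inj_on r ?P"
  proof (rule inj_onI, rule ext)
    fix p q b assume p: "p \<in> ?P" and q: "q \<in> ?P" and eq: "r p = r q"
    show "p b = q b"
    proof (cases "b < k")
      case True
      then have "e (p b) = e (q b)" using fun_cong[OF eq, of b] by (simp add: r_def)
      then show ?thesis using e(1) pk p q True by (auto dest: inj_onD)
    next
      case False
      then show ?thesis using p q permutes_not_in[of p "{0..<k}" b] permutes_not_in[of q "{0..<k}" b] by simp
    qed
  qed
  have im: "r ` ?P = ?X"
  proof (intro equalityI subsetI)
    fix f assume "f \<in> r ` ?P"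
    then obtain p where p: "p \<in> ?P" "f = r p" by auto
    have "inj_on p {..<k}" using p(1) permutes_inj_on by auto
    then have "inj_on (e \<circ> p) {..<k}" using e(1) pim[OF p(1)] by (intro comp_inj_on) simp_all
    moreover have "(e \<circ> p) ` {..<k} = e ` {..<k}" using pim[OF p(1)] by (metis image_comp)
    moreover have "f \<in> maps k N" using pk[OF p(1)] e(2) unfolding p(2) r_def by (auto simp: image_subset_iff)
    ultimately show "f \<in> ?X" unfolding p(2) r_def by (simp add: inj_on_restrict_eq)
  next
    fix f assume f: "f \<in> ?X"
    define p where "p b = (if b < k then inv_into {..<k} e (f b) else b)" for b
    have ep: "e (p b) = f b" and pl: "p b < k" if "b < k" for b
    proof -
      have "f b \<in> e ` {..<k}" using f that by auto
      then show "e (p b) = f b" "p b < k"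
        using that f_inv_into_f[of "f b" e "{..<k}"] inv_into_into[of "f b" e "{..<k}"]
        by (auto simp: p_def)
    qed
    have "inj_on p {0..<k}"
    proof (rule inj_onI)
      fix a b assume ab: "a \<in> {0..<k}" "b \<in> {0..<k}" "p a = p b"
      then have "f a = f b" using ep[of a] ep[of b] by simp
      then show "a = b" using f ab inj_onD[of f "{..<k}" a b] by simp
    qed
    moreover have "p ` {0..<k} \<subseteq> {0..<k}" using pl by auto
    ultimately have "bij_betw p {0..<k} {0..<k}"
      using endo_inj_surj[of "{0..<k}" p] by (simp add: bij_betw_def)
    then have "p permutes {0..<k}"
      by (rule bij_imp_permutes) (simp add: p_def)
    moreover have "f = r p"
    proof
      show "f b = r p b" for b
        using f ep[of b] PiE_arb[of f "{..<k}" _ b] by (cases "b < k") (auto simp: r_def)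
    qed
    ultimately show "f \<in> r ` ?P" by blast
  qed
  let ?T = "\<lambda>f. (\<Prod>b<k. D (f b) b) * det (mat k k (\<lambda>(a, b). W a (f b)))"
  have "sum ?T ?X = (\<Sum>p\<in>?P. ?T (r p))"
    unfolding im[symmetric] by (simp add: sum.reindex[OF inj])
  also have "\<dots> = (\<Sum>p\<in>?P. signof p * (\<Prod>b<k. D (e (p b)) b) * det (mat k k (\<lambda>(a, b). W a (e b))))"
  proof (intro sum.cong refl)
    fix p assume p: "p \<in> ?P"
    have "mat k k (\<lambda>(a, b). W a (r p b)) = mat k k (\<lambda>(a, b). W a (e (p b)))"
      by (intro eq_matI) (auto simp: r_def)
    then show "?T (r p) = signof p * (\<Prod>b<k. D (e (p b)) b) * det (mat k k (\<lambda>(a, b). W a (e b)))"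
      using det_permute_columns[of p k "\<lambda>a b. W a (e b)"] p by (simp add: r_def mult_ac)
  qed
  also have "\<dots> = det (mat k k (\<lambda>(l, b). D (e l) b)) * det (mat k k (\<lambda>(a, b). W a (e b)))"
    unfolding sum_distrib_right[symmetric]
    by (subst (2) det_col[of _ k]) (auto intro!: sum.cong prod.cong arg_cong2[of _ _ _ _ "(*)"] simp: pk)
  finally show ?thesis .
qed

lemma det_non_injective:
  assumes "\<not> inj_on f {..<k}"
  shows "det (mat k k (\<lambda>(a, b). W a (f b))) = 0"
proof -
  from assms obtain i j where "i < k" "j < k" "i \<noteq> j" "f i = f j"
    by (auto simp: inj_on_def)
  then show ?thesis
    by (intro det_identical_columns[of _ k i j]) (auto intro!: eq_vecI)
qed

lemma combinations_index:
  assumes "A \<subseteq> {..<N}" "card A = k"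
  shows "\<exists>!m. m < N choose k \<and> set (combinations N k ! m) = A"
proof -
  have "A \<in> set ` set (subseqs [0..<N])"
    using assms(1) subseqs_powset[of "[0..<N]"] by (auto simp: atLeast0LessThan)
  then obtain I where I: "I \<in> set (subseqs [0..<N])" "set I = A" by auto
  then have "length I = k"
    using assms(2) by (metis distinct_card distinct_upt subseqs_distinctD)
  with I have "I \<in> set (combinations N k)" by (simp add: combinations_def)
  then obtain m where m: "m < N choose k" "combinations N k ! m = I"
    by (metis in_set_conv_nth length_combinations)
  have d: "distinct (map set (combinations N k))"
    unfolding combinations_def by (intro distinct_map_filter distinct_set_subseqs) simp
  show ?thesis
  proof (rule ex1I[of _ m])
    show "m < N choose k \<and> set (combinations N k ! m) = A" using m I by simp
    fix m' assume "m' < N choose k \<and> set (combinations N k ! m') = A"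
    then show "m' = m"
      using m I d nth_eq_iff_index_eq[OF d, of m' m] by (simp add: length_combinations)
  qed
qed

text \<open>By Cauchy--Binet, for a fixed matrix \<open>L\<close> the determinant of \<open>L v\<close> is a linear functional of the
Pluecker coordinates of \<open>v\<close>. Such functionals separate the Pluecker vectors of distinct
\<open>k\<close>-subsets of a basis.\<close>

lemma det_functional_of_wedge:
  "det (mat k k (\<lambda>(a, b). \<Sum>i<N. L a i * v b $ i)) =
    (\<Sum>m<N choose k. det (mat k k (\<lambda>(a, b). L a (combinations N k ! m ! b))) * wedge N k v $ m)"
proof -
  define T where "T f = (\<Prod>b<k. v b $ f b) * det (mat k k (\<lambda>(a, b). L a (f b)))" for f
  define X where "X m = {f. f \<in> maps k N \<and> inj_on f {..<k} \<and> f ` {..<k} = set (combinations N k ! m)}" for m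
  have "det (mat k k (\<lambda>(a, b). \<Sum>i<N. L a i * v b $ i)) = sum T (maps k N)"
    unfolding T_def by (rule det_sum_expand)
  also have "\<dots> = sum T (\<Union>m<N choose k. X m)"
  proof (rule sum.mono_neutral_right)
    show "\<forall>f\<in>maps k N - (\<Union>m<N choose k. X m). T f = 0"
    proof
      fix f assume f: "f \<in> maps k N - (\<Union>m<N choose k. X m)"
      have "\<not> inj_on f {..<k}"
      proof
        assume "inj_on f {..<k}"
        then have "card (f ` {..<k}) = k" "f ` {..<k} \<subseteq> {..<N}"
          using f by (auto simp: card_image)
        then obtain m where m: "m < N choose k" "set (combinations N k ! m) = f ` {..<k}"
          using combinations_index by metis
        then have "f \<in> X m" using f \<open>inj_on f {..<k}\<close> by (simp add: X_def)
        then show False using f m(1) by blast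
      qed
      then show "T f = 0" by (simp add: T_def det_non_injective)
    qed
  qed (auto simp: X_def finite_maps)
  also have "\<dots> = (\<Sum>m<N choose k. sum T (X m))"
  proof (rule sum.UNION_disjoint)
    show "\<forall>m\<in>{..<N choose k}. \<forall>m'\<in>{..<N choose k}. m \<noteq> m' \<longrightarrow> X m \<inter> X m' = {}"
    proof (intro ballI impI)
      fix m m' assume m: "m \<in> {..<N choose k}" "m' \<in> {..<N choose k}" "m \<noteq> m'"
      have "set (combinations N k ! m) \<noteq> set (combinations N k ! m')"
        using m combinations_index[of "set (combinations N k ! m)" N k] combinations_nth[of m N k] distinct_card
        by (metis lessThan_iff)
      then show "X m \<inter> X m' = {}" by (auto simp: X_def)
    qed
  qed (auto intro: finite_subset[OF _ finite_maps] simp: X_def)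
  also have "\<dots> = (\<Sum>m<N choose k. det (mat k k (\<lambda>(a, b). L a (combinations N k ! m ! b))) * wedge N k v $ m)"
  proof (intro sum.cong refl)
    fix m assume "m \<in> {..<N choose k}"
    then have m: "m < N choose k" by simp
    let ?e = "\<lambda>b. combinations N k ! m ! b"
    have im: "?e ` {..<k} = set (combinations N k ! m)"
      using combinations_nth(1)[OF m] by (auto simp: set_conv_nth)
    have "inj_on ?e {..<k}"
      using combinations_nth(1,2)[OF m] by (auto simp: inj_on_def nth_eq_iff_index_eq)
    from det_sum_group[OF this, of N "\<lambda>l b. v b $ l" L]
    show "sum T (X m) = det (mat k k (\<lambda>(a, b). L a (combinations N k ! m ! b))) * wedge N k v $ m"
      using combinations_nth(3)[OF m] unfolding im X_def T_def by (simp add: wedge_index[OF m] mult.commute)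
  qed
  finally show ?thesis .
qed

lemma wedge_expand:
  assumes m: "m < N choose k"
    and u: "\<And>i b. i < N \<Longrightarrow> b < k \<Longrightarrow> u b $ i = (\<Sum>l<M. w l $ i * D l b)"
  shows "wedge N k u $ m = (\<Sum>f\<in>maps k M. (\<Prod>b<k. D (f b) b) * wedge N k (\<lambda>b. w (f b)) $ m)"
proof -
  have "wedge N k u $ m = det (mat k k (\<lambda>(a, b). \<Sum>l<M. w l $ (combinations N k ! m ! a) * D l b))"
    unfolding wedge_index[OF m] using u combinations_nth_less[OF m]
    by (intro arg_cong[of _ _ det] eq_matI) auto
  also have "\<dots> = (\<Sum>f\<in>maps k M. (\<Prod>b<k. D (f b) b) * wedge N k (\<lambda>b. w (f b)) $ m)"
    by (subst det_sum_expand) (simp add: wedge_index[OF m])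
  finally show ?thesis .
qed

lemma wedge_non_injective:
  assumes "m < N choose k" "\<not> inj_on f {..<k}"
  shows "wedge N k (\<lambda>b. w (f b)) $ m = 0"
  unfolding wedge_index[OF assms(1)] using assms(2) by (rule det_non_injective)

lemma wedge_group:
  assumes m: "m < N choose k" and e: "inj_on e {..<k}" "e ` {..<k} \<subseteq> {..<M}"
  shows "(\<Sum>f | f \<in> maps k M \<and> inj_on f {..<k} \<and> f ` {..<k} = e ` {..<k}.
      (\<Prod>b<k. D (f b) b) * wedge N k (\<lambda>b. w (f b)) $ m) =
    det (mat k k (\<lambda>(l, b). D (e l) b)) * wedge N k (\<lambda>b. w (e b)) $ m"
  unfolding wedge_index[OF m] by (rule det_sum_group[OF e])

section \<open>Orders of vanishing and Euler operators\<close>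

definition lin_indep_polys :: "nat \<Rightarrow> (nat \<Rightarrow> complex poly) \<Rightarrow> bool" where
  "lin_indep_polys N R \<longleftrightarrow> (\<forall>c. (\<Sum>i<N. smult (c i) (R i)) = 0 \<longrightarrow> (\<forall>i<N. c i = 0))"

lemma order_0_factor:
  fixes s :: "complex poly"
  assumes "coeff s a \<noteq> 0" "\<And>j. j < a \<Longrightarrow> coeff s j = 0"
  obtains U where "s = monom 1 a * U" "poly U 0 \<noteq> 0"
proof -
  have "monom 1 a dvd s" using assms(2) by (simp add: monom_1_dvd_iff')
  then obtain U where U: "s = monom 1 a * U" by blast
  then have "coeff U 0 = coeff s a" by (simp add: coeff_monom_mult)
  with U show ?thesis using that assms(1) by (simp add: poly_0_coeff_0)
qed

text \<open>Order the coefficients of the \<open>R i\<close> by ascending degree; in the row echelon form of this matrix the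
position of a pivot is the order of vanishing at \<open>0\<close> of the corresponding combination.
Independence excludes zero rows.\<close>

lemma echelon_basis:
  assumes "lin_indep_polys N R"
  shows "\<exists>C C' a U. C \<in> carrier_mat N N \<and> C' \<in> carrier_mat N N \<and> C * C' = 1\<^sub>m N \<and> C' * C = 1\<^sub>m N \<and>
    (\<forall>i j. i < j \<longrightarrow> j < N \<longrightarrow> a i < a j) \<and>
    (\<forall>i<N. (\<Sum>j<N. smult (C $$ (i, j)) (R j)) = monom 1 (a i) * U i \<and> poly (U i) 0 \<noteq> 0)"
proof -
  define D where "D = Suc (Max (insert 0 ((\<lambda>i. degree (R i)) ` {..<N})))"
  have deg: "degree (R i) < D" if "i < N" for i
    unfolding D_def using that by (intro le_imp_less_Suc Max_ge) auto
  define A where "A = mat N D (\<lambda>(i, j). coeff (R i) j)"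
  have A: "A \<in> carrier_mat N D" by (simp add: A_def)
  define G where "G = gauss_jordan_single A"
  note gj = gauss_jordan_single[OF A G_def[symmetric]]
  obtain C C' where C: "G = C * A" "C \<in> carrier_mat N N" "C' \<in> carrier_mat N N"
    "C * C' = 1\<^sub>m N" "C' * C = 1\<^sub>m N"
    using gj(4) by blast
  obtain f where f: "pivot_fun G f D"
    using gj(3,2) unfolding row_echelon_form_def by auto
  have dim: "dim_row G = N" using gj(2) by simp
  note piv = pivot_funD[OF dim f]
  define s where "s i = (\<Sum>j<N. smult (C $$ (i, j)) (R j))" for i
  have coeff_s: "coeff (s i) l = G $$ (i, l)" if "i < N" "l < D" for i l
    using that C(2) unfolding s_def C(1) A_def
    by (simp add: coeff_sum scalar_prod_def atLeast0LessThan)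
  have fD: "f i < D" if i: "i < N" for i
  proof (rule ccontr)
    assume "\<not> f i < D"
    then have "coeff (s i) l = 0" if "l < D" for l
      using piv(1)[OF i] piv(2)[OF i, of l] that coeff_s[OF i that] by simp
    moreover have "coeff (s i) l = 0" if "\<not> l < D" for l
    proof -
      have "coeff (R j) l = 0" if "j < N" for j
        using deg[OF that] \<open>\<not> l < D\<close> by (intro coeff_eq_0) simp
      then show ?thesis by (simp add: s_def coeff_sum)
    qed
    ultimately have "s i = 0" by (metis poly_eqI coeff_0)
    then have "C $$ (i, j) = 0" if "j < N" for j
      using assms[unfolded lin_indep_polys_def, THEN spec, of "\<lambda>j. C $$ (i, j)"] that unfolding s_def by blast
    then have "(C * C') $$ (i, i) = 0"
      using C(2,3) i by (simp add: scalar_prod_def)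
    then show False using C(4) i by simp
  qed
  have "f i < f (Suc i)" if "Suc i < N" for i
    using piv(3)[of i] fD[of "Suc i"] that by auto
  then have mono: "f i < f j" if "i < j" "j < N" for i j
    using that by (induction j) (auto simp: less_Suc_eq dest: less_trans)
  have "\<exists>U. s i = monom 1 (f i) * U \<and> poly U 0 \<noteq> 0" if "i < N" for i
  proof (rule order_0_factor[of "s i" "f i"])
    show "coeff (s i) (f i) \<noteq> 0" using coeff_s fD piv(4) that by simp
    show "coeff (s i) j = 0" if "j < f i" for j
      using coeff_s[of i j] fD[of i] piv(2)[of i j] that \<open>i < N\<close> by simp
  qed blast
  then obtain U where "\<And>i. i < N \<Longrightarrow> s i = monom 1 (f i) * U i \<and> poly (U i) 0 \<noteq> 0"
    by metis
  with C mono show ?thesis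
    unfolding s_def by (intro exI[of _ C] exI[of _ C'] exI[of _ f] exI[of _ U]) simp
qed

text \<open>Differentiation lowers orders of vanishing, but \<open>t\<^sup>b D\<^sup>b\<close> preserves them: it takes \<open>t\<^sup>a U\<close> to
\<open>t\<^sup>a\<close> times \<open>euler_poly a U b\<close>, whose value at \<open>0\<close> is the falling factorial \<open>a(a-1)\<cdots>(a-b+1)\<close>
times \<open>U(0)\<close>. This avoids truncated subtraction in exponents.\<close>

primrec euler_poly :: "nat \<Rightarrow> complex poly \<Rightarrow> nat \<Rightarrow> complex poly" where
  "euler_poly a U 0 = U"
| "euler_poly a U (Suc b) =
     smult (of_nat a - of_nat b) (euler_poly a U b) + pCons 0 (pderiv (euler_poly a U b))"

lemma monom_mult_higher_pderiv:
  "monom 1 b * (pderiv ^^ b) (monom 1 a * U) = monom 1 a * euler_poly a U b"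
proof (induction b)
  case (Suc b)
  let ?q = "(pderiv ^^ b) (monom 1 a * U)" and ?E = "euler_poly a U b"
  have X: "pCons 0 (pderiv (monom 1 c * q)) = smult (of_nat c) (monom 1 c * q) + monom 1 (Suc c) * pderiv q"
    for c and q :: "complex poly"
  proof -
    have "pCons 0 (pderiv (monom 1 c :: complex poly)) = smult (of_nat c) (monom 1 c)"
      by (cases c) (simp_all add: pderiv_monom smult_monom flip: monom_Suc)
    moreover have "pCons 0 (pderiv (monom 1 c * q)) = pCons 0 (pderiv (monom 1 c)) * q + pCons 0 (monom 1 c) * pderiv q"
      by (simp add: pderiv_mult mult.commute)
    ultimately show ?thesis by (simp add: monom_Suc)
  qed
  have "monom 1 (Suc b) * pderiv ?q = pCons 0 (pderiv (monom 1 b * ?q)) - smult (of_nat b) (monom 1 b * ?q)"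
    unfolding X by simp
  also have "\<dots> = pCons 0 (pderiv (monom 1 a * ?E)) - smult (of_nat b) (monom 1 a * ?E)"
    by (simp only: Suc.IH)
  also have "\<dots> = monom 1 a * euler_poly a U (Suc b)"
    unfolding X by (simp add: algebra_simps smult_diff_left monom_Suc)
  finally show ?case by simp
qed simp

lemma euler_poly_0: "poly (euler_poly a U b) 0 = (\<Prod>i<b. of_nat a - of_nat i) * poly U 0"
  by (induction b) (auto simp: algebra_simps)

text \<open>A vector in the kernel would give a combination of the falling factorials of degree below \<open>k\<close>, hence a
polynomial of degree below \<open>k\<close>, that vanishes at the \<open>k\<close> distinct points \<open>a l\<close>.\<close>

lemma det_falling_factorial_nonzero:
  fixes a :: "nat \<Rightarrow> nat"
  assumes "inj_on a {..<k}"
  shows "det (mat k k (\<lambda>(l, b). \<Prod>i<b. (of_nat (a l) - of_nat i :: complex))) \<noteq> 0"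
proof
  let ?M = "mat k k (\<lambda>(l, b). \<Prod>i<b. (of_nat (a l) - of_nat i :: complex))"
  assume "det ?M = 0"
  then obtain v where v: "v \<in> carrier_vec k" "v \<noteq> 0\<^sub>v k" "?M *\<^sub>v v = 0\<^sub>v k"
    using det_0_iff_vec_prod_zero_field[of ?M k] by auto
  define q where "q b = (\<Prod>i<b. [:- of_nat i, 1:] :: complex poly)" for b
  have q: "poly (q b) x = (\<Prod>i<b. x - of_nat i)" for b x
    by (simp add: q_def poly_prod)
  have dq: "degree (q b) = b" for b
    unfolding q_def by (subst degree_prod_eq_sum_degree) auto
  define p where "p = (\<Sum>b<k. smult (v $ b) (q b))"
  have roots: "poly p (of_nat (a l)) = 0" if "l < k" for l
  proof -
    have "(?M *\<^sub>v v) $ l = 0" using v(3) that by simp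
    then show ?thesis using v(1) that
      by (simp add: p_def poly_sum q scalar_prod_def atLeast0LessThan mult.commute)
  qed
  have "p = 0"
  proof (rule ccontr)
    assume "p \<noteq> 0"
    have "k > 0" using \<open>p \<noteq> 0\<close> by (cases k) (auto simp: p_def)
    have "degree p \<le> k - 1"
      unfolding p_def using dq by (intro degree_sum_le) (auto intro: order_trans[OF degree_smult_le])
    moreover have "card ((\<lambda>l. of_nat (a l) :: complex) ` {..<k}) = k"
      using assms by (subst card_image) (auto simp: inj_on_def)
    moreover have "card ((\<lambda>l. of_nat (a l) :: complex) ` {..<k}) \<le> card {x. poly p x = 0}"
      using roots by (intro card_mono poly_roots_finite \<open>p \<noteq> 0\<close>) auto
    ultimately show False using card_poly_roots_bound[OF \<open>p \<noteq> 0\<close>] \<open>k > 0\<close> by simp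
  qed
  have "v $ b = 0" if "b < k" for b
    using that
  proof (induction b rule: less_induct)
    case (less b)
    have z: "v $ j * (\<Prod>i<j. of_nat b - of_nat i :: complex) = 0" if "j < k" "j \<noteq> b" for j
    proof (cases "j < b")
      case True then show ?thesis using less.IH that by simp
    next
      case False
      then have "b \<in> {..<j}" using that by simp
      then show ?thesis by (auto intro!: prod_zero bexI[of _ b])
    qed
    have "0 = (\<Sum>j<k. v $ j * (\<Prod>i<j. of_nat b - of_nat i :: complex))"
      using arg_cong[OF \<open>p = 0\<close>, of "\<lambda>p. poly p (of_nat b)"] by (simp add: p_def poly_sum q)
    also have "\<dots> = v $ b * (\<Prod>i<b. of_nat b - of_nat i)"
    proof -
      have "(\<Sum>j\<in>{..<k} - {b}. v $ j * (\<Prod>i<j. of_nat b - of_nat i :: complex)) = 0"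
        by (rule sum.neutral) (use z in blast)
      then show ?thesis using less.prems by (subst sum.remove[of _ b]) simp_all
    qed
    finally show ?case by auto
  qed
  then have "v = 0\<^sub>v k" using v(1) by (intro eq_vecI) auto
  with v(2) show False by simp
qed

lemma det_scale_rows:
  fixes A :: "nat \<Rightarrow> nat \<Rightarrow> 'a :: comm_ring_1"
  shows "det (mat k k (\<lambda>(i, j). c i * A i j)) = (\<Prod>i<k. c i) * det (mat k k (\<lambda>(i, j). A i j))"
proof -
  have "(\<Prod>i=0..<k. mat k k (\<lambda>(i, j). c i * A i j) $$ (i, p i)) =
      (\<Prod>i<k. c i) * (\<Prod>i=0..<k. mat k k (\<lambda>(i, j). A i j) $$ (i, p i))"
    if "p permutes {0..<k}" for p
  proof -
    have "(\<Prod>i=0..<k. mat k k (\<lambda>(i, j). c i * A i j) $$ (i, p i)) =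
        (\<Prod>i=0..<k. c i * mat k k (\<lambda>(i, j). A i j) $$ (i, p i))"
      using permutes_in_image[OF that] by (intro prod.cong) auto
    then show ?thesis by (simp only: prod.distrib atLeast0LessThan)
  qed
  then show ?thesis
    by (simp add: det_def'[where n = k] sum_distrib_left mult.left_commute)
qed

lemma det_euler_nonzero:
  assumes "inj_on a {..<k}" "\<And>l. l < k \<Longrightarrow> poly (U l) 0 \<noteq> 0"
  shows "det (mat k k (\<lambda>(l, b). poly (euler_poly (a l) (U l) b) 0)) \<noteq> 0"
proof -
  have "det (mat k k (\<lambda>(l, b). poly (euler_poly (a l) (U l) b) 0)) =
     (\<Prod>l<k. poly (U l) 0) * det (mat k k (\<lambda>(l, b). \<Prod>i<b. (of_nat (a l) - of_nat i :: complex)))"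
    unfolding euler_poly_0 by (subst det_scale_rows[symmetric]) (simp add: mult.commute)
  then show ?thesis using assms(2) det_falling_factorial_nonzero[OF assms(1)] by simp
qed

text \<open>Among the sets of given cardinality the initial segment has the least sum of orders, and it is the
only one.\<close>

lemma sum_lowest:
  fixes a :: "nat \<Rightarrow> nat"
  assumes "finite I" "I \<subseteq> {..<N}" "\<And>i j. i < j \<Longrightarrow> j < N \<Longrightarrow> a i < a j"
  shows "(\<Sum>b<card I. a b) \<le> sum a I \<and> (I \<noteq> {..<card I} \<longrightarrow> (\<Sum>b<card I. a b) < sum a I)"
  using assms(1,2)
proof (induction "card I" arbitrary: I)
  case 0
  then show ?case by simp
next
  case (Suc c I)
  define M where "M = Max I"
  have ne: "I \<noteq> {}" using Suc.hyps(2) by auto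
  have M: "M \<in> I" "\<And>i. i \<in> I \<Longrightarrow> i \<le> M" using Suc.prems ne by (auto simp: M_def)
  have c: "c = card (I - {M})" using Suc.hyps(2) Suc.prems M by simp
  have IH: "(\<Sum>b<c. a b) \<le> sum a (I - {M})" "I - {M} \<noteq> {..<c} \<Longrightarrow> (\<Sum>b<c. a b) < sum a (I - {M})"
    using Suc.hyps(1)[OF c] Suc.prems unfolding c[symmetric] by auto
  have "I - {M} \<subseteq> {..<M}" using M(2) by force
  then have "c \<le> M" using card_mono[of "{..<M}" "I - {M}"] c by simp
  moreover have "M < N" using M Suc.prems by auto
  ultimately have aM: "a c \<le> a M" "c \<noteq> M \<Longrightarrow> a c < a M"
    using assms(3)[of c M] by (cases "c = M"; simp)+
  have sI: "sum a I = sum a (I - {M}) + a M"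
    using sum.remove[OF Suc.prems(1) M(1), of a] by simp
  have "I = {..<Suc c}" if "I - {M} = {..<c}" "c = M"
    using that M(1) by (auto simp: lessThan_Suc)
  then show ?case
    unfolding sI Suc.hyps(2)[symmetric] using IH aM by (simp; fastforce)
qed

section \<open>The Fubini--Study metric\<close>

definition herm :: "nat \<Rightarrow> complex vec \<Rightarrow> complex vec \<Rightarrow> complex" where
  "herm M Z W = (\<Sum>i<M. Z $ i * cnj (W $ i))"

lemma herm_scalar_prod:
  assumes "Z \<in> carrier_vec M" "W \<in> carrier_vec M"
  shows "Z \<bullet>c W = herm M Z W"
  using assms by (simp add: scalar_prod_def herm_def atLeast0LessThan conjugate_vec_def)

lemma cnj_herm: "cnj (herm M Z W) = herm M W Z"
  by (simp add: herm_def mult.commute)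

lemma herm_self: "herm M Z Z = of_real (\<Sum>i<M. (cmod (Z $ i))\<^sup>2)"
  by (simp add: herm_def complex_norm_square[symmetric] del: of_real_sum) (simp add: of_real_sum)

lemma fubini_study_herm:
  assumes "Z \<in> carrier_vec M" "W \<in> carrier_vec M"
  shows "complex_of_real (fubini_study Z W) =
    (herm M Z Z * herm M W W - herm M W Z * herm M Z W) / (herm M Z Z)\<^sup>2"
proof -
  have "herm M Z Z = of_real (Re (herm M Z Z))" "herm M W W = of_real (Re (herm M W W))"
    by (simp_all add: herm_self)
  moreover have "herm M W Z * herm M Z W = of_real ((cmod (herm M W Z))\<^sup>2)"
    unfolding complex_norm_square cnj_herm ..
  ultimately show ?thesis
    using assms by (simp add: fubini_study_def herm_scalar_prod)
qed

text \<open>If a lift \<open>Z\<close> with derivative \<open>W\<close> is replaced by \<open>\<phi> Z\<close>, then \<open>W\<close> is replaced by \<open>\<phi> W + \<phi>' Z\<close>. The metric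
lives on projective space, so it does not see this.\<close>

lemma fubini_study_lift_change:
  assumes "Z \<in> carrier_vec M" "W \<in> carrier_vec M" "Z' \<in> carrier_vec M" "W' \<in> carrier_vec M"
    and "\<phi> \<noteq> 0" and Z': "\<And>i. i < M \<Longrightarrow> Z' $ i = \<phi> * Z $ i"
    and W': "\<And>i. i < M \<Longrightarrow> W' $ i = \<phi> * W $ i + \<psi> * Z $ i"
  shows "fubini_study Z' W' = fubini_study Z W"
proof -
  have 1: "herm M Z' Z' = \<phi> * cnj \<phi> * herm M Z Z"
    unfolding herm_def sum_distrib_left by (rule sum.cong) (simp_all add: Z' algebra_simps)
  have 2: "herm M W' W' = \<phi> * cnj \<phi> * herm M W W + \<phi> * cnj \<psi> * herm M W Z + \<psi> * cnj \<phi> * herm M Z W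
      + \<psi> * cnj \<psi> * herm M Z Z"
    unfolding herm_def sum_distrib_left sum.distrib[symmetric]
    by (rule sum.cong) (simp_all add: W' algebra_simps)
  have 3: "herm M W' Z' = \<phi> * cnj \<phi> * herm M W Z + \<psi> * cnj \<phi> * herm M Z Z"
    unfolding herm_def sum_distrib_left sum.distrib[symmetric]
    by (rule sum.cong) (simp_all add: W' Z' algebra_simps)
  have 4: "herm M Z' W' = \<phi> * cnj \<phi> * herm M Z W + \<phi> * cnj \<psi> * herm M Z Z"
    unfolding herm_def sum_distrib_left sum.distrib[symmetric]
    by (rule sum.cong) (simp_all add: W' Z' algebra_simps)
  have "herm M Z' Z' * herm M W' W' - herm M W' Z' * herm M Z' W' =
      (\<phi> * cnj \<phi>)\<^sup>2 * (herm M Z Z * herm M W W - herm M W Z * herm M Z W)"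
    unfolding 1 2 3 4 by (simp add: power2_eq_square algebra_simps)
  then have "complex_of_real (fubini_study Z' W') = complex_of_real (fubini_study Z W)"
    using assms(5) unfolding fubini_study_herm[OF assms(1,2)] fubini_study_herm[OF assms(3,4)] 1
    by (simp add: power_mult_distrib)
  then show ?thesis by (simp only: of_real_eq_iff)
qed

lemma fubini_study_scale:
  assumes "Z \<in> carrier_vec M" "W \<in> carrier_vec M"
  shows "fubini_study Z (c \<cdot>\<^sub>v W) = (cmod c)\<^sup>2 * fubini_study Z W"
proof -
  have h: "herm M (c \<cdot>\<^sub>v W) (c \<cdot>\<^sub>v W) = c * cnj c * herm M W W" "herm M (c \<cdot>\<^sub>v W) Z = c * herm M W Z"
    "herm M Z (c \<cdot>\<^sub>v W) = cnj c * herm M Z W"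
    using assms by (simp_all add: herm_def sum_distrib_left mult_ac)
  have "complex_of_real (fubini_study Z (c \<cdot>\<^sub>v W)) = complex_of_real ((cmod c)\<^sup>2 * fubini_study Z W)"
    using assms unfolding of_real_mult fubini_study_herm[OF assms] complex_norm_square
    by (subst fubini_study_herm[of _ M]) (simp_all add: h algebra_simps diff_divide_distrib)
  then show ?thesis by (simp only: of_real_eq_iff)
qed

text \<open>Strict Cauchy--Schwarz inequality: the numerator is \<open>|Z|\<^sup>2\<close> times the squared norm of the
component of \<open>W\<close> orthogonal to \<open>Z\<close>.\<close>

lemma fubini_study_pos:
  assumes "Z \<in> carrier_vec M" "W \<in> carrier_vec M"
    and indep: "\<And>\<alpha> \<beta>. (\<And>i. i < M \<Longrightarrow> \<alpha> * Z $ i + \<beta> * W $ i = 0) \<Longrightarrow> \<alpha> = 0 \<and> \<beta> = 0"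
  shows "fubini_study Z W > 0"
proof -
  let ?z = "\<Sum>i<M. (cmod (Z $ i))\<^sup>2"
  have "\<exists>i<M. Z $ i \<noteq> 0" using indep[of 1 0] by auto
  then obtain i where i: "i < M" "Z $ i \<noteq> 0" by blast
  then have "(cmod (Z $ i))\<^sup>2 \<le> ?z" by (intro member_le_sum) auto
  then have zpos: "?z > 0" using i(2) by (smt (verit) zero_less_norm_iff zero_less_power)
  have z0: "herm M Z Z \<noteq> 0" using zpos unfolding herm_self of_real_eq_0_iff by simp
  define c where "c = herm M W Z / herm M Z Z"
  define V where "V = vec M (\<lambda>i. W $ i - c * Z $ i)"
  have "\<exists>i<M. W $ i - c * Z $ i \<noteq> 0"
    using indep[of "-c" 1] by (force simp: algebra_simps)
  then obtain j where j: "j < M" "V $ j \<noteq> 0" by (auto simp: V_def)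
  then have "(cmod (V $ j))\<^sup>2 \<le> (\<Sum>i<M. (cmod (V $ i))\<^sup>2)" by (intro member_le_sum) auto
  then have vpos: "(\<Sum>i<M. (cmod (V $ i))\<^sup>2) > 0" using j(2) by (smt (verit) zero_less_norm_iff zero_less_power)
  have "herm M V V = herm M W W - c * herm M Z W - cnj c * herm M W Z + c * cnj c * herm M Z Z"
    unfolding herm_def sum_distrib_left sum.distrib[symmetric] sum_subtractf[symmetric]
    by (rule sum.cong) (simp_all add: V_def algebra_simps)
  also have "c * cnj c * herm M Z Z = cnj c * herm M W Z"
    using z0 by (simp add: c_def)
  finally have "herm M V V = herm M W W - c * herm M Z W" by simp
  then have "herm M Z Z * herm M W W - herm M W Z * herm M Z W = herm M V V * herm M Z Z"
    using z0 by (simp add: c_def field_simps)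
  then have "complex_of_real (fubini_study Z W) = herm M V V / herm M Z Z"
    using z0 unfolding fubini_study_herm[OF assms(1,2)] by (simp add: power2_eq_square)
  also have "\<dots> = complex_of_real ((\<Sum>i<M. (cmod (V $ i))\<^sup>2) / ?z)"
    unfolding herm_self of_real_divide ..
  finally show ?thesis using zpos vpos by (simp only: of_real_eq_iff) simp
qed

lemma continuous_fubini_study:
  assumes "\<And>t. t \<in> S \<Longrightarrow> Z t \<in> carrier_vec M" "\<And>t. t \<in> S \<Longrightarrow> W t \<in> carrier_vec M"
    and "\<And>i. i < M \<Longrightarrow> continuous_on S (\<lambda>t. Z t $ i)" "\<And>i. i < M \<Longrightarrow> continuous_on S (\<lambda>t. W t $ i)"
    and nz: "\<And>t. t \<in> S \<Longrightarrow> Z t \<noteq> 0\<^sub>v M"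
  shows "continuous_on S (\<lambda>t. fubini_study (Z t) (W t))"
proof -
  have z0: "herm M (Z t) (Z t) \<noteq> 0" if t: "t \<in> S" for t
  proof -
    obtain i where i: "i < M" "Z t $ i \<noteq> 0" using nonzero_vecE[OF assms(1)[OF t] nz[OF t]] .
    then have "(cmod (Z t $ i))\<^sup>2 \<le> (\<Sum>i<M. (cmod (Z t $ i))\<^sup>2)" by (intro member_le_sum) auto
    then show ?thesis using i(2) unfolding herm_self of_real_eq_0_iff
      by (smt (verit) zero_less_norm_iff zero_less_power)
  qed
  have "continuous_on S (\<lambda>t. Re ((herm M (Z t) (Z t) * herm M (W t) (W t) - herm M (W t) (Z t) * herm M (Z t) (W t)) / (herm M (Z t) (Z t))\<^sup>2))"
    using z0 assms(3,4) unfolding herm_def by (intro continuous_intros) auto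
  then show ?thesis
    using assms(1,2) by (subst continuous_on_cong[OF refl]) (auto simp flip: fubini_study_herm)
qed

text \<open>Any two lifts differ by a holomorphic factor, so they give the same pullback of the metric, and its
order of vanishing at \<open>0\<close> is well defined.\<close>

lemma has_ramification_index_unique:
  assumes "has_ramification_index N F p \<gamma>" "has_ramification_index N F p \<gamma>'"
  shows "\<gamma> = \<gamma>'"
proof -
  have le: "\<gamma>' \<le> \<gamma>" if A: "has_ramification_index N F p \<gamma>" and B: "has_ramification_index N F p \<gamma>'" for \<gamma> \<gamma>'
  proof (rule ccontr)
    assume lt: "\<not> \<gamma>' \<le> \<gamma>"
    obtain r \<nu> h where l: "local_lift N F p r \<nu>" and h: "continuous_on (ball 0 r) h" "h 0 > 0"
      and fs: "\<forall>t\<in>ball 0 r. fubini_study (\<nu> t) (higher_deriv_vec N 1 \<nu> t) = cmod t ^ (2 * \<gamma>) * h t"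
      using A unfolding has_ramification_index_def by blast
    obtain r' \<nu>' h' where l': "local_lift N F p r' \<nu>'" and h': "continuous_on (ball 0 r') h'" "h' 0 > 0"
      and fs': "\<forall>t\<in>ball 0 r'. fubini_study (\<nu>' t) (higher_deriv_vec N 1 \<nu>' t) = cmod t ^ (2 * \<gamma>') * h' t"
      using B unfolding has_ramification_index_def by blast
    have r: "r > 0" "r' > 0" using l l' unfolding local_lift_def by auto
    have eq: "fubini_study (\<nu>' t) (higher_deriv_vec N 1 \<nu>' t) = fubini_study (\<nu> t) (higher_deriv_vec N 1 \<nu> t)"
      if t: "norm t < r" "norm t < r'" for t
    proof -
      obtain i where i: "i < N" "\<nu> t $ i \<noteq> 0"
        using nonzero_vecE[OF local_liftD(1,2)[OF l t(1)]] .
      define S where "S = ball 0 r' \<inter> (ball 0 r \<inter> (\<lambda>s. \<nu> s $ i) -` (- {0}))"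
      have hol: "(\<lambda>s. \<nu> s $ j) holomorphic_on ball 0 r" "(\<lambda>s. \<nu>' s $ j) holomorphic_on ball 0 r'" if "j < N" for j
        using l l' that unfolding local_lift_def by auto
      have "open (ball 0 r \<inter> (\<lambda>s. \<nu> s $ i) -` (- {0}))"
        using hol(1)[OF i(1)] by (intro continuous_open_preimage holomorphic_on_imp_continuous_on) auto
      then have S: "open S" "t \<in> S" using t i unfolding S_def by auto
      define \<phi> where "\<phi> s = \<nu>' s $ i / \<nu> s $ i" for s
      have rel: "\<nu>' s $ j = \<phi> s * \<nu> s $ j" "\<phi> s \<noteq> 0" if s: "s \<in> S" and j: "j < N" for s j
      proof -
        have s': "norm s < r" "norm s < r'" "\<nu> s $ i \<noteq> 0" using s by (auto simp: S_def)
        then have "proj_class (\<nu>' s) = proj_class (\<nu> s)"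
          using local_liftD(3)[OF l] local_liftD(3)[OF l'] by metis
        then obtain c where c: "c \<noteq> 0" "\<nu>' s = c \<cdot>\<^sub>v \<nu> s" by (rule proj_class_eqD)
        moreover have "dim_vec (\<nu> s) = N" using local_liftD(1)[OF l s'(1)] by simp
        ultimately show "\<nu>' s $ j = \<phi> s * \<nu> s $ j" "\<phi> s \<noteq> 0"
          using i s'(3) j by (simp_all add: \<phi>_def)
      qed
      have hphi: "\<phi> holomorphic_on S"
        unfolding \<phi>_def using hol(1,2)[OF i(1)]
        by (intro holomorphic_intros) (auto simp: S_def intro: holomorphic_on_subset)
      have "higher_deriv_vec N 1 \<nu>' t $ j = \<phi> t * higher_deriv_vec N 1 \<nu> t $ j + deriv \<phi> t * \<nu> t $ j" if j: "j < N" for j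
      proof -
        have "eventually (\<lambda>s. s \<in> S) (nhds t)" using S by (rule eventually_nhds_in_open)
        then have "eventually (\<lambda>s. \<nu>' s $ j = \<phi> s * \<nu> s $ j) (nhds t)"
          by eventually_elim (rule rel(1)[OF _ j])
        then have "deriv (\<lambda>s. \<nu>' s $ j) t = deriv (\<lambda>s. \<phi> s * \<nu> s $ j) t"
          by (intro deriv_cong_ev refl)
        also have "\<dots> = \<phi> t * deriv (\<lambda>s. \<nu> s $ j) t + deriv \<phi> t * \<nu> t $ j"
          using hphi hol(1)[OF j] S t
          by (intro deriv_mult) (auto simp: holomorphic_on_imp_differentiable_at)
        finally show ?thesis using j by (simp add: higher_deriv_vec_def)
      qed
      then show ?thesis
        using local_liftD(1)[OF l t(1)] local_liftD(1)[OF l' t(2)] rel[OF S(2)] i(1)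
        by (intro fubini_study_lift_change[where M = N and \<phi> = "\<phi> t" and \<psi> = "deriv \<phi> t"])
           (auto simp: higher_deriv_vec_def)
    qed
    define \<delta> where "\<delta> = \<gamma>' - \<gamma>"
    have \<delta>: "\<delta> > 0" "2 * \<gamma>' = 2 * \<gamma> + 2 * \<delta>" using lt by (auto simp: \<delta>_def)
    have "isCont h 0" "isCont h' 0"
      using h(1) h'(1) r by (metis centre_in_ball continuous_on_eq_continuous_at open_ball)+
    then have lim: "((\<lambda>t. h t - cmod t ^ (2 * \<delta>) * h' t) \<longlongrightarrow> h 0 - cmod 0 ^ (2 * \<delta>) * h' 0) (at 0)"
      by (intro tendsto_intros) (auto simp: isCont_def)
    have "eventually (\<lambda>t::complex. t \<noteq> 0 \<and> dist t 0 < min r r') (at 0)"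
      using r by (auto simp: eventually_at intro!: exI[of _ "min r r'"])
    then have "eventually (\<lambda>t. h t - cmod t ^ (2 * \<delta>) * h' t = 0) (at 0)"
    proof eventually_elim
      case (elim t)
      then have "cmod t ^ (2 * \<gamma>) * h t = cmod t ^ (2 * \<gamma>') * h' t"
        using eq[of t] fs fs' by simp
      then show ?case using elim by (simp add: \<delta>(2) power_add)
    qed
    from Lim_transform_eventually[OF lim this]
    have "h 0 - cmod 0 ^ (2 * \<delta>) * h' 0 = 0" by (simp add: tendsto_const_iff)
    then show False using h(2) \<delta>(1) by (simp add: zero_power)
  qed
  show ?thesis using le[OF assms] le[OF assms(2,1)] by simp
qed

text \<open>The derivative of \<open>Z0 + t\<^sup>\<gamma>\<^sup>+\<^sup>1 Y\<close> is \<open>t\<^sup>\<gamma>\<close> times a vector that at \<open>0\<close> is \<open>(\<gamma> + 1) Y(0)\<close>. As this is not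
proportional to \<open>Z0\<close>, the metric coefficient without the factor \<open>|t|\<^sup>2\<^sup>\<gamma>\<close> is positive at \<open>0\<close>.\<close>

lemma has_ramification_indexI:
  assumes \<mu>: "local_lift M G p r \<mu>" and \<rho>: "\<rho> > 0"
    and Z0: "Z0 \<in> carrier_vec M"
    and hol: "\<And>m. m < M \<Longrightarrow> Y m holomorphic_on ball 0 \<rho>"
    and eq: "\<And>t. t \<noteq> 0 \<Longrightarrow> norm t < \<rho> \<Longrightarrow>
       G (param p t) = proj_class (vec M (\<lambda>m. Z0 $ m + t ^ Suc \<gamma> * Y m t))"
    and indep: "\<And>\<alpha> \<beta>. (\<And>m. m < M \<Longrightarrow> \<alpha> * Z0 $ m + \<beta> * Y m 0 = 0) \<Longrightarrow> \<alpha> = 0 \<and> \<beta> = 0"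
  shows "has_ramification_index M G p \<gamma>"
proof -
  define Z where "Z t = vec M (\<lambda>m. Z0 $ m + t ^ Suc \<gamma> * Y m t)" for t
  have Zi: "Z t $ m = Z0 $ m + t ^ Suc \<gamma> * Y m t" if "m < M" for m t
    using that by (simp add: Z_def)
  have Zhol: "(\<lambda>t. Z t $ m) holomorphic_on ball 0 \<rho>" if "m < M" for m
    unfolding Zi[OF that] using hol[OF that] by (intro holomorphic_intros)
  have "\<exists>m<M. Z0 $ m \<noteq> 0" using indep[of 1 0] by auto
  then obtain m0 where m0: "m0 < M" "Z0 $ m0 \<noteq> 0" by blast
  have "isCont (\<lambda>t. Z t $ m0) 0"
    using Zhol[OF m0(1)] \<rho> by (meson centre_in_ball continuous_on_eq_continuous_at holomorphic_on_imp_continuous_on open_ball)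
  moreover have "Z 0 $ m0 \<noteq> 0" using m0 by (simp add: Zi)
  ultimately have "eventually (\<lambda>t. Z t $ m0 \<noteq> 0) (nhds 0)"
    by (intro tendsto_imp_eventually_ne) (auto simp: isCont_def tendsto_nhds_iff)
  then obtain \<delta>' where \<delta>': "\<delta>' > 0" "\<And>t. norm t < \<delta>' \<Longrightarrow> Z t $ m0 \<noteq> 0"
    unfolding eventually_nhds_metric by (auto simp: dist_norm)
  define \<delta> where "\<delta> = min \<rho> \<delta>'"
  have \<delta>: "\<delta> > 0" "\<delta> \<le> \<rho>" using \<rho> \<delta>' by (auto simp: \<delta>_def)
  have Znz: "Z t \<noteq> 0\<^sub>v M" if "norm t < \<delta>" for t
    using \<delta>'(2)[of t] that m0(1) by (auto simp: \<delta>_def)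
  have sub: "ball 0 \<delta> \<subseteq> ball 0 \<rho>" using \<delta> by auto
  have Zc: "Z t \<in> carrier_vec M" for t by (simp add: Z_def)
  \<comment> \<open>The formula describes \<open>G\<close> only off \<open>p\<close>; the value at \<open>p\<close> is then forced.\<close>
  define H where "H q = (if q = p then proj_class (Z 0) else G q)" for q
  have "param p t = p \<longleftrightarrow> t = 0" for t by (cases p) auto
  then have H: "H (param p t) = proj_class (Z t)" if "norm t < \<delta>" for t
    using eq[of t] that \<delta>(2) by (auto simp: H_def Z_def)
  have lH: "local_lift M H p \<delta> Z"
    unfolding local_lift_def using H Znz Zc sub \<delta>(1) by (auto intro: holomorphic_on_subset[OF Zhol])
  have "eventually (\<lambda>t::complex. t \<noteq> 0 \<and> dist t 0 < \<delta>) (at 0)"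
    using \<delta>(1) by (auto simp: eventually_at)
  then have "eventually (\<lambda>t. G (param p t) = H (param p t)) (at 0)"
  proof eventually_elim
    case (elim t)
    then have "norm t < \<delta>" "t \<noteq> 0" "norm t < \<rho>" using \<delta>(2) by auto
    then show ?case using H eq by (simp add: Z_def)
  qed
  then have "G p = H p" by (rule isolated_agreement_extends[OF \<mu> lH])
  then have "G = H" by (auto simp: H_def fun_eq_iff)
  then have lG: "local_lift M G p \<delta> Z" using lH by simp
  define X where "X t = vec M (\<lambda>m. of_nat (Suc \<gamma>) * Y m t + t * deriv (Y m) t)" for t
  have Xc: "X t \<in> carrier_vec M" for t by (simp add: X_def)
  have der: "higher_deriv_vec M 1 Z t = t ^ \<gamma> \<cdot>\<^sub>v X t" if t: "norm t < \<delta>" for t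
  proof (rule eq_vecI)
    fix m assume "m < dim_vec (t ^ \<gamma> \<cdot>\<^sub>v X t)"
    then have m: "m < M" by (simp add: X_def)
    have "(Y m has_field_derivative deriv (Y m) t) (at t)"
      using hol[OF m] t \<delta>(2) by (intro holomorphic_derivI[of _ "ball 0 \<rho>"]) auto
    from DERIV_add[OF DERIV_const DERIV_mult[OF DERIV_power[OF DERIV_ident] this]]
    have "((\<lambda>t. Z0 $ m + t ^ Suc \<gamma> * Y m t) has_field_derivative
        t ^ \<gamma> * (of_nat (Suc \<gamma>) * Y m t + t * deriv (Y m) t)) (at t)"
      by (rule DERIV_cong) (simp add: algebra_simps)
    then have "deriv (\<lambda>t. Z t $ m) t = t ^ \<gamma> * (of_nat (Suc \<gamma>) * Y m t + t * deriv (Y m) t)"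
      unfolding Zi[OF m] by (rule DERIV_imp_deriv)
    then show "higher_deriv_vec M 1 Z t $ m = (t ^ \<gamma> \<cdot>\<^sub>v X t) $ m"
      using m by (simp add: higher_deriv_vec_def X_def)
  qed (simp add: higher_deriv_vec_def X_def)
  define h where "h t = fubini_study (Z t) (X t)" for t
  have "continuous_on (ball 0 \<delta>) h"
    unfolding h_def
  proof (rule continuous_fubini_study[where M = M])
    show "continuous_on (ball 0 \<delta>) (\<lambda>t. Z t $ m)" if "m < M" for m
      using Zhol[OF that] sub by (meson continuous_on_subset holomorphic_on_imp_continuous_on)
    have "(\<lambda>t. X t $ m) holomorphic_on ball 0 \<rho>" if "m < M" for m
      using hol[OF that] that by (simp add: X_def) (intro holomorphic_intros; simp)
    then show "continuous_on (ball 0 \<delta>) (\<lambda>t. X t $ m)" if "m < M" for m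
      using that sub by (meson continuous_on_subset holomorphic_on_imp_continuous_on)
  qed (auto simp: Zc Xc Znz)
  moreover have "h 0 > 0"
    unfolding h_def
  proof (rule fubini_study_pos[where M = M])
    fix \<alpha> \<beta> assume "\<And>m. m < M \<Longrightarrow> \<alpha> * Z 0 $ m + \<beta> * X 0 $ m = 0"
    then have "\<alpha> * Z0 $ m + (\<beta> * of_nat (Suc \<gamma>)) * Y m 0 = 0" if "m < M" for m
      using that by (simp add: Zi X_def mult.assoc)
    from indep[OF this] show "\<alpha> = 0 \<and> \<beta> = 0" by (simp del: of_nat_Suc)
  qed (auto simp: Zc Xc)
  moreover have "fubini_study (Z t) (higher_deriv_vec M 1 Z t) = cmod t ^ (2 * \<gamma>) * h t" if "t \<in> ball 0 \<delta>" for t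
    using that der[of t] fubini_study_scale[OF Zc Xc] by (simp add: h_def norm_power power_mult[symmetric] mult.commute)
  ultimately show ?thesis
    unfolding has_ramification_index_def using lG by blast
qed

section \<open>Leading terms of the osculating vectors\<close>

lemma wedge_dual:
  assumes dual: "\<And>l l'. l < N \<Longrightarrow> l' < N \<Longrightarrow> (\<Sum>i<N. C l i * w l' $ i) = (if l = l' then 1 else (0::complex))"
    and e: "\<And>b. b < k \<Longrightarrow> e b < N" "\<And>b. b < k \<Longrightarrow> e' b < N"
    and agree: "\<And>a b. a < k \<Longrightarrow> b < k \<Longrightarrow> e a = e' b \<Longrightarrow> a = b"
  shows "(\<Sum>m<N choose k. det (mat k k (\<lambda>(a, b). C (e a) (combinations N k ! m ! b))) * wedge N k (\<lambda>b. w (e' b)) $ m) =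
    (\<Prod>b<k. if e b = e' b then 1 else 0)"
proof -
  have "det (mat k k (\<lambda>(a, b). \<Sum>i<N. C (e a) i * w (e' b) $ i)) =
      det (mat k k (\<lambda>(a, b). if e a = e' b then 1 else 0 :: complex))"
    using dual e by (intro arg_cong[of _ _ det] eq_matI) auto
  also have "\<dots> = prod_list (diag_mat (mat k k (\<lambda>(a, b). if e a = e' b then 1 else 0 :: complex)))"
  proof (rule det_upper_triangular[of _ k])
    show "upper_triangular (mat k k (\<lambda>(a, b). if e a = e' b then 1 else 0 :: complex))"
      unfolding upper_triangular_def
    proof (intro allI impI)
      fix i j assume "i < dim_row (mat k k (\<lambda>(a, b). if e a = e' b then 1 else 0 :: complex))" "j < i"
      then show "mat k k (\<lambda>(a, b). if e a = e' b then 1 else 0 :: complex) $$ (i, j) = 0"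
        using agree[of i j] by auto
    qed
  qed simp
  also have "\<dots> = (\<Prod>b<k. if e b = e' b then 1 else 0)"
    by (simp add: prod_list_diag_prod atLeast0LessThan)
  finally show ?thesis
    using det_functional_of_wedge[where k = k and N = N and L = "\<lambda>a. C (e a)" and v = "\<lambda>b. w (e' b)"] by simp
qed

text \<open>The increasing enumeration \<open>0, \<dots>, k-2, k\<close>.\<close>

definition last_shift :: "nat \<Rightarrow> nat \<Rightarrow> nat" where
  "last_shift k b = (if Suc b = k then k else b)"

lemma wedge_pair_independent:
  assumes dual: "\<And>l l'. l < N \<Longrightarrow> l' < N \<Longrightarrow> (\<Sum>i<N. C l i * w l' $ i) = (if l = l' then 1 else (0::complex))"
    and k: "1 \<le> k" "k < N"
    and eq: "\<And>m. m < N choose k \<Longrightarrow> \<alpha> * wedge N k w $ m + \<beta> * wedge N k (\<lambda>b. w (last_shift k b)) $ m = 0"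
  shows "\<alpha> = 0 \<and> \<beta> = 0"
proof -
  have "\<alpha> * (\<Prod>b<k. if e b = b then 1 else 0) + \<beta> * (\<Prod>b<k. if e b = last_shift k b then 1 else 0) = 0"
    if "e = (\<lambda>b. b) \<or> e = last_shift k" for e
  proof -
    let ?d = "\<lambda>m. det (mat k k (\<lambda>(a, b). C (e a) (combinations N k ! m ! b)))"
    have "(\<Sum>m<N choose k. ?d m * wedge N k w $ m) = (\<Prod>b<k. if e b = b then 1 else 0)"
      using that k by (intro wedge_dual[where e' = "\<lambda>b. b", OF dual]) (auto simp: last_shift_def split: if_splits)
    moreover have "(\<Sum>m<N choose k. ?d m * wedge N k (\<lambda>b. w (last_shift k b)) $ m) =
        (\<Prod>b<k. if e b = last_shift k b then 1 else 0)"
      using that k by (intro wedge_dual[OF dual]) (auto simp: last_shift_def split: if_splits)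
    moreover have "\<alpha> * (\<Sum>m<N choose k. ?d m * wedge N k w $ m) +
        \<beta> * (\<Sum>m<N choose k. ?d m * wedge N k (\<lambda>b. w (last_shift k b)) $ m) =
        (\<Sum>m<N choose k. ?d m * (\<alpha> * wedge N k w $ m + \<beta> * wedge N k (\<lambda>b. w (last_shift k b)) $ m))"
      by (simp add: sum_distrib_left sum.distrib algebra_simps)
    ultimately show ?thesis using eq by simp
  qed
  note * = this
  have "k - 1 < k" "last_shift k (k - 1) \<noteq> k - 1" using k by (auto simp: last_shift_def)
  then have z: "(\<Prod>b<k. if last_shift k b = b then 1 else 0 :: complex) = 0"
    "(\<Prod>b<k. if b = last_shift k b then 1 else 0 :: complex) = 0"
    by (auto intro!: prod_zero bexI[of _ "k - 1"])
  show ?thesis using *[of "\<lambda>b. b"] *[of "last_shift k"] z by simp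
qed

text \<open>The power of \<open>t\<close> on the left distributes over the \<open>k\<close> columns of derivatives and turns their
entries into powers \<open>t\<^sup>a\<close> times Euler polynomials.\<close>

lemma osculating_sum:
  assumes R: "\<And>i. i < N \<Longrightarrow> R i = (\<Sum>l<N. smult (w l $ i) (monom 1 (a l) * U l))"
    and m: "m < N choose k"
  shows "t ^ (\<Sum>b<k. b) * poly (plucker_poly N k R m) t =
    (\<Sum>f\<in>maps k N. t ^ (\<Sum>b<k. a (f b)) *
      ((\<Prod>b<k. poly (euler_poly (a (f b)) (U (f b)) b) t) * wedge N k (\<lambda>b. w (f b)) $ m))"
proof -
  define u where "u b = vec N (\<lambda>i. poly ((pderiv ^^ b) (R i)) t)" for b
  define v where "v b = vec N (\<lambda>i. t ^ b * poly ((pderiv ^^ b) (R i)) t)" for b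
  have "poly (plucker_poly N k R m) t = wedge N k u $ m"
    unfolding plucker_poly_def poly_det wedge_index[OF m]
    by (intro arg_cong[of _ _ det] eq_matI) (auto simp: u_def combinations_nth_less[OF m])
  moreover have "v b $ i = (\<Sum>l\<le>b. (if l = b then t ^ b else 0) * u l $ i)" if "i < N" for i b
    using that by (simp add: u_def v_def if_distrib[of "\<lambda>x. x * _"] sum.delta cong: if_cong)
  then have "wedge N k v = (\<Prod>j<k. if j = j then t ^ j else 0) \<cdot>\<^sub>v wedge N k u"
    by (intro wedge_triangular[where c = "\<lambda>j l. if l = j then t ^ j else 0"])
  ultimately have "t ^ (\<Sum>b<k. b) * poly (plucker_poly N k R m) t = wedge N k v $ m"
    using m by (simp add: power_sum)
  also have "\<dots> = (\<Sum>f\<in>maps k N. (\<Prod>b<k. t ^ a (f b) * poly (euler_poly (a (f b)) (U (f b)) b) t) * wedge N k (\<lambda>b. w (f b)) $ m)"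
  proof (rule wedge_expand[OF m, where M = N and w = w and D = "\<lambda>l b. t ^ a l * poly (euler_poly (a l) (U l) b) t"])
    fix i b assume i: "i < N"
    have "t ^ b * poly ((pderiv ^^ b) (R i)) t =
       (\<Sum>l<N. w l $ i * poly (monom 1 b * (pderiv ^^ b) (monom 1 (a l) * U l)) t)"
      unfolding R[OF i] higher_pderiv_sum higher_pderiv_smult by (simp add: poly_sum poly_monom sum_distrib_left mult_ac)
    also have "\<dots> = (\<Sum>l<N. w l $ i * (t ^ a l * poly (euler_poly (a l) (U l) b) t))"
      unfolding monom_mult_higher_pderiv by (simp add: poly_monom)
    finally show "v b $ i = (\<Sum>l<N. w l $ i * (t ^ a l * poly (euler_poly (a l) (U l) b) t))"
      using i by (simp add: v_def)
  qed
  also have "\<dots> = (\<Sum>f\<in>maps k N. t ^ (\<Sum>b<k. a (f b)) *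
    ((\<Prod>b<k. poly (euler_poly (a (f b)) (U (f b)) b) t) * wedge N k (\<lambda>b. w (f b)) $ m))"
    by (simp add: prod.distrib power_sum mult.assoc)
  finally show ?thesis .
qed

text \<open>In \<open>osculating_sum\<close> the exponent of \<open>t\<close> depends only on the image of the map. It is smallest for
\<open>{0, \<dots>, k-1}\<close>, next for \<open>{0, \<dots>, k-2, k}\<close>, and strictly larger for every other set. The coefficients \<open>c0\<close>
and \<open>c1\<close> collect the terms of the first two images; at \<open>t = 0\<close> they are, up to nonzero
factors, determinants of falling factorials.\<close>

lemma osculating_expansion:
  assumes mono: "\<And>i j. i < j \<Longrightarrow> j < N \<Longrightarrow> a i < a j"
    and U: "\<And>l. l < N \<Longrightarrow> poly (U l) 0 \<noteq> 0"
    and R: "\<And>i. i < N \<Longrightarrow> R i = (\<Sum>l<N. smult (w l $ i) (monom 1 (a l) * U l))"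
    and k: "1 \<le> k" "k < N"
  shows "\<exists>c0 c1 Y. c0 holomorphic_on UNIV \<and> c0 0 \<noteq> 0 \<and> c1 holomorphic_on UNIV \<and> c1 0 \<noteq> 0 \<and>
    (\<forall>m. Y m holomorphic_on UNIV) \<and>
    (\<forall>m<N choose k. \<forall>t. t ^ (\<Sum>b<k. b) * poly (plucker_poly N k R m) t =
       t ^ (\<Sum>b<k. a b) * (c0 t * wedge N k w $ m +
         t ^ (a k - a (k - 1)) * (c1 t * wedge N k (\<lambda>b. w (last_shift k b)) $ m + t * Y m t)))"
proof -
  define E where "E l b t = poly (euler_poly (a l) (U l) b) t" for l b t
  define A0 where "A0 = (\<Sum>b<k. a b)"
  define g where "g = a k - a (k - 1)"
  have "a (k - 1) < a k" using mono[of "k - 1" k] k by simp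
  then have g: "a k = a (k - 1) + g" by (simp add: g_def)
  have last: "A0 = (\<Sum>b<k-1. a b) + a (k - 1)"
    unfolding A0_def using k(1) by (cases k) auto
  define tm where "tm f m t = (\<Prod>b<k. E (f b) b t) * wedge N k (\<lambda>b. w (f b)) $ m" for f m t
  have hol_tm: "tm f m holomorphic_on UNIV" for f m
    unfolding tm_def E_def by (intro holomorphic_intros)
  define X where "X J = {f. f \<in> maps k N \<and> inj_on f {..<k} \<and> f ` {..<k} = J}" for J
  define J1 where "J1 = last_shift k ` {..<k}"
  have "last_shift k ` {..<k - 1} = id ` {..<k - 1}"
    by (rule image_cong) (auto simp: last_shift_def)
  moreover have "{..<k} = insert (k - 1) {..<k - 1}" "last_shift k (k - 1) = k"
    using k by (auto simp: last_shift_def)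
  ultimately have J1: "J1 = insert k {..<k - 1}" by (simp add: J1_def)
  have J1N: "last_shift k ` {..<k} \<subseteq> {..<N}" using k by (auto simp: last_shift_def)
  have inj1: "inj_on (last_shift k) {..<k}" by (auto simp: inj_on_def last_shift_def)
  \<comment> \<open>the injective maps with neither of the two lowest images\<close>
  define rest where "rest = {f \<in> maps k N. inj_on f {..<k}} - X {..<k} - X J1"
  have finX: "finite (X J)" "finite rest" for J
    by (auto simp: X_def rest_def intro: finite_subset[OF _ finite_maps])
  define c0 where "c0 t = det (mat k k (\<lambda>(l, b). E l b t))" for t
  define c1 where "c1 t = det (mat k k (\<lambda>(l, b). E (last_shift k l) b t))" for t
  define Y where "Y m t = (\<Sum>f\<in>rest. t ^ ((\<Sum>b<k. a (f b)) - (A0 + g + 1)) * tm f m t)" for m t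
  have sumX0: "(\<Sum>f\<in>X {..<k}. tm f m t) = c0 t * wedge N k w $ m" if "m < N choose k" for m t
    using wedge_group[OF that, of "\<lambda>b. b" N "\<lambda>l b. E l b t" w] k
    by (simp add: X_def tm_def c0_def)
  have sumX1: "(\<Sum>f\<in>X J1. tm f m t) = c1 t * wedge N k (\<lambda>b. w (last_shift k b)) $ m"
    if "m < N choose k" for m t
    using wedge_group[OF that inj1 J1N, of "\<lambda>l b. E l b t" w]
    by (simp add: X_def tm_def c1_def J1_def)
  have J01: "J1 \<noteq> {..<k}" unfolding J1 by auto
  have expX: "(\<Sum>b<k. a (f b)) = sum a J" if "f \<in> X J" for f J
    using that sum.reindex[of f "{..<k}" a] by (auto simp: X_def)
  have "sum a J1 = A0 + g" unfolding J1 using k by (simp add: last g)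
  have rest_exp: "A0 + g + 1 \<le> (\<Sum>b<k. a (f b))" if f: "f \<in> rest" for f
  proof -
    define I where "I = f ` {..<k}"
    have fi: "inj_on f {..<k}" "f \<in> maps k N" using f by (auto simp: rest_def)
    have I: "I \<subseteq> {..<N}" "card I = k" "finite I" using fi by (auto simp: I_def card_image)
    have ne: "I \<noteq> {..<k}" "I \<noteq> insert k {..<k - 1}"
      using f fi unfolding rest_def X_def J1[symmetric] I_def by blast+
    have sI: "(\<Sum>b<k. a (f b)) = sum a I"
      using fi(1) by (simp add: I_def sum.reindex)
    define M where "M = Max I"
    have "I \<noteq> {}" using I(2) k by auto
    then have M: "M \<in> I" "\<And>i. i \<in> I \<Longrightarrow> i \<le> M" using I(3) by (auto simp: M_def)
    have "\<not> M < k"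
    proof
      assume "M < k"
      then have "I \<subseteq> {..<k}" using M(2) by (meson lessThan_iff order_le_less_trans subsetI)
      then show False using ne(1) I(2) card_subset_eq[of "{..<k}" I] by simp
    qed
    have MN: "M < N" using M(1) I(1) by auto
    have cI: "card (I - {M}) = k - 1" using I(2,3) M(1) by simp
    have "(\<Sum>b<card (I - {M}). a b) \<le> sum a (I - {M}) \<and>
        (I - {M} \<noteq> {..<card (I - {M})} \<longrightarrow> (\<Sum>b<card (I - {M}). a b) < sum a (I - {M}))"
      by (rule sum_lowest[where N = N]) (use I mono in \<open>simp_all add: subset_iff\<close>)
    then have low: "(\<Sum>b<k-1. a b) \<le> sum a (I - {M})"
      "I - {M} \<noteq> {..<k-1} \<Longrightarrow> (\<Sum>b<k-1. a b) < sum a (I - {M})"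
      unfolding cI by simp_all
    have "sum a I = sum a (I - {M}) + a M" using sum.remove[OF I(3) M(1), of a] by simp
    moreover have aM: "M \<noteq> k \<Longrightarrow> a k < a M"
      using mono[of k M] MN \<open>\<not> M < k\<close> by simp
    then have "a k \<le> a M" by (cases "M = k") simp_all
    moreover have "I - {M} \<noteq> {..<k-1} \<or> M \<noteq> k" using ne(2) M(1) by blast
    then have "(\<Sum>b<k-1. a b) < sum a (I - {M}) \<or> a k < a M" using low(2) aM by blast
    ultimately show ?thesis unfolding sI using low(1) last g by linarith
  qed
  have main: "t ^ (\<Sum>b<k. b) * poly (plucker_poly N k R m) t =
       t ^ A0 * (c0 t * wedge N k w $ m + t ^ g * (c1 t * wedge N k (\<lambda>b. w (last_shift k b)) $ m + t * Y m t))"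
    if m: "m < N choose k" for m t
  proof -
    have "t ^ (\<Sum>b<k. b) * poly (plucker_poly N k R m) t = (\<Sum>f\<in>maps k N. t ^ (\<Sum>b<k. a (f b)) * tm f m t)"
      unfolding tm_def E_def by (rule osculating_sum[OF R m])
    also have "\<dots> = (\<Sum>f\<in>(X {..<k} \<union> X J1) \<union> rest. t ^ (\<Sum>b<k. a (f b)) * tm f m t)"
    proof (rule sum.mono_neutral_right)
      show "\<forall>f\<in>maps k N - (X {..<k} \<union> X J1 \<union> rest). t ^ (\<Sum>b<k. a (f b)) * tm f m t = 0"
        using wedge_non_injective[OF m] by (auto simp: rest_def X_def tm_def)
    qed (auto simp: finite_maps X_def rest_def)
    also have "\<dots> = (\<Sum>f\<in>X {..<k}. t ^ (\<Sum>b<k. a (f b)) * tm f m t) +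
        (\<Sum>f\<in>X J1. t ^ (\<Sum>b<k. a (f b)) * tm f m t) + (\<Sum>f\<in>rest. t ^ (\<Sum>b<k. a (f b)) * tm f m t)"
    proof -
      have "X {..<k} \<inter> X J1 = {}" using J01 by (auto simp: X_def)
      moreover have "(X {..<k} \<union> X J1) \<inter> rest = {}" by (auto simp: rest_def)
      ultimately show ?thesis using finX by (simp add: sum.union_disjoint)
    qed
    also have "(\<Sum>f\<in>X {..<k}. t ^ (\<Sum>b<k. a (f b)) * tm f m t) = t ^ A0 * (c0 t * wedge N k w $ m)"
      unfolding sumX0[OF m, symmetric] sum_distrib_left
      by (rule sum.cong) (simp_all add: expX A0_def)
    also have "(\<Sum>f\<in>X J1. t ^ (\<Sum>b<k. a (f b)) * tm f m t) =
        t ^ (A0 + g) * (c1 t * wedge N k (\<lambda>b. w (last_shift k b)) $ m)"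
      unfolding sumX1[OF m, symmetric] sum_distrib_left
      by (rule sum.cong) (simp_all add: expX \<open>sum a J1 = A0 + g\<close>)
    also have "(\<Sum>f\<in>rest. t ^ (\<Sum>b<k. a (f b)) * tm f m t) = t ^ (A0 + g + 1) * Y m t"
      unfolding Y_def sum_distrib_left
    proof (rule sum.cong)
      fix f assume "f \<in> rest"
      then have "t ^ (A0 + g + 1) * t ^ ((\<Sum>b<k. a (f b)) - (A0 + g + 1)) = t ^ (\<Sum>b<k. a (f b))"
        by (simp only: power_add[symmetric] le_add_diff_inverse[OF rest_exp])
      then show "t ^ (\<Sum>b<k. a (f b)) * tm f m t =
          t ^ (A0 + g + 1) * (t ^ ((\<Sum>b<k. a (f b)) - (A0 + g + 1)) * tm f m t)"
        by (simp only: mult.assoc[symmetric])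
    qed simp
    finally show ?thesis by (simp add: power_add algebra_simps)
  qed
  have "c0 holomorphic_on UNIV" "c1 holomorphic_on UNIV"
    unfolding c0_def c1_def E_def by (intro holomorphic_on_det holomorphic_intros)+
  moreover have "Y m holomorphic_on UNIV" for m
    unfolding Y_def by (intro holomorphic_intros hol_tm)
  moreover have aneq: "i = j" if "i < N" "j < N" "a i = a j" for i j
    using mono[of i j] mono[of j i] that by (metis less_irrefl linorder_neqE_nat)
  have "inj_on a {..<k}" using aneq k by (auto simp: inj_on_def)
  then have "c0 0 \<noteq> 0"
    unfolding c0_def E_def using U k by (intro det_euler_nonzero) auto
  moreover have "inj_on (\<lambda>l. a (last_shift k l)) {..<k}"
    using aneq k inj1 by (auto simp: inj_on_def last_shift_def split: if_splits)
  then have "c1 0 \<noteq> 0"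
    unfolding c1_def E_def using U k
    by (intro det_euler_nonzero[of "\<lambda>l. a (last_shift k l)" k "\<lambda>l. U (last_shift k l)"]) (auto simp: last_shift_def)
  ultimately show ?thesis
    using main unfolding A0_def[symmetric] g_def[symmetric]
    by (intro exI[of _ c0] exI[of _ c1] exI[of _ Y]) simp
qed

section \<open>Orders of vanishing and ramification indices\<close>

lemma local_poly_lincomb:
  "local_poly d p (\<Sum>i<N. smult (c i) (P i)) = (\<Sum>i<N. smult (c i) (local_poly d p (P i)))"
proof (cases p)
  case (Plane a)
  then show ?thesis by (simp add: pcompose_sum pcompose_smult)
next
  case Infty
  then show ?thesis by (intro poly_eqI) (simp add: coeff_flip coeff_sum)
qed

lemma local_poly_eq_0_iff:
  assumes "degree q \<le> d"
  shows "local_poly d p q = 0 \<longleftrightarrow> q = 0"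
proof
  show "q = 0" if "local_poly d p q = 0"
  proof (cases p)
    case (Plane a)
    then show ?thesis using that pcompose_eq_0[of q "[:a, 1:]"] by simp
  next
    case Infty
    have "coeff q j = 0" for j
    proof (cases "j \<le> d")
      case True
      then have "coeff q j = coeff (flip d q) (d - j)" by (simp add: coeff_flip)
      then show ?thesis using that Infty by simp
    next
      case False
      then show ?thesis using assms by (intro coeff_eq_0) simp
    qed
    then show ?thesis by (intro poly_eqI) simp
  qed
next
  show "local_poly d p q = 0" if "q = 0"
    using that by (cases p) (simp_all add: flip_def)
qed

lemma degree_lincomb_le:
  fixes P :: "nat \<Rightarrow> complex poly"
  assumes "\<forall>i<N. degree (P i) \<le> d"
  shows "degree (\<Sum>i<N. smult (c i) (P i)) \<le> d"
  using assms by (intro degree_sum_le) (auto intro: order_trans[OF degree_smult_le])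

lemma smult_sum_right: "smult c (\<Sum>i\<in>A. f i) = (\<Sum>i\<in>A. smult c (f i))"
  by (induction A rule: infinite_finite_induct) (auto simp: smult_add_right)

lemma lin_indep_local_poly:
  assumes "lin_indep_polys N P" "\<forall>i<N. degree (P i) \<le> d"
  shows "lin_indep_polys N (\<lambda>i. local_poly d p (P i))"
  unfolding lin_indep_polys_def
proof (intro allI impI)
  fix c i assume "(\<Sum>i<N. smult (c i) (local_poly d p (P i))) = 0" and i: "i < N"
  then have "(\<Sum>i<N. smult (c i) (P i)) = 0"
    unfolding local_poly_lincomb[symmetric]
    using local_poly_eq_0_iff[OF degree_lincomb_le[OF assms(2)]] by blast
  then show "c i = 0" using assms(1) i unfolding lin_indep_polys_def by blast
qed

lemma hyperplane_subspace:
  "VectorSpace.subspace class_ring {v \<in> carrier_vec N. (\<Sum>i<N. c i * v $ i) = 0}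
     (module_vec TYPE(complex) N)"
proof -
  interpret vec_space "TYPE(complex)" N .
  show ?thesis
    unfolding VectorSpace.subspace_def submodule_def
    using vectorspace_axioms module_axioms
    by (auto simp: module_vec_simps class_ring_simps sum.distrib algebra_simps sum_distrib_left[symmetric])
qed

lemma nondegenerate_imp_lin_indep:
  assumes F: "poly_curve N d P F" and nd: "linearly_nondegenerate N F"
  shows "lin_indep_polys N P"
  unfolding lin_indep_polys_def
proof (intro allI impI)
  fix c i assume c: "(\<Sum>i<N. smult (c i) (P i)) = 0" and i: "i < N"
  let ?W = "{v \<in> carrier_vec N. (\<Sum>i<N. c i * v $ i) = 0}"
  have "F p \<subseteq> ?W" for p
  proof
    fix v assume "v \<in> F p"
    then obtain e where v: "v = e \<cdot>\<^sub>v poly_lift N d P p 0"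
      using F unfolding poly_curve_def proj_class_def by auto
    have "poly (\<Sum>i<N. smult (c i) (local_poly d p (P i))) 0 = 0"
      unfolding local_poly_lincomb[symmetric] c by (cases p) (simp_all add: poly_0_coeff_0 coeff_flip)
    then have "(\<Sum>i<N. c i * poly (local_poly d p (P i)) 0) = 0" by (simp add: poly_sum)
    then have "e * (\<Sum>i<N. c i * poly (local_poly d p (P i)) 0) = 0" by simp
    then show "v \<in> ?W" unfolding v by (simp add: sum_distrib_left mult.left_commute)
  qed
  then have "?W = carrier_vec N"
    using nd hyperplane_subspace[of N c] unfolding linearly_nondegenerate_def by blast
  then have "unit_vec N i \<in> ?W" using i by simp
  then have "(\<Sum>j<N. c j * unit_vec N i $ j) = 0" by simp
  also have "(\<Sum>j<N. c j * unit_vec N i $ j) = (\<Sum>j<N. if j = i then c i else 0)"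
    using i by (intro sum.cong) auto
  finally show "c i = 0" using i by (simp add: sum.delta)
qed

text \<open>The rows of \<open>C\<close> are combinations of the \<open>P j\<close> that, as sections of \<open>O(d)\<close>, vanish at \<open>p\<close> to the orders
\<open>a 0 < a 1 < \<dots>\<close>; these are all the orders of vanishing at \<open>p\<close> that occur in the span of \<open>P\<close>. The matrix
\<open>C'\<close> is the inverse of \<open>C\<close>.\<close>

definition adapted_basis ::
  "nat \<Rightarrow> nat \<Rightarrow> (nat \<Rightarrow> complex poly) \<Rightarrow> riemann_sphere \<Rightarrow> (nat \<Rightarrow> nat) \<Rightarrow> complex mat \<Rightarrow> complex mat \<Rightarrow> bool"
  where
  "adapted_basis N d P p a C C' \<longleftrightarrow>
     C \<in> carrier_mat N N \<and> C' \<in> carrier_mat N N \<and> C * C' = 1\<^sub>m N \<and> C' * C = 1\<^sub>m N \<and>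
     (\<forall>i j. i < j \<longrightarrow> j < N \<longrightarrow> a i < a j) \<and>
     (\<forall>i<N. \<exists>U. local_poly d p (\<Sum>j<N. smult (C $$ (i, j)) (P j)) = monom 1 (a i) * U \<and> poly U 0 \<noteq> 0)"

lemma adapted_basis_exists:
  assumes "lin_indep_polys N P" "\<forall>i<N. degree (P i) \<le> d"
  shows "\<exists>a C C'. adapted_basis N d P p a C C'"
proof -
  from echelon_basis[OF lin_indep_local_poly[OF assms, of p]]
  obtain C C' a U where "C \<in> carrier_mat N N" "C' \<in> carrier_mat N N" "C * C' = 1\<^sub>m N" "C' * C = 1\<^sub>m N"
    "\<forall>i j. i < j \<longrightarrow> j < N \<longrightarrow> a i < a j"
    "\<forall>i<N. (\<Sum>j<N. smult (C $$ (i, j)) (local_poly d p (P j))) = monom 1 (a i) * U i \<and> poly (U i) 0 \<noteq> 0"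
    by (elim exE conjE)
  then have "adapted_basis N d P p a C C'"
    unfolding adapted_basis_def local_poly_lincomb
    by (intro conjI allI impI exI[of _ "U _"]) auto
  then show ?thesis by blast
qed

lemma mat_mult_index_sum:
  assumes "A \<in> carrier_mat N N" "B \<in> carrier_mat N N" "i < N" "j < N"
  shows "(A * B) $$ (i, j) = (\<Sum>l<N. A $$ (i, l) * B $$ (l, j))"
  using assms by (simp add: scalar_prod_def atLeast0LessThan)

lemma adapted_basis_expand:
  assumes ad: "adapted_basis N d P p a C C'"
  shows "\<exists>U. (\<forall>l<N. poly (U l) 0 \<noteq> 0) \<and>
    (\<forall>i<N. local_poly d p (P i) = (\<Sum>l<N. smult (col C' l $ i) (monom 1 (a l) * U l)))"
    and "\<And>l l'. l < N \<Longrightarrow> l' < N \<Longrightarrow> (\<Sum>i<N. C $$ (l, i) * col C' l' $ i) = (if l = l' then 1 else 0)"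
proof -
  have C: "C \<in> carrier_mat N N" "C' \<in> carrier_mat N N" "C * C' = 1\<^sub>m N" "C' * C = 1\<^sub>m N"
    using ad unfolding adapted_basis_def by auto
  let ?R = "\<lambda>i. local_poly d p (P i)"
  have "\<exists>U. \<forall>l<N. (\<Sum>j<N. smult (C $$ (l, j)) (?R j)) = monom 1 (a l) * U l \<and> poly (U l) 0 \<noteq> 0"
    using ad unfolding adapted_basis_def local_poly_lincomb by metis
  then obtain U where U: "\<forall>l<N. (\<Sum>j<N. smult (C $$ (l, j)) (?R j)) = monom 1 (a l) * U l \<and> poly (U l) 0 \<noteq> 0"
    by blast
  have "?R i = (\<Sum>l<N. smult (col C' l $ i) (monom 1 (a l) * U l))" if i: "i < N" for i
  proof -
    have "(\<Sum>l<N. smult (col C' l $ i) (monom 1 (a l) * U l)) =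
        (\<Sum>l<N. smult (C' $$ (i, l)) (\<Sum>j<N. smult (C $$ (l, j)) (?R j)))"
      using U C i by (intro sum.cong) auto
    also have "\<dots> = (\<Sum>l<N. \<Sum>j<N. smult (C' $$ (i, l) * C $$ (l, j)) (?R j))"
      by (simp add: smult_sum_right)
    also have "\<dots> = (\<Sum>j<N. \<Sum>l<N. smult (C' $$ (i, l) * C $$ (l, j)) (?R j))"
      by (rule sum.swap)
    also have "\<dots> = (\<Sum>j<N. smult ((C' * C) $$ (i, j)) (?R j))"
      by (intro sum.cong refl) (simp only: lessThan_iff mat_mult_index_sum[OF C(2,1) i] smult_sum)
    also have "\<dots> = (\<Sum>j<N. if j = i then ?R i else 0)"
      using i unfolding C(4) by (intro sum.cong) auto
    also have "\<dots> = ?R i" using i by (simp add: sum.delta)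
    finally show ?thesis ..
  qed
  then show "\<exists>U. (\<forall>l<N. poly (U l) 0 \<noteq> 0) \<and>
    (\<forall>i<N. local_poly d p (P i) = (\<Sum>l<N. smult (col C' l $ i) (monom 1 (a l) * U l)))"
    using U by (intro exI[of _ U] conjI allI impI) auto
  show "(\<Sum>i<N. C $$ (l, i) * col C' l' $ i) = (if l = l' then 1 else 0)" if "l < N" "l' < N" for l l'
    using mat_mult_index_sum[OF C(1,2) that] that C(2) unfolding C(3) by (simp split: if_splits)
qed

lemma plucker_poly_param:
  assumes F: "poly_curve N d P F" and z: "param p t = Plane z"
  obtains c where "c \<noteq> 0" "\<And>m. m < N choose k \<Longrightarrow>
    poly (plucker_poly N k (\<lambda>i. local_poly d p (P i)) m) t = c * poly (plucker_poly N k P m) z"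
proof -
  have l: "local_lift N F p (norm t + 1) (poly_lift N d P p)"
    using F by (rule poly_curve_local_lift) (simp add: add_nonneg_pos)
  have "norm t < norm t + 1" by simp
  then obtain c where c: "c \<noteq> 0"
    "osculating N k (poly_lift N d P p) t = c \<cdot>\<^sub>v vec (N choose k) (\<lambda>m. poly (plucker_poly N k P m) z)"
    using osculating_local_lift[OF F l _ z, of k] by blast
  have "osculating N k (poly_lift N d P p) t =
      vec (N choose k) (\<lambda>m. poly (plucker_poly N k (\<lambda>i. local_poly d p (P i)) m) t)"
    by (rule osculating_poly) simp
  with c(2) have "vec (N choose k) (\<lambda>m. poly (plucker_poly N k (\<lambda>i. local_poly d p (P i)) m) t) =
     c \<cdot>\<^sub>v vec (N choose k) (\<lambda>m. poly (plucker_poly N k P m) z)" by simp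
  then have "poly (plucker_poly N k (\<lambda>i. local_poly d p (P i)) m) t = c * poly (plucker_poly N k P m) z"
    if "m < N choose k" for m
    using that by (metis (no_types, lifting) dim_vec index_smult_vec(1) index_vec)
  with c(1) show ?thesis by (rule that)
qed

lemma param_finite: "t \<noteq> 0 \<Longrightarrow> \<exists>z. param p t = Plane z"
  by (cases p) auto

text \<open>By \<open>osculating_expansion\<close> the \<open>k\<close>-th associated curve has near \<open>p\<close>, up to a scalar factor, a lift
\<open>w + t\<^sup>g (c w' + O(t))\<close> with \<open>g = a k - a (k - 1)\<close>, \<open>c \<noteq> 0\<close> and linearly independent \<open>w\<close>, \<open>w'\<close>.\<close>

lemma ramification_index_eq:
  assumes F: "poly_curve N d P F" and ad: "adapted_basis N d P p a C C'" and k: "1 \<le> k" "k < N"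
  shows "ramification_index N F k p = a k - a (k - 1) - 1"
proof -
  let ?M = "N choose k" and ?R = "\<lambda>i. local_poly d p (P i)" and ?w = "col C'"
  have mono: "\<And>i j. i < j \<Longrightarrow> j < N \<Longrightarrow> a i < a j"
    using ad unfolding adapted_basis_def by blast
  obtain U where U: "\<forall>l<N. poly (U l) 0 \<noteq> 0"
    "\<forall>i<N. ?R i = (\<Sum>l<N. smult (?w l $ i) (monom 1 (a l) * U l))"
    using adapted_basis_expand(1)[OF ad] by blast
  define g where "g = a k - a (k - 1)"
  have "a (k - 1) < a k" using mono[of "k - 1" k] k by simp
  then have g: "g = Suc (g - 1)" by (simp add: g_def)
  let ?w0 = "wedge N k ?w" and ?w1 = "wedge N k (\<lambda>b. ?w (last_shift k b))"
  define A where "A = (\<Sum>b<k. a b)"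
  define K where "K = (\<Sum>b<k. b :: nat)"
  have "\<exists>c0 c1 Y. c0 holomorphic_on UNIV \<and> c0 0 \<noteq> 0 \<and> c1 holomorphic_on UNIV \<and> c1 0 \<noteq> 0 \<and>
    (\<forall>m. Y m holomorphic_on UNIV) \<and>
    (\<forall>m<?M. \<forall>t. t ^ K * poly (plucker_poly N k ?R m) t =
       t ^ A * (c0 t * ?w0 $ m + t ^ g * (c1 t * ?w1 $ m + t * Y m t)))"
    unfolding g_def A_def K_def
    by (rule osculating_expansion[where U = U]) (use mono U k in auto)
  then obtain c0 c1 Y where c0: "c0 holomorphic_on UNIV" "c0 0 \<noteq> 0"
    and c1: "c1 holomorphic_on UNIV" "c1 0 \<noteq> 0" and Y: "\<forall>m. Y m holomorphic_on UNIV"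
    and exp: "\<forall>m<?M. \<forall>t. t ^ K * poly (plucker_poly N k ?R m) t =
       t ^ A * (c0 t * ?w0 $ m + t ^ g * (c1 t * ?w1 $ m + t * Y m t))"
    by (elim exE conjE)
  define Y' where "Y' m t = (c1 t * ?w1 $ m + t * Y m t) / c0 t" for m t
  have indep: "\<alpha> = 0 \<and> \<beta> = 0"
    if "\<And>m. m < ?M \<Longrightarrow> \<alpha> * ?w0 $ m + \<beta> * ?w1 $ m = 0" for \<alpha> \<beta>
    by (rule wedge_pair_independent[where C = "\<lambda>l i. C $$ (l, i)" and w = "col C'", OF _ k that])
       (rule adapted_basis_expand(2)[OF ad])
  have "\<exists>m<?M. ?w0 $ m \<noteq> 0" using indep[of 1 0] by auto
  then obtain m0 where m0: "m0 < ?M" "?w0 $ m0 \<noteq> 0" by blast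
  have cont: "isCont f 0" if "f holomorphic_on UNIV" for f :: "complex \<Rightarrow> complex"
    using that by (meson UNIV_I continuous_on_eq_continuous_at holomorphic_on_imp_continuous_on open_UNIV)
  have "isCont c0 0" "isCont (\<lambda>t. c0 t * ?w0 $ m0 + t ^ g * (c1 t * ?w1 $ m0 + t * Y m0 t)) 0"
    using c0(1) c1(1) Y by (intro cont holomorphic_intros; simp)+
  moreover have "c0 0 * ?w0 $ m0 + 0 ^ g * (c1 0 * ?w1 $ m0 + 0 * Y m0 0) \<noteq> 0"
    using m0 c0 g by (metis add_cancel_left_right mult_eq_0_iff power_0_Suc)
  ultimately have "eventually (\<lambda>t. c0 t \<noteq> 0) (nhds 0)"
    "eventually (\<lambda>t. c0 t * ?w0 $ m0 + t ^ g * (c1 t * ?w1 $ m0 + t * Y m0 t) \<noteq> 0) (nhds 0)"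
    using c0(2) by (auto intro!: tendsto_imp_eventually_ne simp: isCont_def tendsto_nhds_iff)
  then have "eventually (\<lambda>t. c0 t \<noteq> 0 \<and> c0 t * ?w0 $ m0 + t ^ g * (c1 t * ?w1 $ m0 + t * Y m0 t) \<noteq> 0) (nhds 0)"
    by eventually_elim simp
  then obtain \<rho> where \<rho>: "\<rho> > 0" "\<And>t. norm t < \<rho> \<Longrightarrow> c0 t \<noteq> 0"
    "\<And>t. norm t < \<rho> \<Longrightarrow> c0 t * ?w0 $ m0 + t ^ g * (c1 t * ?w1 $ m0 + t * Y m0 t) \<noteq> 0"
    unfolding eventually_nhds_metric by (auto simp: dist_norm)
  have pl_nz: "poly (plucker_poly N k ?R m0) t \<noteq> 0" if t: "t \<noteq> 0" "norm t < \<rho>" for t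
    using exp m0(1) \<rho>(3)[OF t(2)] t(1) by (metis mult_eq_0_iff power_not_zero)
  \<comment> \<open>The expansion lives at \<open>p\<close>; one small nonzero \<open>t\<close> transfers the nonvanishing to the global lift.\<close>
  obtain z where z: "param p (of_real (\<rho> / 2)) = Plane z"
    using param_finite[of "of_real (\<rho> / 2)" p] \<rho>(1) by auto
  obtain c where "\<And>m. m < ?M \<Longrightarrow>
     poly (plucker_poly N k ?R m) (of_real (\<rho> / 2)) = c * poly (plucker_poly N k P m) z"
    using plucker_poly_param[OF F z] by metis
  then have "plucker_poly N k P m0 \<noteq> 0"
    using pl_nz[of "of_real (\<rho> / 2)"] \<rho>(1) m0(1) by auto
  from poly_curve_of_polys[OF m0(1), of "plucker_poly N k P", OF this]
  obtain h Q e G where h: "h \<noteq> 0" "\<forall>m<?M. plucker_poly N k P m = h * Q m" "poly_curve ?M e Q G"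
    by (elim exE conjE)
  have assoc: "associated_curve N k F = G" "is_associated_curve N k F G"
    using associated_curve_eq[OF F h(3,1,2)] is_associated_curve_poly[OF F h(3,1,2)] by simp_all
  have "has_ramification_index ?M G p (g - 1)"
  proof (rule has_ramification_indexI)
    show "local_lift ?M G p 1 (poly_lift ?M e Q p)" using h(3) by (rule poly_curve_local_lift) simp
    show "\<rho> > 0" by fact
    show "?w0 \<in> carrier_vec ?M" by simp
    show "Y' m holomorphic_on ball 0 \<rho>" for m
      unfolding Y'_def using c0(1) c1(1) Y \<rho>(2)
      by (intro holomorphic_intros) (auto intro: holomorphic_on_subset)
    show "\<alpha> = 0 \<and> \<beta> = 0" if "\<And>m. m < ?M \<Longrightarrow> \<alpha> * ?w0 $ m + \<beta> * Y' m 0 = 0" for \<alpha> \<beta>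
    proof -
      have "\<alpha> * ?w0 $ m + (\<beta> * c1 0 / c0 0) * ?w1 $ m = 0" if "m < ?M" for m
        using \<open>\<And>m. m < ?M \<Longrightarrow> \<alpha> * ?w0 $ m + \<beta> * Y' m 0 = 0\<close>[OF that] by (simp add: Y'_def mult.assoc)
      from indep[OF this] show ?thesis using c0(2) c1(2) by simp
    qed
    fix t :: complex assume t: "t \<noteq> 0" "norm t < \<rho>"
    let ?\<nu> = "poly_lift N d P p"
    have l: "local_lift N F p \<rho> ?\<nu>" using F \<rho>(1) by (rule poly_curve_local_lift)
    have osc: "osculating N k ?\<nu> t = vec ?M (\<lambda>m. poly (plucker_poly N k ?R m) t)"
      by (rule osculating_poly) simp
    then have "osculating N k ?\<nu> t $ m0 \<noteq> 0" using pl_nz[OF t] m0(1) by simp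
    then have "osculating N k ?\<nu> t \<noteq> 0\<^sub>v ?M" using m0(1) by auto
    then have "G (param p t) = proj_class (osculating N k ?\<nu> t)"
      using assoc(2) l t(2) unfolding is_associated_curve_def by auto
    moreover have "osculating N k ?\<nu> t = (t ^ A * c0 t / t ^ K) \<cdot>\<^sub>v vec ?M (\<lambda>m. ?w0 $ m + t ^ Suc (g - 1) * Y' m t)"
    proof (rule eq_vecI)
      fix m assume "m < dim_vec ((t ^ A * c0 t / t ^ K) \<cdot>\<^sub>v vec ?M (\<lambda>m. ?w0 $ m + t ^ Suc (g - 1) * Y' m t))"
      then have m: "m < ?M" by simp
      have "t ^ K * poly (plucker_poly N k ?R m) t = t ^ A * c0 t * (?w0 $ m + t ^ g * Y' m t)"
        using exp m \<rho>(2)[OF t(2)] by (simp add: Y'_def field_simps)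
      then have "poly (plucker_poly N k ?R m) t = t ^ A * c0 t / t ^ K * (?w0 $ m + t ^ g * Y' m t)"
        using t(1) by (simp add: field_simps)
      then show "osculating N k ?\<nu> t $ m =
          ((t ^ A * c0 t / t ^ K) \<cdot>\<^sub>v vec ?M (\<lambda>m. ?w0 $ m + t ^ Suc (g - 1) * Y' m t)) $ m"
        unfolding osc g[symmetric] using m by simp
    qed (simp add: osc)
    moreover have "t ^ A * c0 t / t ^ K \<noteq> 0" using t(1) \<rho>(2)[OF t(2)] by simp
    ultimately show "G (param p t) = proj_class (vec ?M (\<lambda>m. ?w0 $ m + t ^ Suc (g - 1) * Y' m t))"
      using proj_class_smult by metis
  qed
  then show ?thesis
    unfolding ramification_index_def assoc(1) g_def
    by (intro the_equality) (auto dest: has_ramification_index_unique)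
qed

section \<open>The Wronskian and the Pluecker formula\<close>

lemma order_0_monom_mult:
  fixes U :: "complex poly"
  assumes "poly U 0 \<noteq> 0"
  shows "monom 1 a * U \<noteq> 0" "order 0 (monom 1 a * U) = a"
proof -
  have "U \<noteq> 0" using assms by auto
  then show nz: "monom 1 a * U \<noteq> 0" by simp
  show "order 0 (monom 1 a * U) = a"
    using order_mult[OF nz, of 0] order_0I[OF assms] by simp
qed

lemma order_local_poly_Plane:
  assumes "q \<noteq> 0"
  shows "order 0 (local_poly d (Plane x) q) = order x q"
proof -
  obtain r where r: "q = [:- x, 1:] ^ order x q * r" "\<not> [:- x, 1:] dvd r"
    using order_decomp[OF assms] by blast
  have "pcompose (q1 ^ n) s = pcompose q1 s ^ n" for q1 s :: "complex poly" and n
    by (induction n) (simp_all add: pcompose_mult pcompose_1)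
  then have "local_poly d (Plane x) q = pcompose [:- x, 1:] [:x, 1:] ^ order x q * pcompose r [:x, 1:]"
    using arg_cong[OF r(1), of "\<lambda>q. pcompose q [:x, 1:]"] by (simp add: pcompose_mult del: pcompose_pCons)
  also have "pcompose [:- x, 1:] [:x, 1:] ^ order x q = monom 1 (order x q)"
    by (simp add: pcompose_pCons monom_altdef)
  finally show ?thesis
    using r(2) order_0_monom_mult(2)[of "pcompose r [:x, 1:]" "order x q"]
    by (simp add: poly_pcompose poly_eq_0_iff_dvd)
qed

lemma order_local_poly_Infty:
  assumes "q \<noteq> 0" "degree q \<le> d"
  shows "order 0 (local_poly d Infty q) = d - degree q"
proof -
  have "coeff (flip d q) (d - degree q) \<noteq> 0" using assms by (simp add: coeff_flip)
  moreover have "coeff (flip d q) j = 0" if "j < d - degree q" for j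
    using that by (simp add: coeff_flip coeff_eq_0)
  ultimately obtain U where "flip d q = monom 1 (d - degree q) * U" "poly U 0 \<noteq> 0"
    by (rule order_0_factor)
  then show ?thesis using order_0_monom_mult(2) by simp
qed

text \<open>For \<open>k = N\<close> there is a single Pluecker coordinate, the determinant of all derivatives up to order
\<open>N - 1\<close>.\<close>

definition wronskian :: "nat \<Rightarrow> (nat \<Rightarrow> complex poly) \<Rightarrow> complex poly" where
  "wronskian N P = plucker_poly N N P 0"

text \<open>The case \<open>k = N\<close> of the expansion: an injective map of \<open>{0, \<dots>, N-1}\<close> to itself is onto, so there is
only one exponent.\<close>

lemma wronskian_order_adapted:
  assumes ad: "adapted_basis N d P p a C C'"
  shows "wronskian N (\<lambda>i. local_poly d p (P i)) \<noteq> 0"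
    and "order 0 (wronskian N (\<lambda>i. local_poly d p (P i))) + (\<Sum>b<N. b) = (\<Sum>i<N. a i)"
proof -
  let ?R = "\<lambda>i. local_poly d p (P i)"
  define K where "K = (\<Sum>b<N. b :: nat)"
  define A where "A = (\<Sum>i<N. a i)"
  have mono: "\<And>i j. i < j \<Longrightarrow> j < N \<Longrightarrow> a i < a j"
    using ad unfolding adapted_basis_def by blast
  obtain U where U: "\<forall>l<N. poly (U l) 0 \<noteq> 0"
    "\<forall>i<N. ?R i = (\<Sum>l<N. smult (col C' l $ i) (monom 1 (a l) * U l))"
    using adapted_basis_expand(1)[OF ad] by blast
  define V where "V = smult (wedge N N (col C') $ 0) (det (mat N N (\<lambda>(l, b). euler_poly (a l) (U l) b)))"
  have "t ^ K * poly (wronskian N ?R) t = t ^ A * poly V t" for t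
  proof -
    let ?T = "\<lambda>f. (\<Prod>b<N. poly (euler_poly (a (f b)) (U (f b)) b) t) * wedge N N (\<lambda>b. col C' (f b)) $ 0"
    let ?I = "{f. f \<in> maps N N \<and> inj_on f {..<N} \<and> f ` {..<N} = (\<lambda>b. b) ` {..<N}}"
    have "t ^ K * poly (wronskian N ?R) t = (\<Sum>f\<in>maps N N. t ^ (\<Sum>b<N. a (f b)) * ?T f)"
      unfolding K_def wronskian_def by (rule osculating_sum) (use U in auto)
    also have "\<dots> = (\<Sum>f\<in>?I. t ^ (\<Sum>b<N. a (f b)) * ?T f)"
    proof (rule sum.mono_neutral_right)
      show "\<forall>f\<in>maps N N - ?I. t ^ (\<Sum>b<N. a (f b)) * ?T f = 0"
      proof
        fix f assume f: "f \<in> maps N N - ?I"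
        then have "f ` {..<N} \<subseteq> {..<N}" by auto
        then have "\<not> inj_on f {..<N}" using f endo_inj_surj[of "{..<N}" f] by auto
        then show "t ^ (\<Sum>b<N. a (f b)) * ?T f = 0" by (simp add: wedge_non_injective)
      qed
    qed (auto simp: finite_maps)
    also have "\<dots> = (\<Sum>f\<in>?I. t ^ A * ?T f)"
    proof (rule sum.cong)
      fix f assume "f \<in> ?I"
      then have "(\<Sum>b<N. a (f b)) = A"
        using sum.reindex[of f "{..<N}" a] by (simp add: A_def)
      then show "t ^ (\<Sum>b<N. a (f b)) * ?T f = t ^ A * ?T f" by simp
    qed simp
    also have "\<dots> = t ^ A * (det (mat N N (\<lambda>(l, b). poly (euler_poly (a l) (U l) b) t)) * wedge N N (col C') $ 0)"
      unfolding sum_distrib_left[symmetric]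
      using wedge_group[of 0 N N "\<lambda>b. b" N "\<lambda>l b. poly (euler_poly (a l) (U l) b) t" "col C'"] by simp
    also have "\<dots> = t ^ A * poly V t"
      by (simp add: V_def poly_det mult.commute split_def)
    finally show ?thesis .
  qed
  then have eq: "monom 1 K * wronskian N ?R = monom 1 A * V"
    by (intro poly_eq_poly_eq_iff[THEN iffD1] ext) (simp add: poly_monom)
  have "(\<Sum>m<N choose N. det (mat N N (\<lambda>(x, y). C $$ (x, combinations N N ! m ! y))) * wedge N N (\<lambda>b. col C' b) $ m) =
    (\<Prod>b<N. if b = b then 1 else 0)"
    by (rule wedge_dual[where C = "\<lambda>l i. C $$ (l, i)" and w = "col C'" and e = "\<lambda>b. b" and e' = "\<lambda>b. b"])
       (use adapted_basis_expand(2)[OF ad] in auto)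
  then have "wedge N N (col C') $ 0 \<noteq> 0" by auto
  moreover have "inj_on a {..<N}"
  proof (rule inj_onI)
    fix i j assume "i \<in> {..<N}" "j \<in> {..<N}" "a i = a j"
    then show "i = j" using mono[of i j] mono[of j i] by (metis lessThan_iff less_irrefl linorder_neqE_nat)
  qed
  then have "det (mat N N (\<lambda>(l, b). poly (euler_poly (a l) (U l) b) 0)) \<noteq> 0"
    using U by (intro det_euler_nonzero) auto
  ultimately have V0: "poly V 0 \<noteq> 0" by (simp add: V_def poly_det split_def)
  then have nz: "monom 1 K * wronskian N ?R \<noteq> 0" unfolding eq by (rule order_0_monom_mult)
  then show "wronskian N ?R \<noteq> 0" by auto
  have "order 0 (monom 1 K * wronskian N ?R) = A" unfolding eq by (rule order_0_monom_mult(2)[OF V0])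
  then show "order 0 (wronskian N ?R) + (\<Sum>b<N. b) = (\<Sum>i<N. a i)"
    using order_mult[OF nz, of 0] by (simp add: K_def A_def)
qed

lemma poly_eq_off_0:
  fixes p q :: "complex poly"
  assumes "\<And>t. t \<noteq> 0 \<Longrightarrow> poly p t = poly q t"
  shows "p = q"
proof -
  have "poly ([:0, 1:] * p) t = poly ([:0, 1:] * q) t" for t
    using assms[of t] by (cases "t = 0") auto
  then have "[:0, 1:] * p = [:0, 1:] * q" by (intro poly_eq_poly_eq_iff[THEN iffD1] ext)
  then show ?thesis by (simp add: mult_left_cancel)
qed

lemma wronskian_Plane: "wronskian N (\<lambda>i. local_poly d (Plane x) (P i)) = local_poly d (Plane x) (wronskian N P)"
proof -
  have hp: "(pderiv ^^ b) (pcompose q [:x, 1:]) = pcompose ((pderiv ^^ b) q) [:x, 1:]" for b and q :: "complex poly"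
    by (induction b) (simp_all add: pderiv_pcompose pderiv_pCons)
  have "poly (wronskian N (\<lambda>i. local_poly d (Plane x) (P i))) t = poly (wronskian N P) (x + t)" for t
    by (simp add: wronskian_def plucker_poly_def poly_det hp poly_pcompose split_def)
  then show ?thesis
    by (intro poly_eq_poly_eq_iff[THEN iffD1] ext) (simp add: poly_pcompose)
qed

lemma degree_wronskian:
  assumes "\<forall>i<N. degree (P i) \<le> d"
  shows "degree (wronskian N P) \<le> d * N"
  unfolding wronskian_def plucker_poly_def
proof (rule degree_det_le)
  fix i j assume ij: "i < N" "j < N"
  then have "combinations N N ! 0 ! i < N" by (intro combinations_nth_less) auto
  then have "degree (P (combinations N N ! 0 ! i)) - j \<le> d" using assms by (meson diff_le_self le_trans)
  then show "degree (mat N N (\<lambda>(a, b). (pderiv ^^ b) (P (combinations N N ! 0 ! a))) $$ (i, j)) \<le> d"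
    using ij by (simp add: degree_higher_pderiv)
qed simp

text \<open>The factor in \<open>osculating_change\<close> for \<open>\<phi> = t\<^sup>d\<close> and \<open>\<tau> = 1/t\<close> is \<open>t\<^sup>d\<^sup>N (-t\<^sup>-\<^sup>2)\<^sup>K\<close> with
\<open>K = 0 + 1 + \<dots> + (N-1)\<close>.\<close>

lemma wronskian_Infty:
  assumes "\<forall>i<N. degree (P i) \<le> d"
  shows "monom 1 (2 * (\<Sum>b<N. b)) * wronskian N (\<lambda>i. local_poly d Infty (P i)) =
    smult ((-1) ^ (\<Sum>b<N. b)) (local_poly (d * N) Infty (wronskian N P))"
proof (rule poly_eq_off_0)
  fix t :: complex assume t: "t \<noteq> 0"
  define K where "K = (\<Sum>b<N. b :: nat)"
  let ?Pz = "\<lambda>z. vec N (\<lambda>i. poly (P i) z)"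
  have "((\<lambda>s. 1 / s) has_field_derivative - (1 / t\<^sup>2)) (at t)"
    using t by (auto intro!: derivative_eq_intros simp: power2_eq_square)
  then have der: "deriv (\<lambda>s. 1 / s) t = - (1 / t\<^sup>2)" by (rule DERIV_imp_deriv)
  have "osculating N N (poly_lift N d P Infty) t =
     (\<Prod>j<N. t ^ d * deriv (\<lambda>s. 1 / s) t ^ j) \<cdot>\<^sub>v osculating N N ?Pz (1 / t)"
  proof (rule osculating_change[where S = "- {0}" and T = UNIV])
    show "poly_lift N d P Infty s $ i = s ^ d * ?Pz (1 / s) $ i" if "s \<in> - {0}" "i < N" for s i
      using that assms by (simp add: poly_flip)
  qed (use t in \<open>auto intro!: holomorphic_intros\<close>)
  moreover have "osculating N N (poly_lift N d P Infty) t $ 0 = poly (wronskian N (\<lambda>i. local_poly d Infty (P i))) t"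
    by (subst osculating_poly) (auto simp: wronskian_def)
  moreover have "osculating N N ?Pz (1 / t) $ 0 = poly (wronskian N P) (1 / t)"
    by (subst osculating_poly) (auto simp: wronskian_def)
  moreover have "(\<Prod>j<N. t ^ d * deriv (\<lambda>s. 1 / s) t ^ j) = t ^ (d * N) * (- (1 / t\<^sup>2)) ^ K"
    unfolding der K_def by (simp add: prod.distrib power_sum power_mult)
  moreover have "dim_vec (osculating N N ?Pz (1 / t)) = 1" by (simp add: osculating_def)
  ultimately have "poly (wronskian N (\<lambda>i. local_poly d Infty (P i))) t =
      t ^ (d * N) * (- (1 / t\<^sup>2)) ^ K * poly (wronskian N P) (1 / t)" by simp
  moreover have "t ^ (2 * K) * (- (1 / t\<^sup>2)) ^ K = (-1) ^ K"
    using t by (simp add: power_mult power_mult_distrib[symmetric])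
  ultimately have "t ^ (2 * K) * poly (wronskian N (\<lambda>i. local_poly d Infty (P i))) t =
      (-1) ^ K * (t ^ (d * N) * poly (wronskian N P) (1 / t))"
    by (simp add: mult_ac)
  then show "poly (monom 1 (2 * (\<Sum>b<N. b)) * wronskian N (\<lambda>i. local_poly d Infty (P i))) t =
    poly (smult ((-1) ^ (\<Sum>b<N. b)) (local_poly (d * N) Infty (wronskian N P))) t"
    using poly_flip[OF degree_wronskian[OF assms] t] by (simp add: K_def poly_monom)
qed

lemma wronskian_order_Plane:
  assumes ad: "adapted_basis N d P (Plane x) a C C'"
  shows "wronskian N P \<noteq> 0" "order x (wronskian N P) + (\<Sum>b<N. b) = (\<Sum>i<N. a i)"
proof -
  show "wronskian N P \<noteq> 0"
    using wronskian_order_adapted(1)[OF ad] unfolding wronskian_Plane by auto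
  from order_local_poly_Plane[OF this, of d x]
  show "order x (wronskian N P) + (\<Sum>b<N. b) = (\<Sum>i<N. a i)"
    using wronskian_order_adapted(2)[OF ad] unfolding wronskian_Plane by simp
qed

text \<open>Together with \<open>wronskian_order_Plane\<close> this is the Pluecker formula: the degree of the Wronskian is the
number of its roots, so the excesses of the sums of orders over \<open>0 + 1 + \<dots> + (N-1)\<close>
add up to \<open>N (d - N + 1)\<close> over the whole sphere.\<close>

lemma wronskian_degree_Infty:
  assumes ad: "adapted_basis N d P Infty a C C'" and deg: "\<forall>i<N. degree (P i) \<le> d"
  shows "degree (wronskian N P) + (\<Sum>b<N. b) + (\<Sum>i<N. a i) = d * N"
proof -
  let ?W = "wronskian N (\<lambda>i. local_poly d Infty (P i))" and ?K = "\<Sum>b<N. b :: nat"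
  have W: "?W \<noteq> 0" by (rule wronskian_order_adapted(1)[OF ad])
  then have nz: "monom 1 (2 * ?K) * ?W \<noteq> 0" by simp
  have W0: "wronskian N P \<noteq> 0"
    using nz unfolding wronskian_Infty[OF deg] by (auto simp: flip_def)
  have "2 * ?K + order 0 ?W = order 0 (monom 1 (2 * ?K) * ?W)"
    using order_mult[OF nz, of 0] by simp
  also have "\<dots> = d * N - degree (wronskian N P)"
    unfolding wronskian_Infty[OF deg]
    using order_local_poly_Infty[OF W0 degree_wronskian[OF deg]] by (simp add: order_smult del: local_poly.simps)
  finally show ?thesis
    using wronskian_order_adapted(2)[OF ad] degree_wronskian[OF deg] by simp
qed

lemma degree_eq_sum_order:
  fixes W :: "complex poly"
  assumes "W \<noteq> 0" "finite S" "\<And>z. z \<notin> S \<Longrightarrow> poly W z \<noteq> 0"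
  shows "degree W = (\<Sum>z\<in>S. order z W)"
proof -
  have "degree W = degree (smult (lead_coeff W) (\<Prod>z|poly W z = 0. [:-z, 1:] ^ order z W))"
    by (simp only: complex_poly_decompose)
  also have "\<dots> = (\<Sum>z|poly W z = 0. order z W)"
    using assms(1) by (simp add: degree_prod_eq_sum_degree degree_linear_power)
  also have "\<dots> = (\<Sum>z\<in>S. order z W)"
    using assms by (intro sum.mono_neutral_left) (auto simp: order_0I)
  finally show ?thesis .
qed

text \<open>Otherwise all \<open>P j\<close> would vanish at \<open>p\<close>.\<close>

lemma adapted_basis_0:
  assumes F: "poly_curve N d P F" and ad: "adapted_basis N d P p a C C'"
  shows "a 0 = 0"
proof (rule ccontr)
  assume a0: "a 0 \<noteq> 0"
  obtain U where U: "\<forall>i<N. local_poly d p (P i) = (\<Sum>l<N. smult (col C' l $ i) (monom 1 (a l) * U l))"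
    using adapted_basis_expand(1)[OF ad] by blast
  have "a l \<noteq> 0" if "l < N" for l
    using ad that a0 unfolding adapted_basis_def by (cases "l = 0") force+
  then have "poly (local_poly d p (P i)) 0 = 0" if "i < N" for i
    using U that by (auto simp: poly_sum poly_monom zero_power intro!: sum.neutral)
  then have "poly_lift N d P p 0 = 0\<^sub>v N" by (intro eq_vecI) auto
  then show False using poly_curve_param(1)[OF F] by blast
qed

lemma unramified_order_sum:
  assumes F: "poly_curve N d P F" and ad: "adapted_basis N d P p a C C'"
    and p: "p \<notin> ramified_points N F"
  shows "(\<Sum>i<N. a i) = (\<Sum>i<N. i)"
proof -
  have "a i = i" if "i < N" for i
    using that
  proof (induction i)
    case 0
    show ?case by (rule adapted_basis_0[OF F ad])
  next
    case (Suc i)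
    have "ramification_index N F (Suc i) p = 0"
      using p Suc.prems unfolding ramified_points_def by auto
    then have "a (Suc i) - a i - 1 = 0"
      using ramification_index_eq[OF F ad, of "Suc i"] Suc.prems by simp
    moreover have "a i < a (Suc i)"
      using ad Suc.prems unfolding adapted_basis_def by auto
    ultimately show ?case using Suc by simp
  qed
  then show ?thesis by (intro sum.cong) auto
qed

text \<open>At an unramified point the orders are \<open>0, 1, \<dots>, N-1\<close>, so the Wronskian does not vanish there. Only
\<open>p\<close> and \<open>q\<close> contribute to the Pluecker formula.\<close>

lemma order_sum_two_ramified_points:
  assumes F: "poly_curve N d P F" and li: "lin_indep_polys N P"
    and ram: "ramified_points N F \<subseteq> {p, q}" and pq: "p \<noteq> q"
    and p: "adapted_basis N d P p a C C'" and q: "adapted_basis N d P q b D D'"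
  shows "(\<Sum>i<N. a i) + (\<Sum>i<N. b i) = d * N"
proof -
  have deg: "\<forall>i<N. degree (P i) \<le> d" using F unfolding poly_curve_def by blast
  let ?W = "wronskian N P" and ?K = "\<Sum>b<N. b :: nat"
  have W0: "?W \<noteq> 0"
    using adapted_basis_exists[OF li deg, of "Plane 0"] wronskian_order_Plane(1) by blast
  have other: "order z ?W = 0" if "Plane z \<notin> {p, q}" for z
  proof -
    obtain c E E' where z: "adapted_basis N d P (Plane z) c E E'"
      using adapted_basis_exists[OF li deg] by blast
    have "Plane z \<notin> ramified_points N F" using ram that by blast
    from unramified_order_sum[OF F z this] show ?thesis
      using wronskian_order_Plane(2)[OF z] by simp
  qed
  have root: "poly ?W z \<noteq> 0" if "Plane z \<notin> {p, q}" for z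
    using other[OF that] W0 by (simp add: order_root)
  have one: "(\<Sum>i<N. a i) + (\<Sum>i<N. b i) = d * N"
    if pq: "p' = Plane x" "q' = Infty" "{p', q'} = {p, q}"
      and p: "adapted_basis N d P p' a C C'" and q: "adapted_basis N d P q' b D D'"
    for p' q' x a b C C' D D'
  proof -
    have "poly ?W z \<noteq> 0" if "z \<notin> {x}" for z using root[of z] pq that by auto
    then have "degree ?W = order x ?W" using degree_eq_sum_order[OF W0, of "{x}"] by simp
    then show ?thesis
      using wronskian_order_Plane(2)[of N d P x a C C'] wronskian_degree_Infty[of N d P b D D'] deg p q pq
      by simp
  qed
  show ?thesis
  proof (cases p)
    case (Plane x)
    show ?thesis
    proof (cases q)
      case q': (Plane y)
      obtain c E E' where inf: "adapted_basis N d P Infty c E E'"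
        using adapted_basis_exists[OF li deg] by blast
      have "Infty \<notin> ramified_points N F" using ram Plane q' by auto
      then have "(\<Sum>i<N. c i) = ?K" by (rule unramified_order_sum[OF F inf])
      then have "degree ?W + ?K + ?K = d * N" using wronskian_degree_Infty[OF inf deg] by simp
      moreover have "poly ?W z \<noteq> 0" if "z \<notin> {x, y}" for z using root[of z] Plane q' that by auto
      then have "degree ?W = (\<Sum>z\<in>{x, y}. order z ?W)" by (intro degree_eq_sum_order[OF W0]) auto
      then have "degree ?W = order x ?W + order y ?W" using pq Plane q' by simp
      ultimately show ?thesis
        using wronskian_order_Plane(2)[of N d P x a C C'] wronskian_order_Plane(2)[of N d P y b D D'] p q Plane q'
        by simp
    next
      case Infty
      then show ?thesis using one[OF Plane Infty _ p q] by simp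
    qed
  next
    case Infty
    then obtain y where y: "q = Plane y" using pq by (cases q) auto
    show ?thesis using one[OF y Infty _ q p] by (simp add: insert_commute add.commute)
  qed
qed

section \<open>Curves with two ramified points\<close>

lemma adapted_combination_dvd:
  assumes ad: "adapted_basis N d P p a C C'" and r: "r < N" and z: "\<And>l. l < r \<Longrightarrow> z l = 0"
    and c: "\<And>j. j < N \<Longrightarrow> c j = (\<Sum>l<N. z l * C $$ (l, j))"
  shows "monom 1 (a r) dvd local_poly d p (\<Sum>j<N. smult (c j) (P j))"
proof -
  let ?v = "\<lambda>l. \<Sum>j<N. smult (C $$ (l, j)) (P j)"
  have "(\<Sum>j<N. smult (c j) (P j)) = (\<Sum>j<N. \<Sum>l<N. smult (z l * C $$ (l, j)) (P j))"
    by (simp add: c smult_sum)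
  also have "\<dots> = (\<Sum>l<N. \<Sum>j<N. smult (z l * C $$ (l, j)) (P j))" by (rule sum.swap)
  also have "\<dots> = (\<Sum>l<N. smult (z l) (?v l))" by (simp add: smult_sum_right)
  finally have eq: "(\<Sum>j<N. smult (c j) (P j)) = (\<Sum>l<N. smult (z l) (?v l))" .
  have "monom 1 (a r) dvd smult (z l) (local_poly d p (?v l))" if l: "l < N" for l
  proof (cases "l < r")
    case True
    then show ?thesis using z by simp
  next
    case False
    then have "a r \<le> a l"
      using ad l unfolding adapted_basis_def by (cases "l = r") (auto intro: less_imp_le)
    then have "monom (1::complex) (a r) dvd monom 1 (a l)"
      by (metis dvdI le_add_diff_inverse mult.right_neutral mult_monom)
    moreover obtain U where "local_poly d p (?v l) = monom 1 (a l) * U"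
      using ad l unfolding adapted_basis_def by blast
    ultimately show ?thesis by (simp add: dvd_smult)
  qed
  then show ?thesis unfolding eq local_poly_lincomb by (intro dvd_sum) auto
qed

text \<open>The combinations that vanish at \<open>p\<close> to order at least \<open>a i\<close> form a space of dimension \<open>N - i\<close>, those that
vanish at \<open>q\<close> to order at least \<open>b (N - 1 - i)\<close> one of dimension \<open>i + 1\<close>. The dimensions add up to more than
\<open>N\<close>, so the two spaces have a common nonzero element.\<close>

lemma section_with_large_orders:
  assumes p: "adapted_basis N d P p a C C'" and q: "adapted_basis N d P q b D D'"
    and li: "lin_indep_polys N P" and i: "i < N"
  shows "\<exists>c. (\<Sum>j<N. smult (c j) (P j)) \<noteq> 0 \<and>
    monom 1 (a i) dvd local_poly d p (\<Sum>j<N. smult (c j) (P j)) \<and>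
    monom 1 (b (N - 1 - i)) dvd local_poly d q (\<Sum>j<N. smult (c j) (P j))"
proof -
  have C: "C \<in> carrier_mat N N" "C' \<in> carrier_mat N N" "C' * C = 1\<^sub>m N"
    and D: "D \<in> carrier_mat N N" "D' \<in> carrier_mat N N" "D * D' = 1\<^sub>m N"
    using p q unfolding adapted_basis_def by auto
  define M where "M = D * C'"
  have M: "M \<in> carrier_mat N N" using C D by (simp add: M_def)
  have MC: "M * C = D"
    unfolding M_def using C D by (simp add: assoc_mult_mat[of _ N N _ N _ N])
  define s where "s = N - 1 - i"
  \<comment> \<open>In the basis adapted to \<open>q\<close>, a section of order at least \<open>b s\<close> at \<open>q\<close> has \<open>i + 1\<close> coefficients,
    and order at least \<open>a i\<close> at \<open>p\<close> means \<open>i\<close> linear equations for them. A zero row makes the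
    system square, with determinant \<open>0\<close>.\<close>
  define Q where "Q = mat (Suc i) (Suc i) (\<lambda>(r, l). if r < i then M $$ (s + l, r) else 0)"
  have "det Q = 0"
    unfolding Q_def by (subst laplace_expansion_row[of _ "Suc i" i]) auto
  then obtain y where y: "y \<in> carrier_vec (Suc i)" "y \<noteq> 0\<^sub>v (Suc i)" "Q *\<^sub>v y = 0\<^sub>v (Suc i)"
    using det_0_iff_vec_prod_zero_field[of Q "Suc i"] by (auto simp: Q_def)
  define z where "z l = (if s \<le> l \<and> l < N then y $ (l - s) else 0)" for l
  define c where "c j = (\<Sum>l<N. z l * D $$ (l, j))" for j
  define \<xi> where "\<xi> r = (\<Sum>l<N. z l * M $$ (l, r))" for r
  have Ns: "N = s + Suc i" using i by (simp add: s_def)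
  have "\<xi> r = 0" if r: "r < i" for r
  proof -
    have "\<xi> r = (\<Sum>l\<in>{s..<N}. z l * M $$ (l, r))"
      unfolding \<xi>_def by (rule sum.mono_neutral_right) (auto simp: z_def)
    also have "\<dots> = (\<Sum>l\<in>{0..<Suc i}. z (s + l) * M $$ (s + l, r))"
      using sum.shift_bounds_nat_ivl[of "\<lambda>l. z l * M $$ (l, r)" 0 s "Suc i"] Ns by (simp add: add.commute)
    also have "\<dots> = (\<Sum>l\<in>{0..<Suc i}. Q $$ (r, l) * y $ l)"
      using r Ns by (intro sum.cong) (auto simp: z_def Q_def)
    also have "\<dots> = (Q *\<^sub>v y) $ r" using r y(1) by (simp add: Q_def scalar_prod_def del: sum.op_ivl_Suc)
    finally show ?thesis using y(3) r by simp
  qed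
  moreover have "c j = (\<Sum>r<N. \<xi> r * C $$ (r, j))" if j: "j < N" for j
  proof -
    have "c j = (\<Sum>l<N. z l * (\<Sum>r<N. M $$ (l, r) * C $$ (r, j)))"
      unfolding c_def by (intro sum.cong refl) (simp only: mat_mult_index_sum[OF M C(1) _ j, symmetric] MC lessThan_iff)
    also have "\<dots> = (\<Sum>l<N. \<Sum>r<N. z l * M $$ (l, r) * C $$ (r, j))"
      by (simp add: sum_distrib_left mult.assoc)
    also have "\<dots> = (\<Sum>r<N. \<xi> r * C $$ (r, j))"
      unfolding \<xi>_def by (subst sum.swap) (simp add: sum_distrib_right)
    finally show ?thesis .
  qed
  ultimately have 1: "monom 1 (a i) dvd local_poly d p (\<Sum>j<N. smult (c j) (P j))"
    by (intro adapted_combination_dvd[OF p i, where z = \<xi>])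
  have 2: "monom 1 (b s) dvd local_poly d q (\<Sum>j<N. smult (c j) (P j))"
    using i by (intro adapted_combination_dvd[OF q, where z = z]) (auto simp: c_def z_def s_def)
  have "(\<Sum>j<N. smult (c j) (P j)) \<noteq> 0"
  proof
    assume "(\<Sum>j<N. smult (c j) (P j)) = 0"
    then have c0: "c j = 0" if "j < N" for j using li that unfolding lin_indep_polys_def by blast
    have "z l' = 0" if l': "l' < N" for l'
    proof -
      have "0 = (\<Sum>j<N. c j * D' $$ (j, l'))" using c0 by simp
      also have "\<dots> = (\<Sum>j<N. \<Sum>l<N. z l * (D $$ (l, j) * D' $$ (j, l')))"
        unfolding c_def by (simp add: sum_distrib_right mult.assoc)
      also have "\<dots> = (\<Sum>l<N. z l * (\<Sum>j<N. D $$ (l, j) * D' $$ (j, l')))"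
        by (subst sum.swap) (simp add: sum_distrib_left)
      also have "\<dots> = (\<Sum>l<N. z l * (1\<^sub>m N :: complex mat) $$ (l, l'))"
        by (intro sum.cong refl) (simp only: mat_mult_index_sum[OF D(1,2) _ l', symmetric] D(3) lessThan_iff)
      also have "\<dots> = (\<Sum>l<N. if l = l' then z l' else 0)"
        using l' by (intro sum.cong) auto
      finally show ?thesis using l' by (simp add: sum.delta)
    qed
    then have "y $ l = 0" if "l < Suc i" for l
      using that Ns \<open>\<And>l'. l' < N \<Longrightarrow> z l' = 0\<close>[of "s + l"] by (simp add: z_def)
    then have "y = 0\<^sub>v (Suc i)" using y(1) by (intro eq_vecI) auto
    then show False using y(2) by simp
  qed
  with 1 2 show ?thesis unfolding s_def by blast
qed

text \<open>The polynomial whose only zero is a simple one at the given point, as a section of \<open>O(1)\<close>.\<close>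

fun point_section :: "riemann_sphere \<Rightarrow> complex poly" where
  "point_section (Plane x) = [:- x, 1:]"
| "point_section Infty = 1"

lemma two_point_section_aux:
  fixes v :: "complex poly"
  assumes v: "v \<noteq> 0" "degree v \<le> d" and q: "q \<noteq> Plane x"
    and 1: "monom 1 \<alpha> dvd local_poly d (Plane x) v" and 2: "monom 1 \<beta> dvd local_poly d q v"
  shows "\<alpha> + \<beta> \<le> d \<and> (\<alpha> + \<beta> = d \<longrightarrow>
    (\<exists>c. c \<noteq> 0 \<and> v = smult c (point_section (Plane x) ^ \<alpha> * point_section q ^ \<beta>)))"
proof -
  have nz: "local_poly d p' v \<noteq> 0" for p' using local_poly_eq_0_iff[OF v(2)] v(1) by blast
  have "\<alpha> \<le> order x v" using 1 monom_1_dvd_iff[OF nz] order_local_poly_Plane[OF v(1)] by metis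
  then have "[:- x, 1:] ^ \<alpha> dvd v" by (simp add: order_divides)
  then obtain u where u: "v = [:- x, 1:] ^ \<alpha> * u" by blast
  have u0: "u \<noteq> 0" using u v(1) by auto
  have dv: "degree v = \<alpha> + degree u"
    using u0 unfolding u by (subst degree_mult_eq) (simp_all add: degree_linear_power)
  have \<beta>: "\<beta> \<le> order 0 (local_poly d q v)" using 2 monom_1_dvd_iff[OF nz] by blast
  show ?thesis
  proof (cases q)
    case (Plane y)
    have "\<beta> \<le> order y v" using \<beta> order_local_poly_Plane[OF v(1)] Plane by metis
    also have "order y v = order y ([:- x, 1:] ^ \<alpha>) + order y u"
      using v(1) unfolding u by (rule order_mult)
    also have "order y ([:- x, 1:] ^ \<alpha>) = 0"
      using q Plane by (intro order_0I) simp
    finally have "[:- y, 1:] ^ \<beta> dvd u" by (simp add: order_divides)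
    then obtain w where w: "u = [:- y, 1:] ^ \<beta> * w" by blast
    have w0: "w \<noteq> 0" using w u0 by auto
    have du: "degree u = \<beta> + degree w"
      using w0 unfolding w by (subst degree_mult_eq) (simp_all add: degree_linear_power)
    show ?thesis
    proof (intro conjI impI)
      show "\<alpha> + \<beta> \<le> d" using dv du v(2) by simp
      assume "\<alpha> + \<beta> = d"
      then have "degree w = 0" using dv du v(2) by simp
      then obtain c where c: "w = [:c:]" by (metis degree_eq_zeroE)
      then have "v = smult c (point_section (Plane x) ^ \<alpha> * point_section q ^ \<beta>)"
        unfolding u w Plane by (simp add: mult_ac)
      then show "\<exists>c. c \<noteq> 0 \<and> v = smult c (point_section (Plane x) ^ \<alpha> * point_section q ^ \<beta>)"
        using c w0 by auto
    qed
  next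
    case Infty
    have "\<beta> \<le> d - degree v" using \<beta> order_local_poly_Infty[OF v] Infty by metis
    show ?thesis
    proof (intro conjI impI)
      show "\<alpha> + \<beta> \<le> d" using dv \<open>\<beta> \<le> d - degree v\<close> v(2) by simp
      assume "\<alpha> + \<beta> = d"
      then have "degree u = 0" using dv \<open>\<beta> \<le> d - degree v\<close> v(2) by simp
      then obtain c where c: "u = [:c:]" by (metis degree_eq_zeroE)
      then have "v = smult c (point_section (Plane x) ^ \<alpha> * point_section q ^ \<beta>)"
        unfolding u Infty by (simp add: mult_ac)
      then show "\<exists>c. c \<noteq> 0 \<and> v = smult c (point_section (Plane x) ^ \<alpha> * point_section q ^ \<beta>)"
        using c u0 by auto
    qed
  qed
qed

text \<open>A nonzero section of \<open>O(d)\<close> has exactly \<open>d\<close> zeros on the sphere, counted with multiplicity.\<close>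

lemma two_point_section:
  fixes v :: "complex poly"
  assumes v: "v \<noteq> 0" "degree v \<le> d" and pq: "p \<noteq> q"
    and 1: "monom 1 \<alpha> dvd local_poly d p v" and 2: "monom 1 \<beta> dvd local_poly d q v"
  shows "\<alpha> + \<beta> \<le> d"
    "\<alpha> + \<beta> = d \<Longrightarrow> \<exists>c. c \<noteq> 0 \<and> v = smult c (point_section p ^ \<alpha> * point_section q ^ \<beta>)"
proof -
  have "\<alpha> + \<beta> \<le> d \<and> (\<alpha> + \<beta> = d \<longrightarrow>
    (\<exists>c. c \<noteq> 0 \<and> v = smult c (point_section p ^ \<alpha> * point_section q ^ \<beta>)))"
  proof (cases p)
    case (Plane x)
    then show ?thesis using two_point_section_aux[OF v, of q x \<alpha> \<beta>] pq 1 2 by simp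
  next
    case Infty
    then obtain y where "q = Plane y" using pq by (cases q) auto
    then show ?thesis using two_point_section_aux[OF v, of p y \<beta> \<alpha>] pq 1 2 by (simp add: add.commute mult.commute)
  qed
  then show "\<alpha> + \<beta> \<le> d"
    "\<alpha> + \<beta> = d \<Longrightarrow> \<exists>c. c \<noteq> 0 \<and> v = smult c (point_section p ^ \<alpha> * point_section q ^ \<beta>)" by auto
qed

text \<open>In a vanishing combination the term of smallest order at \<open>x\<close> could not be cancelled.\<close>

lemma lin_indep_distinct_orders:
  assumes nz: "\<And>i. i < N \<Longrightarrow> q i \<noteq> 0" and inj: "inj_on (\<lambda>i. order x (q i)) {..<N}"
  shows "lin_indep_polys N q"
  unfolding lin_indep_polys_def
proof (intro allI impI)
  fix y i assume sum0: "(\<Sum>i<N. smult (y i) (q i)) = 0" and i: "i < N"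
  show "y i = 0"
  proof (rule ccontr)
    assume "y i \<noteq> 0"
    define I where "I = {i. i < N \<and> y i \<noteq> 0}"
    have I: "finite I" "i \<in> I" using i \<open>y i \<noteq> 0\<close> by (auto simp: I_def)
    obtain j where j: "j \<in> I" "\<And>l. l \<in> I \<Longrightarrow> order x (q j) \<le> order x (q l)"
      using ex_min_if_finite[of "(\<lambda>l. order x (q l)) ` I"] I by (auto simp: not_less)
    have jN: "j < N" "y j \<noteq> 0" using j(1) by (auto simp: I_def)
    have "[:- x, 1:] ^ Suc (order x (q j)) dvd smult (y l) (q l)" if l: "l \<in> {..<N} - {j}" for l
    proof (cases "y l = 0")
      case False
      then have "l \<in> I" using l by (simp add: I_def)
      then have "order x (q j) \<le> order x (q l)" by (rule j(2))
      moreover have "order x (q j) \<noteq> order x (q l)" using inj_onD[OF inj, of j l] l jN by auto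
      ultimately have "[:- x, 1:] ^ Suc (order x (q j)) dvd q l" by (simp only: order_divides) simp
      then show ?thesis by (rule dvd_smult)
    qed simp
    then have "[:- x, 1:] ^ Suc (order x (q j)) dvd (\<Sum>l\<in>{..<N} - {j}. smult (y l) (q l))"
      by (rule dvd_sum)
    moreover have "smult (y j) (q j) = - (\<Sum>l\<in>{..<N} - {j}. smult (y l) (q l))"
      using sum0 sum.remove[of "{..<N}" j "\<lambda>l. smult (y l) (q l)"] jN by (simp add: eq_neg_iff_add_eq_0)
    ultimately have "[:- x, 1:] ^ Suc (order x (q j)) dvd smult (y j) (q j)" by simp
    then have "[:- x, 1:] ^ Suc (order x (q j)) dvd q j" using jN(2) by (simp add: dvd_smult_iff)
    then show False using order_2[OF nz[OF jN(1)]] by blast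
  qed
qed

lemma point_section_nonzero: "point_section p \<noteq> 0"
  by (cases p) auto

lemma order_point_section: "order x (point_section p ^ n) = (if p = Plane x then n else 0)"
proof (cases p)
  case (Plane y)
  then show ?thesis by (auto simp: order_power_n_n intro!: order_0I)
qed simp

text \<open>At a finite one of the two points, the orders \<open>a i\<close> or \<open>d - a i\<close> are distinct.\<close>

lemma lin_indep_two_point_sections:
  assumes pq: "p \<noteq> q" and a: "inj_on a {..<N}" "\<And>i. i < N \<Longrightarrow> a i \<le> d"
  shows "lin_indep_polys N (\<lambda>i. point_section p ^ a i * point_section q ^ (d - a i))"
proof -
  let ?s = "\<lambda>i. point_section p ^ a i * point_section q ^ (d - a i)"
  have nz: "?s i \<noteq> 0" for i using point_section_nonzero by simp
  have ord: "order x (?s i) = (if p = Plane x then a i else 0) + (if q = Plane x then d - a i else 0)" for x i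
    using order_mult[OF nz] by (simp only: order_point_section)
  have "\<exists>x. p = Plane x \<or> q = Plane x" using pq by (cases p; cases q) auto
  then obtain x where x: "p = Plane x \<or> q = Plane x" by blast
  have "inj_on (\<lambda>i. order x (?s i)) {..<N}"
  proof (rule inj_onI)
    fix i j assume ij: "i \<in> {..<N}" "j \<in> {..<N}" "order x (?s i) = order x (?s j)"
    then have "a i = a j" using x pq a(2)[of i] a(2)[of j] unfolding ord by auto
    then show "i = j" using a(1) ij by (auto dest: inj_onD)
  qed
  with nz show ?thesis by (rule lin_indep_distinct_orders)
qed

lemma adapted_basis_inj:
  assumes "adapted_basis N d P p a C C'"
  shows "inj_on a {..<N}"
proof (rule inj_onI)
  fix i j assume "i \<in> {..<N}" "j \<in> {..<N}" "a i = a j"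
  then show "i = j"
    using assms unfolding adapted_basis_def by (metis lessThan_iff less_irrefl linorder_neqE_nat)
qed

lemma lin_indep_imp_invertible:
  assumes X: "X \<in> carrier_mat N N" and S: "lin_indep_polys N S"
    and eq: "\<And>i. i < N \<Longrightarrow> (\<Sum>j<N. smult (X $$ (i, j)) (P j)) = S i"
  shows "det X \<noteq> 0"
proof
  assume "det X = 0"
  then have "det (transpose_mat X) = 0" using det_transpose[OF X] by simp
  then obtain y where y: "y \<in> carrier_vec N" "y \<noteq> 0\<^sub>v N" "transpose_mat X *\<^sub>v y = 0\<^sub>v N"
    using det_0_iff_vec_prod_zero_field[of "transpose_mat X" N] X by auto
  have col0: "(\<Sum>i<N. y $ i * X $$ (i, j)) = 0" if j: "j < N" for j
  proof -
    have "(transpose_mat X *\<^sub>v y) $ j = (\<Sum>i<N. y $ i * X $$ (i, j))"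
      using X y(1) j by (simp add: scalar_prod_def atLeast0LessThan mult.commute)
    then show ?thesis using y(3) j by simp
  qed
  have "(\<Sum>i<N. smult (y $ i) (S i)) = (\<Sum>i<N. \<Sum>j<N. smult (y $ i * X $$ (i, j)) (P j))"
    using eq by (intro sum.cong refl) (simp add: smult_sum_right flip: eq)
  also have "\<dots> = (\<Sum>j<N. smult (\<Sum>i<N. y $ i * X $$ (i, j)) (P j))"
    by (subst sum.swap) (simp add: smult_sum)
  also have "\<dots> = 0" using col0 by simp
  finally have "y $ i = 0" if "i < N" for i
    using S that unfolding lin_indep_polys_def by blast
  then have "y = 0\<^sub>v N" using y(1) by (intro eq_vecI) auto
  then show False using y(2) by simp
qed

text \<open>The sections of \<open>section_with_large_orders\<close> give \<open>a i + b (N - 1 - i) \<le> d\<close> for all \<open>i\<close>. By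
\<open>order_sum_two_ramified_points\<close> the sum of these inequalities is an equality, hence so is each of
them, and each of these sections has no zeros besides \<open>p\<close> and \<open>q\<close>.\<close>

lemma two_ramified_points_normal_form:
  assumes F: "poly_curve N d P F" and li: "lin_indep_polys N P"
    and ram: "ramified_points N F \<subseteq> {p, q}" and pq: "p \<noteq> q"
    and p: "adapted_basis N d P p a C C'" and q: "adapted_basis N d P q b D D'"
  shows "\<forall>i<N. a i + b (N - 1 - i) = d"
    and "\<exists>X \<in> carrier_mat N N. det X \<noteq> 0 \<and>
      (\<forall>i<N. (\<Sum>j<N. smult (X $$ (i, j)) (P j)) = point_section p ^ a i * point_section q ^ (d - a i))"
proof -
  have deg: "\<forall>i<N. degree (P i) \<le> d" using F unfolding poly_curve_def by blast
  let ?v = "\<lambda>c. \<Sum>j<N. smult (c j) (P j)"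
  have "\<forall>i\<in>{..<N}. \<exists>c. ?v c \<noteq> 0 \<and> monom 1 (a i) dvd local_poly d p (?v c) \<and>
      monom 1 (b (N - 1 - i)) dvd local_poly d q (?v c)"
    using section_with_large_orders[OF p q li] by simp
  from bchoice[OF this] obtain c where c: "\<And>i. i < N \<Longrightarrow> ?v (c i) \<noteq> 0 \<and>
      monom 1 (a i) dvd local_poly d p (?v (c i)) \<and> monom 1 (b (N - 1 - i)) dvd local_poly d q (?v (c i))"
    by auto
  have le: "a i + b (N - 1 - i) \<le> d" if "i < N" for i
    using two_point_section(1)[OF _ degree_lincomb_le[OF deg] pq] c[OF that] by blast
  have "(\<Sum>i<N. a i + b (N - 1 - i)) = (\<Sum>i<N. a i) + (\<Sum>i<N. b i)"
    using sum.nat_diff_reindex[of b N] by (simp add: sum.distrib)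
  also have "\<dots> = (\<Sum>i<N. d)"
    using order_sum_two_ramified_points[OF F li ram pq p q] by (simp add: mult.commute)
  finally have total: "(\<Sum>i<N. a i + b (N - 1 - i)) = (\<Sum>i<N. d)" .
  show sum_eq: "\<forall>i<N. a i + b (N - 1 - i) = d"
  proof (rule ccontr)
    assume "\<not> (\<forall>i<N. a i + b (N - 1 - i) = d)"
    then obtain i where "i < N" "a i + b (N - 1 - i) < d" using le by (meson nat_less_le)
    then have "(\<Sum>i<N. a i + b (N - 1 - i)) < (\<Sum>i<N. d)"
      using le by (intro sum_strict_mono_ex1) auto
    then show False using total by simp
  qed
  let ?s = "\<lambda>i. point_section p ^ a i * point_section q ^ (d - a i)"
  have "\<forall>i\<in>{..<N}. \<exists>e. e \<noteq> 0 \<and> ?v (c i) = smult e (?s i)"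
  proof
    fix i assume i: "i \<in> {..<N}"
    then have ab: "a i + b (N - 1 - i) = d" using sum_eq by simp
    then have "b (N - 1 - i) = d - a i" by simp
    then show "\<exists>e. e \<noteq> 0 \<and> ?v (c i) = smult e (?s i)"
      using two_point_section(2)[OF _ degree_lincomb_le[OF deg] pq _ _ ab, of "c i"] c[of i] i by simp
  qed
  from bchoice[OF this] obtain e where e: "\<And>i. i < N \<Longrightarrow> e i \<noteq> 0 \<and> ?v (c i) = smult (e i) (?s i)" by auto
  define X where "X = mat N N (\<lambda>(i, j). c i j / e i)"
  have X: "X \<in> carrier_mat N N" by (simp add: X_def)
  have eq: "(\<Sum>j<N. smult (X $$ (i, j)) (P j)) = ?s i" if i: "i < N" for i
  proof -
    have "(\<Sum>j<N. smult (X $$ (i, j)) (P j)) = smult (1 / e i) (?v (c i))"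
      using i by (simp add: X_def smult_sum_right)
    then show ?thesis using e[OF i] by simp
  qed
  have "a i \<le> d" if "i < N" for i using le[OF that] by simp
  then have "lin_indep_polys N ?s"
    using adapted_basis_inj[OF p] by (intro lin_indep_two_point_sections[OF pq])
  from lin_indep_imp_invertible[OF X this eq]
  show "\<exists>X \<in> carrier_mat N N. det X \<noteq> 0 \<and> (\<forall>i<N. (\<Sum>j<N. smult (X $$ (i, j)) (P j)) = ?s i)"
    using X eq by blast
qed

lemma det_nonzero_inverse:
  fixes A :: "complex mat"
  assumes "A \<in> carrier_mat N N" "det A \<noteq> 0"
  obtains B where "B \<in> carrier_mat N N" "A * B = 1\<^sub>m N" "B * A = 1\<^sub>m N"
  using det_non_zero_imp_unit[OF assms, of "()"] unfolding Units_def ring_mat_def by auto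

lemma image_proj_class:
  fixes A :: "complex mat"
  assumes "A \<in> carrier_mat N N" "v \<in> carrier_vec N"
  shows "(\<lambda>v. A *\<^sub>v v) ` proj_class v = proj_class (A *\<^sub>v v)"
proof -
  have "A *\<^sub>v (c \<cdot>\<^sub>v v) = c \<cdot>\<^sub>v (A *\<^sub>v v)" for c
    using mult_mat_vec[OF assms] by simp
  then show ?thesis unfolding proj_class_def by (auto simp: image_iff) metis
qed

theorem corollary1p4:
  fixes n :: nat
    and f :: "riemann_sphere \<Rightarrow> complex vec set"
    and P1 P2 :: riemann_sphere
  assumes "holomorphic_curve (Suc n) f"
    and "linearly_nondegenerate (Suc n) f"
    and "P1 \<noteq> P2"
    and "ramified_points (Suc n) f = {P1, P2}"
  shows "(\<forall>j \<in> {1..n}.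
            ramification_index (Suc n) f j P1 = ramification_index (Suc n) f (n + 1 - j) P2) \<and>
         (\<forall>g. holomorphic_curve (Suc n) g \<and>
              linearly_nondegenerate (Suc n) g \<and>
              ramified_points (Suc n) g = {P1, P2} \<and>
              (\<forall>j \<in> {1..n}. \<forall>P \<in> {P1, P2}.
                 ramification_index (Suc n) f j P = ramification_index (Suc n) g j P) \<longrightarrow>
              (\<exists>A \<in> carrier_mat (Suc n) (Suc n).
                 invertible_mat A \<and> (\<forall>p. g p = (\<lambda>v. A *\<^sub>v v) ` f p)))"
proof -
  let ?N = "Suc n"
  have data: "\<exists>d P a b X. poly_curve ?N d P F \<and> a 0 = 0 \<and> b 0 = 0 \<and>
      (\<forall>i<n. a i < a (Suc i)) \<and>
      (\<forall>i<?N. a i + b (n - i) = d) \<and>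
      (\<forall>k\<in>{1..n}. ramification_index ?N F k P1 = a k - a (k - 1) - 1) \<and>
      (\<forall>k\<in>{1..n}. ramification_index ?N F k P2 = b k - b (k - 1) - 1) \<and>
      X \<in> carrier_mat ?N ?N \<and> det X \<noteq> 0 \<and>
      (\<forall>i<?N. (\<Sum>j<?N. smult (X $$ (i, j)) (P j)) = point_section P1 ^ a i * point_section P2 ^ (d - a i))"
    if hol: "holomorphic_curve ?N F" and nd: "linearly_nondegenerate ?N F"
      and ram: "ramified_points ?N F = {P1, P2}" for F
  proof -
    obtain d P where F: "poly_curve ?N d P F"
      using holomorphic_curve_imp_poly_curve[OF hol] by blast
    have li: "lin_indep_polys ?N P" by (rule nondegenerate_imp_lin_indep[OF F nd])
    have deg: "\<forall>i<?N. degree (P i) \<le> d" using F unfolding poly_curve_def by blast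
    obtain a C C' where p: "adapted_basis ?N d P P1 a C C'"
      using adapted_basis_exists[OF li deg] by blast
    obtain b D D' where q: "adapted_basis ?N d P P2 b D D'"
      using adapted_basis_exists[OF li deg] by blast
    have ram': "ramified_points ?N F \<subseteq> {P1, P2}" using ram by simp
    note nf = two_ramified_points_normal_form[OF F li ram' assms(3) p q]
    obtain X where X: "X \<in> carrier_mat ?N ?N" "det X \<noteq> 0 \<and>
      (\<forall>i<?N. (\<Sum>j<?N. smult (X $$ (i, j)) (P j)) = point_section P1 ^ a i * point_section P2 ^ (d - a i))"
      using nf(2) by (rule bexE)
    have ab: "\<forall>i<?N. a i + b (n - i) = d" using nf(1) by simp
    have inc: "\<forall>i<n. a i < a (Suc i)" using p unfolding adapted_basis_def by simp
    have index: "\<forall>k\<in>{1..n}. ramification_index ?N F k P1 = a k - a (k - 1) - 1"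
      "\<forall>k\<in>{1..n}. ramification_index ?N F k P2 = b k - b (k - 1) - 1"
      using ramification_index_eq[OF F p] ramification_index_eq[OF F q] by auto
    show ?thesis
      by (intro exI[of _ d] exI[of _ P] exI[of _ a] exI[of _ b] exI[of _ X] conjI
           F inc ab index X(1) X(2)[THEN conjunct1] X(2)[THEN conjunct2]
           adapted_basis_0[OF F p] adapted_basis_0[OF F q])
  qed
  obtain d P a b X where f: "poly_curve ?N d P f" "a 0 = 0" "b 0 = 0"
      "\<forall>i<n. a i < a (Suc i)" "\<forall>i<?N. a i + b (n - i) = d"
      "\<forall>k\<in>{1..n}. ramification_index ?N f k P1 = a k - a (k - 1) - 1"
      "\<forall>k\<in>{1..n}. ramification_index ?N f k P2 = b k - b (k - 1) - 1"
      "X \<in> carrier_mat ?N ?N" "det X \<noteq> 0"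
      "\<forall>i<?N. (\<Sum>j<?N. smult (X $$ (i, j)) (P j)) = point_section P1 ^ a i * point_section P2 ^ (d - a i)"
    using data[OF assms(1,2,4)] by (elim exE conjE)
  \<comment> \<open>The orders at \<open>P2\<close> are \<open>d\<close> minus the orders at \<open>P1\<close>, in reverse, so the gaps are reversed.\<close>
  have part1: "ramification_index ?N f j P1 = ramification_index ?N f (n + 1 - j) P2" if j: "j \<in> {1..n}" for j
  proof -
    have "a (j - 1) + b (n - (j - 1)) = d" "a j + b (n - j) = d"
      using f(5)[rule_format, of "j - 1"] f(5)[rule_format, of j] j by auto
    moreover have "n - (j - 1) = n + 1 - j" "n + 1 - j - 1 = n - j" "n + 1 - j \<in> {1..n}" using j by auto
    ultimately show ?thesis using f(6,7) j by simp
  qed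
  \<comment> \<open>Both curves have the same span of sections, so their lifts differ by a change of basis.\<close>
  have part2: "\<exists>A \<in> carrier_mat ?N ?N. invertible_mat A \<and> (\<forall>p. g p = (\<lambda>v. A *\<^sub>v v) ` f p)"
    if g: "holomorphic_curve ?N g" "linearly_nondegenerate ?N g" "ramified_points ?N g = {P1, P2}"
      and same: "\<forall>j \<in> {1..n}. \<forall>P \<in> {P1, P2}. ramification_index ?N f j P = ramification_index ?N g j P" for g
  proof -
    obtain d' P' a' b' Y where g': "poly_curve ?N d' P' g" "a' 0 = 0" "b' 0 = 0"
      "\<forall>i<n. a' i < a' (Suc i)" "\<forall>i<?N. a' i + b' (n - i) = d'"
      "\<forall>k\<in>{1..n}. ramification_index ?N g k P1 = a' k - a' (k - 1) - 1"
      "\<forall>k\<in>{1..n}. ramification_index ?N g k P2 = b' k - b' (k - 1) - 1"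
      "Y \<in> carrier_mat ?N ?N" "det Y \<noteq> 0"
      "\<forall>i<?N. (\<Sum>j<?N. smult (Y $$ (i, j)) (P' j)) = point_section P1 ^ a' i * point_section P2 ^ (d' - a' i)"
      using data[OF g] by (elim exE conjE)
    have aa: "a i = a' i" if "i < ?N" for i
      using that
    proof (induction i)
      case 0
      then show ?case using f(2) g'(2) by simp
    next
      case (Suc i)
      have "ramification_index ?N f (Suc i) P1 = ramification_index ?N g (Suc i) P1"
        using same Suc.prems by simp
      then have "a (Suc i) - a i - 1 = a' (Suc i) - a' i - 1"
        using f(6) g'(6) Suc.prems by simp
      moreover have "a i < a (Suc i)" "a' i < a' (Suc i)" using f(4) g'(4) Suc.prems by auto
      ultimately show ?case using Suc by simp
    qed
    have "a n + b 0 = d" "a' n + b' 0 = d'" using f(5) g'(5) by auto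
    \<comment> \<open>The degree is the largest order at \<open>P1\<close>, because the smallest order at \<open>P2\<close> is \<open>0\<close>.\<close>
    then have dd: "d = d'" using f(3) g'(3) aa[of n] by simp
    obtain Z where Z: "Z \<in> carrier_mat ?N ?N" "Y * Z = 1\<^sub>m ?N" "Z * Y = 1\<^sub>m ?N"
      by (rule det_nonzero_inverse[OF g'(8,9)])
    define A where "A = Z * X"
    have A: "A \<in> carrier_mat ?N ?N" using Z f(8) by (simp add: A_def)
    have P': "P' i = (\<Sum>j<?N. smult (A $$ (i, j)) (P j))" if i: "i < ?N" for i
    proof -
      let ?s = "\<lambda>i. point_section P1 ^ a i * point_section P2 ^ (d - a i)"
      have "P' i = (\<Sum>j<?N. if j = i then P' i else 0)" using i by (simp add: sum.delta del: sum.lessThan_Suc)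
      also have "\<dots> = (\<Sum>j<?N. smult ((Z * Y) $$ (i, j)) (P' j))"
        unfolding Z(3) using i by (intro sum.cong) auto
      also have "\<dots> = (\<Sum>j<?N. \<Sum>l<?N. smult (Z $$ (i, l) * Y $$ (l, j)) (P' j))"
        by (intro sum.cong refl) (simp only: lessThan_iff mat_mult_index_sum[OF Z(1) g'(8) i] smult_sum)
      also have "\<dots> = (\<Sum>l<?N. smult (Z $$ (i, l)) (\<Sum>j<?N. smult (Y $$ (l, j)) (P' j)))"
        by (subst sum.swap) (simp add: smult_sum_right del: sum.lessThan_Suc)
      also have "\<dots> = (\<Sum>l<?N. smult (Z $$ (i, l)) (\<Sum>j<?N. smult (X $$ (l, j)) (P j)))"
        using f(10) g'(10) aa dd by (intro sum.cong refl) simp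
      also have "\<dots> = (\<Sum>j<?N. \<Sum>l<?N. smult (Z $$ (i, l) * X $$ (l, j)) (P j))"
        by (subst sum.swap) (simp add: smult_sum_right del: sum.lessThan_Suc)
      also have "\<dots> = (\<Sum>j<?N. smult (A $$ (i, j)) (P j))"
        unfolding A_def by (intro sum.cong refl) (simp only: lessThan_iff mat_mult_index_sum[OF Z(1) f(8) i] smult_sum)
      finally show ?thesis .
    qed
    have lift: "poly_lift ?N d' P' p 0 = A *\<^sub>v poly_lift ?N d P p 0" for p
    proof (rule eq_vecI)
      fix i assume "i < dim_vec (A *\<^sub>v poly_lift ?N d P p 0)"
      then have i: "i < ?N" using A by simp
      have "poly (local_poly d' p (P' i)) 0 = (\<Sum>j<?N. A $$ (i, j) * poly (local_poly d p (P j)) 0)"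
        unfolding P'[OF i] dd[symmetric] local_poly_lincomb by (simp add: poly_sum del: sum.lessThan_Suc)
      then show "poly_lift ?N d' P' p 0 $ i = (A *\<^sub>v poly_lift ?N d P p 0) $ i"
        using i A by (simp add: scalar_prod_def atLeast0LessThan del: sum.lessThan_Suc sum.op_ivl_Suc)
    qed (use A in simp)
    have "g p = (\<lambda>v. A *\<^sub>v v) ` f p" for p
    proof -
      have "g p = proj_class (poly_lift ?N d' P' p 0)" "f p = proj_class (poly_lift ?N d P p 0)"
        using g'(1) f(1) unfolding poly_curve_def by auto
      then show ?thesis using lift image_proj_class[OF A, of "poly_lift ?N d P p 0"] by simp
    qed
    moreover have "invertible_mat A"
    proof -
      have "det Z * det Y = 1" using arg_cong[OF Z(3), of det] det_mult[OF Z(1) g'(8)] by simp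
      then have "det Z \<noteq> 0" by auto
      then have "det A \<noteq> 0" using det_mult[OF Z(1) f(8)] f(9) by (simp add: A_def)
      then obtain B where "B \<in> carrier_mat ?N ?N" "A * B = 1\<^sub>m ?N" "B * A = 1\<^sub>m ?N"
        by (rule det_nonzero_inverse[OF A])
      then show ?thesis
        using A unfolding invertible_mat_def inverts_mat_def square_mat.simps by auto
    qed
    ultimately show ?thesis using A by blast
  qed
  show ?thesis using part1 part2 by blast
qed

end
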